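(* Let $A = \varinjlim (A_n, \psi_n)$ be the $2^\infty$ UHF algebra, presented as the direct limit described in the context (Blackadar's construction), and let $\alpha \in \mathrm{Aut}(A)$ be the automorphism of order two which is the direct limit of the automorphisms $\alpha_n = \mathrm{Ad}(u_n)$ of $A_n$. Then $\alpha$ generates an action of $\mathbb{Z}/2\mathbb{Z}$ on $A$ with the tracial Rokhlin property.
   Context: Conventions: in any block matrix decomposition all blocks have the same size; $M_m \otimes M_n$ is identified with $M_{mn}$ by sending $a \otimes e_{j,k}$ to the $n \times n$ block matrix with $m \times m$ blocks whose $(j,k)$ block is $a$ and whose other blocks are zero. The circle $S^1$ is identified with $\mathbb{R}/\mathbb{Z}$, and elements of $C(S^1)$ are written as functions on $[0,1]$ with equal values at $0$ and $1$. Choose a continuous unitary path $c \in C([0,1], M_2)$ with $c(0) = 1$ and $c(1) = \begin{pmatrix} 0 & 1 \\ 1 & 0 \end{pmatrix}$. Define $\varphi^+ \colon C(S^1) \to C(S^1, M_2)$ by \[ \varphi^+(f)(t) = c(t) \begin{pmatrix} f(\tfrac12 t) & 0 \\ 0 & f(\tfrac12(t+1)) \end{pmatrix} c(t)^*, \] and $\varphi^- \colon C(S^1) \to C(S^1, M_2)$ by $\varphi^-(f)(t) = \varphi^+(f)(1-t)$. Use the same notation for the extensions $C(S^1, M_m) \to C(S^1, M_{2m})$ given by $\varphi^{\pm} \otimes \mathrm{id}_{M_m}$ (with $c(t)$ acting as a $2 \times 2$ block matrix with scalar $m \times m$ blocks). For $n \geq 1$ let $A_n = C(S^1, M_{4^n})$,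 let $u_n = \mathrm{diag}(1, -1) \in M_{4^n} \subset A_n$ (two blocks of equal size), let $\alpha_n = \mathrm{Ad}(u_n)$, and define $\psi_n \colon A_n \to A_{n+1}$ by \[ \psi_n \begin{pmatrix} f_{1,1} & f_{1,2} \\ f_{2,1} & f_{2,2} \end{pmatrix} = \begin{pmatrix} \varphi^+(f_{1,1}) & 0 & \varphi^+(f_{1,2}) & 0 \\ 0 & \varphi^-(f_{2,2}) & 0 & \varphi^-(f_{2,1}) \\ \varphi^+(f_{2,1}) & 0 & \varphi^+(f_{2,2}) & 0 \\ 0 & \varphi^-(f_{1,2}) & 0 & \varphi^-(f_{1,1}) \end{pmatrix}. \] By results of Blackadar, $A = \varinjlim (A_n, \psi_n)$ is the $2^\infty$ UHF algebra, and the $\alpha_n$ are compatible with the $\psi_n$ and define an automorphism $\alpha$ of $A$ with $\alpha^2 = \mathrm{id}_A$. Tracial Rokhlin property (form valid for finite algebras, action of $\mathbb{Z}/2\mathbb{Z}$ generated by $\alpha$ on a finite infinite dimensional simple unital C*-algebra $A$): for every finite set $F \subset A$, every $\varepsilon > 0$, and every nonzero positive $x \in A$, there are orthogonal projections $e_0, e_1 \in A$ such that: (i) $\| \alpha(e_0) - e_1 \| < \varepsilon$ and $\| \alpha(e_1) - e_0 \| < \varepsilon$; (ii) $\| e_j a - a e_j \| < \varepsilon$ for $j = 0, 1$ and all $a \in F$; (iii) the projection $1 - e_0 - e_1$ is Murray-von Neumann equivalent to a projection in the hereditary subalgebra of $A$ generated by $x$. *)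

theory Defs
  imports "HOL-Analysis.Analysis" "Jordan_Normal_Form.Schur_Decomposition"
begin

section \<open>Unital C*-algebras\<close>

text \<open>
  The distribution has real, but no complex, normed algebras; the complex scalar multiplication is
  therefore added here. Being an instance of \<^class>\<open>real_normed_algebra_1\<close>, these algebras are
  unital and nonzero.
\<close>

class cstar_algebra = real_normed_algebra_1 + banach +
  fixes cscale :: "complex \<Rightarrow> 'a \<Rightarrow> 'a"
    and star :: "'a \<Rightarrow> 'a"
  assumes cscale_add_right: "cscale a (x + y) = cscale a x + cscale a y"
    and cscale_add_left: "cscale (a + b) x = cscale a x + cscale b x"
    and cscale_cscale: "cscale a (cscale b x) = cscale (a * b) x"
    and cscale_of_real: "cscale (complex_of_real r) x = r *\<^sub>R x"
    and mult_cscale_left: "cscale a x * y = cscale a (x * y)"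
    and mult_cscale_right: "x * cscale a y = cscale a (x * y)"
    and norm_cscale: "norm (cscale a x) = cmod a * norm x"
    and star_add: "star (x + y) = star x + star y"
    and star_cscale: "star (cscale a x) = cscale (cnj a) (star x)"
    and star_mult: "star (x * y) = star y * star x"
    and star_star: "star (star x) = x"
    and cstar_identity: "norm (star x * x) = (norm x)\<^sup>2"

definition star_automorphism :: "('a::cstar_algebra \<Rightarrow> 'a) \<Rightarrow> bool" where
  "star_automorphism \<alpha> \<longleftrightarrow> bij \<alpha> \<and>
     (\<forall>x y. \<alpha> (x + y) = \<alpha> x + \<alpha> y) \<and> (\<forall>a x. \<alpha> (cscale a x) = cscale a (\<alpha> x)) \<and>
     (\<forall>x y. \<alpha> (x * y) = \<alpha> x * \<alpha> y) \<and> (\<forall>x. \<alpha> (star x) = star (\<alpha> x))"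

definition order_two_automorphism :: "('a::cstar_algebra \<Rightarrow> 'a) \<Rightarrow> bool" where
  "order_two_automorphism \<alpha> \<longleftrightarrow> star_automorphism \<alpha> \<and> \<alpha> \<circ> \<alpha> = id \<and> \<alpha> \<noteq> id"

definition positive :: "'a::cstar_algebra \<Rightarrow> bool" where
  "positive x \<longleftrightarrow> (\<exists>y. x = star y * y)"

definition projection :: "'a::cstar_algebra \<Rightarrow> bool" where
  "projection p \<longleftrightarrow> star p = p \<and> p * p = p"

definition murray_von_neumann :: "'a::cstar_algebra \<Rightarrow> 'a \<Rightarrow> bool" where
  "murray_von_neumann p q \<longleftrightarrow> (\<exists>v. star v * v = p \<and> v * star v = q)"

definition cstar_subalgebra :: "'a::cstar_algebra set \<Rightarrow> bool" where
  "cstar_subalgebra B \<longleftrightarrow> closed B \<and> 0 \<in> B \<and>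
     (\<forall>x\<in>B. \<forall>y\<in>B. x + y \<in> B \<and> x * y \<in> B) \<and> (\<forall>a. \<forall>x\<in>B. cscale a x \<in> B) \<and>
     (\<forall>x\<in>B. star x \<in> B)"

definition hereditary_subalgebra :: "'a::cstar_algebra set \<Rightarrow> bool" where
  "hereditary_subalgebra B \<longleftrightarrow> cstar_subalgebra B \<and>
     (\<forall>a. \<forall>b\<in>B. positive a \<and> positive (b - a) \<longrightarrow> a \<in> B)"

definition hereditary_generated :: "'a::cstar_algebra \<Rightarrow> 'a set" where
  "hereditary_generated x = \<Inter>{B. hereditary_subalgebra B \<and> x \<in> B}"

text \<open>
  The tracial Rokhlin property, in the form valid for finite algebras, of the action of
  \<open>\<int>/2\<int>\<close> generated by \<open>\<alpha>\<close>.
\<close>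

definition tracial_Rokhlin_Z2 :: "('a::cstar_algebra \<Rightarrow> 'a) \<Rightarrow> bool" where
  "tracial_Rokhlin_Z2 \<alpha> \<longleftrightarrow>
     (\<forall>F \<epsilon> x. finite F \<and> \<epsilon> > 0 \<and> positive x \<and> x \<noteq> 0 \<longrightarrow>
       (\<exists>e0 e1. projection e0 \<and> projection e1 \<and> e0 * e1 = 0 \<and>
          norm (\<alpha> e0 - e1) < \<epsilon> \<and> norm (\<alpha> e1 - e0) < \<epsilon> \<and>
          (\<forall>a\<in>F. norm (e0 * a - a * e0) < \<epsilon> \<and> norm (e1 * a - a * e1) < \<epsilon>) \<and>
          (\<exists>q. projection q \<and> q \<in> hereditary_generated x \<and>
               murray_von_neumann (1 - e0 - e1) q)))"


section \<open>The algebras \<open>C(S\<^sup>1, M\<^sub>N)\<close>\<close>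

text \<open>
  Elements are functions on \<open>[0,1]\<close> with equal values at the end points, made extensional (value
  \<^const>\<open>undefined\<close> outside \<open>[0,1]\<close>) so that equality of functions is equality in the algebra.
\<close>

type_synonym circle_mat = "real \<Rightarrow> complex mat"

definition circle_algebra :: "nat \<Rightarrow> circle_mat set" where
  "circle_algebra N = {f \<in> {0..1} \<rightarrow>\<^sub>E carrier_mat N N. f 0 = f 1 \<and>
     (\<forall>i<N. \<forall>j<N. continuous_on {0..1} (\<lambda>t. f t $$ (i, j)))}"

definition circle_one :: "nat \<Rightarrow> circle_mat" where
  "circle_one N = (\<lambda>t\<in>{0..1}. 1\<^sub>m N)"

definition circle_add :: "circle_mat \<Rightarrow> circle_mat \<Rightarrow> circle_mat" where
  "circle_add f g = (\<lambda>t\<in>{0..1}. f t + g t)"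

definition circle_mult :: "circle_mat \<Rightarrow> circle_mat \<Rightarrow> circle_mat" where
  "circle_mult f g = (\<lambda>t\<in>{0..1}. f t * g t)"

definition circle_scale :: "complex \<Rightarrow> circle_mat \<Rightarrow> circle_mat" where
  "circle_scale a f = (\<lambda>t\<in>{0..1}. a \<cdot>\<^sub>m f t)"

definition circle_star :: "circle_mat \<Rightarrow> circle_mat" where
  "circle_star f = (\<lambda>t\<in>{0..1}. mat_adjoint (f t))"

definition euclidean_norm :: "complex vec \<Rightarrow> real" where
  "euclidean_norm v = sqrt (\<Sum>i<dim_vec v. (cmod (vec_index v i))\<^sup>2)"

definition operator_norm :: "complex mat \<Rightarrow> real" where
  "operator_norm M =
     (SUP v\<in>{v \<in> carrier_vec (dim_col M). euclidean_norm v \<le> 1}. euclidean_norm (mult_mat_vec M v))"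

definition circle_norm :: "circle_mat \<Rightarrow> real" where
  "circle_norm f = (SUP t\<in>{0..1}. operator_norm (f t))"

definition circle_star_hom :: "nat \<Rightarrow> (circle_mat \<Rightarrow> 'a::cstar_algebra) \<Rightarrow> bool" where
  "circle_star_hom N h \<longleftrightarrow> h (circle_one N) = 1 \<and>
     (\<forall>f\<in>circle_algebra N. \<forall>g\<in>circle_algebra N.
        h (circle_add f g) = h f + h g \<and> h (circle_mult f g) = h f * h g) \<and>
     (\<forall>a. \<forall>f\<in>circle_algebra N. h (circle_scale a f) = cscale a (h f)) \<and>
     (\<forall>f\<in>circle_algebra N. h (circle_star f) = star (h f))"


section \<open>Blackadar's direct system\<close>

definition swap_path :: "(real \<Rightarrow> complex mat) \<Rightarrow> bool" where
  "swap_path c \<longleftrightarrow>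
     (\<forall>t\<in>{0..1}. c t \<in> carrier_mat 2 2 \<and>
        c t * mat_adjoint (c t) = 1\<^sub>m 2 \<and> mat_adjoint (c t) * c t = 1\<^sub>m 2) \<and>
     (\<forall>i<2. \<forall>j<2. continuous_on {0..1} (\<lambda>t. c t $$ (i, j))) \<and>
     c 0 = 1\<^sub>m 2 \<and> c 1 = mat_of_rows_list 2 [[0, 1], [1, 0]]"

text \<open>The \<open>2 \<times> 2\<close> block matrix with the entries of \<open>c\<close> as scalar \<open>m \<times> m\<close> blocks.\<close>

definition inflate :: "nat \<Rightarrow> complex mat \<Rightarrow> complex mat" where
  "inflate m c = four_block_mat
     (c $$ (0, 0) \<cdot>\<^sub>m 1\<^sub>m m) (c $$ (0, 1) \<cdot>\<^sub>m 1\<^sub>m m)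
     (c $$ (1, 0) \<cdot>\<^sub>m 1\<^sub>m m) (c $$ (1, 1) \<cdot>\<^sub>m 1\<^sub>m m)"

text \<open>
  The maps \<open>\<phi>\<^sup>+\<close> and \<open>\<phi>\<^sup>-\<close> from \<open>C(S\<^sup>1, M\<^sub>m)\<close> to \<open>C(S\<^sup>1, M\<^sub>2\<^sub>m)\<close>.
\<close>

definition phi_plus :: "(real \<Rightarrow> complex mat) \<Rightarrow> nat \<Rightarrow> circle_mat \<Rightarrow> circle_mat" where
  "phi_plus c m f = (\<lambda>t\<in>{0..1}.
     inflate m (c t) *
     four_block_mat (f (t / 2)) (0\<^sub>m m m) (0\<^sub>m m m) (f ((t + 1) / 2)) *
     mat_adjoint (inflate m (c t)))"

definition phi_minus :: "(real \<Rightarrow> complex mat) \<Rightarrow> nat \<Rightarrow> circle_mat \<Rightarrow> circle_mat" where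
  "phi_minus c m f = (\<lambda>t\<in>{0..1}. phi_plus c m f (1 - t))"

text \<open>The \<open>m \<times> m\<close> block of \<open>f\<close> in position \<open>(i, j)\<close>, where \<open>i\<close> and \<open>j\<close> count from \<open>0\<close>.\<close>

definition block :: "nat \<Rightarrow> circle_mat \<Rightarrow> nat \<Rightarrow> nat \<Rightarrow> circle_mat" where
  "block m f i j = (\<lambda>t\<in>{0..1}. mat m m (\<lambda>(r, s). f t $$ (i * m + r, j * m + s)))"

abbreviation stage_algebra :: "nat \<Rightarrow> circle_mat set" where
  "stage_algebra n \<equiv> circle_algebra (4 ^ n)"

text \<open>The \<open>4 \<times> 4\<close> block matrix is written as a \<open>2 \<times> 2\<close> array of \<open>2 \<times> 2\<close> arrays.\<close>

definition psi :: "(real \<Rightarrow> complex mat) \<Rightarrow> nat \<Rightarrow> circle_mat \<Rightarrow> circle_mat" where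
  "psi c n f = (\<lambda>t\<in>{0..1}.
     let m = 4 ^ n div 2;
         p = (\<lambda>i j. phi_plus c m (block m f i j) t);
         q = (\<lambda>i j. phi_minus c m (block m f i j) t);
         z = 0\<^sub>m (2 * m) (2 * m)
     in four_block_mat
          (four_block_mat (p 0 0) z z (q 1 1)) (four_block_mat (p 0 1) z z (q 1 0))
          (four_block_mat (p 1 0) z z (q 0 1)) (four_block_mat (p 1 1) z z (q 0 0)))"

definition sign_unitary :: "nat \<Rightarrow> complex mat" where
  "sign_unitary n = (let m = 4 ^ n div 2 in four_block_mat (1\<^sub>m m) (0\<^sub>m m m) (0\<^sub>m m m) (- 1\<^sub>m m))"

definition alpha :: "nat \<Rightarrow> circle_mat \<Rightarrow> circle_mat" where
  "alpha n f = (\<lambda>t\<in>{0..1}. sign_unitary n * f t * mat_adjoint (sign_unitary n))"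


section \<open>Direct limits\<close>

fun connecting :: "(nat \<Rightarrow> circle_mat \<Rightarrow> circle_mat) \<Rightarrow> nat \<Rightarrow> nat \<Rightarrow> circle_mat \<Rightarrow> circle_mat" where
  "connecting \<psi> n 0 f = f"
| "connecting \<psi> n (Suc k) f = \<psi> (n + k) (connecting \<psi> n k f)"

text \<open>
  The type \<^typ>\<open>'a\<close>, with the maps \<open>\<phi> n\<close> from \<open>stage_algebra n\<close>, is the C*-algebraic direct
  limit of the system \<open>\<psi> n\<close>, \<open>n \<ge> 1\<close>: the completion of the algebraic direct limit (which is
  the union of the ranges of the \<open>\<phi> n\<close>) in the C*-norm given by the limits of the norms along the
  system. These conditions determine the limit up to a unique isomorphism compatible with the maps.
\<close>

definition direct_limit ::
  "(nat \<Rightarrow> circle_mat \<Rightarrow> circle_mat) \<Rightarrow> (nat \<Rightarrow> circle_mat \<Rightarrow> 'a::cstar_algebra) \<Rightarrow> bool" where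
  "direct_limit \<psi> \<phi> \<longleftrightarrow>
     (\<forall>n\<ge>1. circle_star_hom (4 ^ n) (\<phi> n)) \<and>
     (\<forall>n\<ge>1. \<forall>f\<in>stage_algebra n. \<phi> (Suc n) (\<psi> n f) = \<phi> n f) \<and>
     (\<forall>n\<ge>1. \<forall>f\<in>stage_algebra n. (\<lambda>k. circle_norm (connecting \<psi> n k f)) \<longlonglongrightarrow> norm (\<phi> n f)) \<and>
     closure (\<Union>n\<in>{1..}. \<phi> n ` stage_algebra n) = UNIV"

text \<open>
  The map \<open>\<alpha>\<close> is the direct limit of the maps \<open>\<beta> n\<close> of the algebras \<open>stage_algebra n\<close>: the
  continuous extension of the map that they induce on the union of the ranges of the \<open>\<phi> n\<close>.
\<close>

definition limit_map ::
  "(nat \<Rightarrow> circle_mat \<Rightarrow> circle_mat) \<Rightarrow> (nat \<Rightarrow> circle_mat \<Rightarrow> 'a::cstar_algebra) \<Rightarrow>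
   ('a \<Rightarrow> 'a) \<Rightarrow> bool" where
  "limit_map \<beta> \<phi> \<alpha> \<longleftrightarrow> continuous_on UNIV \<alpha> \<and>
     (\<forall>n\<ge>1. \<forall>f\<in>stage_algebra n. \<alpha> (\<phi> n f) = \<phi> n (\<beta> n f))"

end

theory Submission
  imports Defs
begin

text \<open>
  The composite of \<open>k\<close> connecting maps out of \<open>A\<^sub>n\<close> is, up to a continuous choice of frames, a direct
  sum of \<open>2\<^sup>k\<close> sheets, one for each word \<open>w\<close> in \<open>\<phi>\<^sup>+\<close> and \<open>\<phi>\<^sup>-\<close>: on the sheet of \<open>w\<close> it is the push-forward
  along the covering \<open>s \<mapsto> \<plusminus>2\<^sup>k s\<close> of the circle, where the sign is the product of the signs in \<open>w\<close>, and
  \<open>\<alpha>\<close> acts on that sheet by \<open>u\<^sub>n\<close> times this sign. So elements of \<open>A\<^bsub>n+k\<^esub>\<close> are matrix-valued kernels on the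
  fibres of the coverings that are compatible with the monodromy.

  Cut the circle into \<open>K\<close> short arcs, \<open>2\<^sup>k = K L\<close>, so that each fibre meets each arc in \<open>L\<close> points. A sheet
  is matched with one of opposite sign by reflecting every arc. The two sheets move through an arc in
  opposite directions; therefore the matching is compatible with the monodromy only after removal of
  one dimension per arc, spanned by \<open>\<surd>(1 - t) e\<^sub>0 + \<surd>t e\<^bsub>L-1\<^esub>\<close>. On what remains, the graphs of plus and
  minus the matching are projections \<open>e\<^sub>0\<close> and \<open>e\<^sub>1\<close>, which \<open>\<alpha>\<close> exchanges exactly and which almost commute with
  \<open>A\<^sub>n\<close> because arcs are short. Each sheet of \<open>2\<^sup>k\<close> points loses only \<open>K\<close> dimensions; for large \<open>L\<close> they fit
  next to a point of the circle at which a given positive element is close to its norm.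
\<close>

section \<open>Inverse square roots and hereditary subalgebras\<close>

text \<open>Why the circle is cut at all: matching a positive and a negative sheet by one global
  reflection \<open>s \<mapsto> - s\<close> would respect the monodromy without any loss, but it
  moves points far, so the resulting projections would not almost commute with A_n. A matching of
  nearby points that keeps the direction along the circle is broken at once, as the two sheets
  rotate oppositely. Reflecting short arcs separately is the compromise: it fails only where a point
  leaves one arc for the next. The weights sqrt(1 - t) and sqrt t form a path of unit vectors from
  the first to the last point of an arc, and one turn carries the last point of an arc to the first
  point of the next. So the removed vectors close up, and so does what remains. K is fixed by the
  modulus of continuity of the approximants of the finite set, L only afterwards, by K and the
  positive element. Each of the K 4^n dimensions lost on a sheet gets its own two points near the
  peak of the positive element, so 2 K 4^n has to be small against 2^k = K L; one vector that nearly
  attains the norm serves at all these points.\<close>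

lemma star_zero [simp]: "star (0::'a::cstar_algebra) = 0"
  using star_add[of "0::'a" 0] by simp

lemma star_minus: "star (- x) = - star (x::'a::cstar_algebra)"
  using star_add[of x "- x"] by (simp add: eq_neg_iff_add_eq_0 add.commute)

lemma star_diff: "star (x - y) = star x - star (y::'a::cstar_algebra)"
  using star_add[of x "- y"] by (simp add: star_minus)

lemma star_one [simp]: "star (1::'a::cstar_algebra) = 1"
  using star_mult[of "star 1" "1::'a"] by (simp add: star_star)

lemma star_scaleR: "star (r *\<^sub>R x) = r *\<^sub>R star (x::'a::cstar_algebra)"
  using star_cscale[of "complex_of_real r" x] by (simp add: cscale_of_real)

lemma norm_star [simp]: "norm (star x) = norm (x::'a::cstar_algebra)"
proof -
  have le: "norm y \<le> norm (star y)" for y :: 'a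
  proof (cases "y = 0")
    case False
    have "norm y * norm y \<le> norm (star y) * norm y"
      using norm_mult_ineq[of "star y" y] by (simp add: cstar_identity power2_eq_square)
    then show ?thesis using False by simp
  qed simp
  show ?thesis using le[of x] le[of "star x"] by (simp add: star_star)
qed

lemma bounded_linear_star: "bounded_linear (star :: 'a \<Rightarrow> 'a::cstar_algebra)"
  by (rule bounded_linear_intro[where K = 1]) (simp_all add: star_add star_scaleR)

lemma bounded_linear_cscale: "bounded_linear (cscale a :: 'a \<Rightarrow> 'a::cstar_algebra)"
proof (rule bounded_linear_intro[where K = "cmod a"])
  show "cscale a (r *\<^sub>R x) = r *\<^sub>R cscale a x" for r and x :: 'a
    by (simp add: cscale_of_real[symmetric] cscale_cscale mult.commute)
qed (simp_all add: cscale_add_right norm_cscale mult.commute)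

lemma norm_projection_le_1: "projection (p::'a::cstar_algebra) \<Longrightarrow> norm p \<le> 1"
  using cstar_identity[of p] unfolding projection_def
  by (metis mult_cancel_left2 norm_ge_zero order.refl power2_eq_square zero_le_one)

lemma power_commutes_with:
  fixes y h :: "'a::monoid_mult"
  assumes "y * h = h * y" shows "y * h ^ k = h ^ k * y"
  by (induction k) (simp_all add: assms mult.assoc, metis assms mult.assoc)

lemma star_power: "star (x ^ k) = star (x::'a::cstar_algebra) ^ k"
  by (induction k) (simp_all add: star_mult power_commutes)

text \<open>The Taylor coefficients of 1 - x to the power -1/2; the sign factor turns the
  alternating binomial coefficients into positive numbers.\<close>

definition inv_sqrt_coeff :: "nat \<Rightarrow> real" where
  "inv_sqrt_coeff k = (- 1) ^ k * ((- 1 / 2) gchoose k)"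

lemma abs_inv_sqrt_coeff_le_1: "\<bar>inv_sqrt_coeff k\<bar> \<le> 1"
proof (induction k)
  case (Suc k)
  have "((- 1 / 2 :: real) gchoose Suc k) = ((- 1 / 2) gchoose k) * ((- 1 / 2 - real k) / (real k + 1))"
    using gbinomial_mult_1[of "- 1 / 2 :: real" k] by (simp add: field_simps)
  then have "\<bar>inv_sqrt_coeff (Suc k)\<bar> = \<bar>inv_sqrt_coeff k\<bar> * \<bar>(- 1 / 2 - real k) / (real k + 1)\<bar>"
    by (simp add: inv_sqrt_coeff_def abs_mult)
  also have "\<bar>(- 1 / 2 - real k) / (real k + 1)\<bar> \<le> 1" by (simp add: field_simps)
  then have "\<bar>inv_sqrt_coeff k\<bar> * \<bar>(- 1 / 2 - real k) / (real k + 1)\<bar> \<le> 1 * 1"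
    using Suc by (intro mult_mono) auto
  finally show ?case by simp
qed (simp add: inv_sqrt_coeff_def)

text \<open>The square of the series for 1 - x to the power -1/2 is the geometric series; on
  coefficients this is the Vandermonde identity with both exponents -1/2.\<close>

lemma inv_sqrt_coeff_convolution: "(\<Sum>i\<le>k. inv_sqrt_coeff i * inv_sqrt_coeff (k - i)) = 1"
proof -
  have "(\<Sum>i\<le>k. inv_sqrt_coeff i * inv_sqrt_coeff (k - i)) =
      (\<Sum>i\<le>k. (- 1) ^ k * (((- 1 / 2) gchoose i) * ((- 1 / 2) gchoose (k - i))))"
    by (rule sum.cong) (auto simp: inv_sqrt_coeff_def power_add[symmetric] mult_ac)
  also have "\<dots> = (- 1) ^ k * ((- 1 :: real) gchoose k)"
    using gbinomial_Vandermonde[of "- 1 / 2 :: real" "- 1 / 2" k]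
    by (simp add: sum_distrib_left[symmetric] atMost_atLeast0)
  also have "\<dots> = 1"
    using gbinomial_minus[of "1::real" k] by (simp add: gbinomial_of_nat_symmetric[of k k, simplified] flip: of_nat_add binomial_gbinomial power_add)
  finally show ?thesis .
qed

text \<open>The coefficients are at most 1, so the binomial series in \<open>h\<close> is dominated
  by the geometric series in \<open>norm h\<close>. The commutation clause holds termwise; it is
  applied to the unit of a corner as well as to \<open>h\<close> itself.\<close>

lemma cstar_inverse_sqrt:
  fixes h :: "'a::cstar_algebra"
  assumes h: "norm h < 1" "star h = h"
  obtains b where "star b = b" "b * b * (1 - h) = 1" "\<And>y. y * h = h * y \<Longrightarrow> y * b = b * y"
proof -
  define c where "c k = inv_sqrt_coeff k *\<^sub>R h ^ k" for k
  define b where "b = (\<Sum>k. c k)"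
  have sg: "summable (\<lambda>k. norm h ^ k)" using h by (simp add: summable_geometric)
  have sn: "summable (\<lambda>k. norm (c k))"
  proof (rule summable_comparison_test'[OF sg])
    show "norm (norm (c k)) \<le> norm h ^ k" for k
      using mult_mono[OF abs_inv_sqrt_coeff_le_1[of k] norm_power_ineq[of h k]]
      by (simp add: c_def)
  qed
  have s: "summable c" using sn by (rule summable_norm_cancel)
  have shn: "summable (\<lambda>k. norm (h ^ k))"
    by (rule summable_comparison_test'[OF sg]) (simp add: norm_power_ineq)
  have sh: "summable (\<lambda>k. h ^ k)" using shn by (rule summable_norm_cancel)
  have "star b = (\<Sum>k. star (c k))"
    unfolding b_def by (rule bounded_linear.suminf[OF bounded_linear_star s])
  also have "\<dots> = b" by (simp add: b_def c_def star_scaleR star_power h)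
  finally have 1: "star b = b" .
  have "b * b = (\<Sum>k. \<Sum>i\<le>k. c i * c (k - i))"
    unfolding b_def by (rule Cauchy_product[OF sn sn])
  also have "(\<lambda>k. \<Sum>i\<le>k. c i * c (k - i)) = (\<lambda>k. h ^ k)"
  proof
    fix k
    have "(\<Sum>i\<le>k. c i * c (k - i)) = (\<Sum>i\<le>k. (inv_sqrt_coeff i * inv_sqrt_coeff (k - i)) *\<^sub>R h ^ k)"
      by (rule sum.cong) (auto simp: c_def power_add[symmetric])
    then show "(\<Sum>i\<le>k. c i * c (k - i)) = h ^ k"
      by (simp add: scaleR_left.sum[symmetric] inv_sqrt_coeff_convolution)
  qed
  finally have bb: "b * b = (\<Sum>k. h ^ k)" .
  have "(\<Sum>k. h ^ k) * h = (\<Sum>k. h ^ k * h)" by (rule suminf_mult2[OF sh])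
  also have "\<dots> = (\<Sum>k. h ^ Suc k)" by (simp add: power_commutes)
  also have "\<dots> = (\<Sum>k. h ^ k) - 1" using suminf_split_head[OF sh] by simp
  finally have 2: "b * b * (1 - h) = 1" by (simp add: bb algebra_simps)
  have 3: "y * b = b * y" if "y * h = h * y" for y
  proof -
    have "y * c k = c k * y" for k
      using power_commutes_with[OF that, of k] by (simp add: c_def)
    then show ?thesis
      unfolding b_def by (simp add: suminf_mult[OF s, symmetric] suminf_mult2[OF s])
  qed
  show thesis using that 1 2 3 by blast
qed

text \<open>The element equals \<open>C *\<^sub>R (x * (1 - h) * x)\<close> with \<open>h\<close>
  the normalised \<open>star s * s\<close>; as \<open>norm h < 1\<close>, a square root of
  \<open>1 - h\<close> puts it into the form \<open>star y * y\<close>.\<close>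

lemma positive_scale_minus:
  fixes s x :: "'a::cstar_algebra"
  assumes x: "star x = x" and C: "(norm s)\<^sup>2 < C"
  shows "positive (C *\<^sub>R (x * x) - star (s * x) * (s * x))"
proof -
  have C0: "C > 0" using C by (meson le_less_trans zero_le_power2)
  define h where "h = (1 / C) *\<^sub>R (star s * s)"
  have "norm h < 1" using C C0 by (simp add: h_def cstar_identity)
  moreover have hs: "star h = h" by (simp add: h_def star_scaleR star_mult star_star)
  ultimately obtain b where b: "star b = b" "b * b * (1 - h) = 1" "b * h = h * b"
    using cstar_inverse_sqrt[of h] by metis
  \<comment> \<open>\<open>b\<close> is the inverse square root of \<open>1 - h\<close>, so this is
    the square root.\<close>
  define d where "d = b * (1 - h)"
  have bc: "b * (1 - h) = (1 - h) * b" using b(3) by (simp add: algebra_simps)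
  have ds: "star d = d" by (simp add: d_def star_mult star_diff hs b bc)
  have "d * d = b * ((1 - h) * b) * (1 - h)" by (simp add: d_def mult.assoc)
  also have "\<dots> = b * b * (1 - h) * (1 - h)" by (simp add: bc[symmetric] mult.assoc)
  finally have dd: "d * d = 1 - h" using b by simp
  have "star (sqrt C *\<^sub>R (d * x)) * (sqrt C *\<^sub>R (d * x)) = (sqrt C * sqrt C) *\<^sub>R (x * (d * d) * x)"
    by (simp add: star_scaleR star_mult ds x mult.assoc)
  also have "\<dots> = C *\<^sub>R (x * (1 - h) * x)" using C0 by (simp add: dd)
  also have "\<dots> = C *\<^sub>R (x * x) - (C * (1 / C)) *\<^sub>R (x * (star s * s) * x)"
    by (simp add: h_def algebra_simps scaleR_diff_right)
  also have "\<dots> = C *\<^sub>R (x * x) - star (s * x) * (s * x)"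
    using C0 by (simp add: star_mult x mult.assoc)
  finally show ?thesis unfolding positive_def by metis
qed

lemma positive_imp_selfadjoint: "positive x \<Longrightarrow> star x = x"
  by (auto simp: positive_def star_mult star_star)

text \<open>\<open>x * star s * s * x\<close> is dominated by a multiple of \<open>x * x\<close>,
  which lies in every subalgebra containing \<open>x\<close>; heredity does the rest.\<close>

lemma sandwich_in_hereditary_generated:
  assumes x: "positive x"
  shows "star (s * x) * (s * x) \<in> hereditary_generated x"
  unfolding hereditary_generated_def
proof clarify
  fix B :: "'a set" assume B: "hereditary_subalgebra B" "x \<in> B"
  define C where "C = (norm s)\<^sup>2 + 1"
  have "C *\<^sub>R (x * x) \<in> B"
    using B cscale_of_real[of C "x * x"]
    unfolding hereditary_subalgebra_def cstar_subalgebra_def by metis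
  moreover have "positive (C *\<^sub>R (x * x) - star (s * x) * (s * x))"
    by (rule positive_scale_minus) (simp_all add: positive_imp_selfadjoint x C_def)
  moreover have "positive (star (s * x) * (s * x))" unfolding positive_def by blast
  ultimately show "star (s * x) * (s * x) \<in> B"
    using B(1) unfolding hereditary_subalgebra_def by blast
qed

text \<open>
  The polar part \<open>x v r (r v\<^sup>* x\<^sup>2 v r)\<^sup>-\<^sup>1\<^sup>/\<^sup>2\<close>, the inverse being taken in the corner of \<open>r\<close>, is a
  partial isometry from \<open>r\<close> to a projection in \<open>x A x\<close>.
\<close>

lemma murray_von_neumann_hereditary:
  fixes x r v :: "'a::cstar_algebra"
  assumes x: "positive x" and r: "projection r"
    and v: "norm (star v * x * x * v - \<rho> *\<^sub>R r) < \<rho>"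
  shows "\<exists>q. projection q \<and> q \<in> hereditary_generated x \<and> murray_von_neumann r q"
proof -
  have xs: "star x = x" by (rule positive_imp_selfadjoint[OF x])
  have rs: "star r = r" "r * r = r" using r by (auto simp: projection_def)
  have \<rho>: "\<rho> > 0" using v by (meson le_less_trans norm_ge_zero)
  define y where "y = (1 / sqrt \<rho>) *\<^sub>R (v * r)"
  define u where "u = x * y"
  define z where "z = star u * u"
  have yr: "y * r = y" by (simp add: y_def mult.assoc rs)
  have ur: "u * r = u" by (simp add: u_def mult.assoc yr)
  have z_eq: "z = (1 / \<rho>) *\<^sub>R (r * (star v * x * x * v) * r)"
  proof -
    have "z = (1 / sqrt \<rho> * (1 / sqrt \<rho>)) *\<^sub>R (r * (star v * x * x * v) * r)"
      by (simp add: z_def u_def y_def star_mult star_scaleR rs xs mult.assoc)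
    moreover have "1 / sqrt \<rho> * (1 / sqrt \<rho>) = 1 / \<rho>" using \<rho> by simp
    ultimately show ?thesis by metis
  qed
  \<comment> \<open>\<open>h\<close> measures how far the compression \<open>z\<close> is from
    \<open>r\<close>, the unit of the corner. Since \<open>z = r * (1 - h)\<close>, the inverse
    square root of \<open>1 - h\<close> in the whole algebra restricts to that of \<open>z\<close>
    in the corner.\<close>
  define h where "h = r - z"
  have "r * (star v * x * x * v - \<rho> *\<^sub>R r) * r = r * (star v * x * x * v) * r - \<rho> *\<^sub>R r"
    by (simp add: algebra_simps rs)
  then have "h = - (1 / \<rho>) *\<^sub>R (r * (star v * x * x * v - \<rho> *\<^sub>R r) * r)"
    using \<rho> by (simp add: h_def z_eq algebra_simps)
  then have nh: "norm h = norm (r * (star v * x * x * v - \<rho> *\<^sub>R r) * r) / \<rho>"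
    using \<rho> by simp
  have "norm (r * (star v * x * x * v - \<rho> *\<^sub>R r) * r) \<le> 1 * norm (star v * x * x * v - \<rho> *\<^sub>R r) * 1"
    using norm_projection_le_1[OF r]
    by (intro order.trans[OF norm_mult_ineq] mult_mono) auto
  then have "norm (r * (star v * x * x * v - \<rho> *\<^sub>R r) * r) < \<rho>" using v by linarith
  then have "norm h < 1" using \<rho> by (simp add: nh)
  moreover have zr: "r * z = z" "z * r = z" "star z = z"
    by (simp_all add: z_def star_mult star_star mult.assoc ur, metis mult.assoc rs(1) star_mult ur)
  have hs: "star h = h" by (simp add: h_def star_diff rs zr)
  moreover have hr: "r * h = h" "h * r = h" by (simp_all add: h_def algebra_simps rs zr)
  ultimately obtain b where b: "star b = b" "b * b * (1 - h) = 1"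
    and bcomm: "\<And>y. y * h = h * y \<Longrightarrow> y * b = b * y"
    using cstar_inverse_sqrt[of h] by metis
  have br: "r * b = b * r" using bcomm[of r] hr by simp
  have bh: "h * b = b * h" using bcomm[of h] by simp
  define w where "w = u * b"
  have zh: "z = r * (1 - h)" by (simp add: algebra_simps rs hr zr h_def)
  have "star w * w = b * z * b" by (simp add: w_def z_def star_mult b mult.assoc)
  also have "\<dots> = b * r * ((1 - h) * b)" by (simp add: zh mult.assoc)
  also have "(1 - h) * b = b * (1 - h)" using bh by (simp add: algebra_simps)
  also have "b * r * (b * (1 - h)) = r * (b * b * (1 - h))" by (simp add: br[symmetric] mult.assoc)
  finally have ww: "star w * w = r" by (simp add: b)
  have wr: "w * r = w" using ur by (simp add: w_def mult.assoc br[symmetric]) (simp add: mult.assoc[symmetric])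
  define q where "q = w * star w"
  have "q * q = w * (star w * w) * star w" by (simp add: q_def mult.assoc)
  then have "projection q" by (simp add: projection_def ww wr q_def star_mult star_star)
  moreover have "q = star (star (y * b) * x) * (star (y * b) * x)"
    by (simp add: q_def w_def u_def star_mult star_star xs mult.assoc)
  then have "q \<in> hereditary_generated x" using sandwich_in_hereditary_generated[OF x] by simp
  moreover have "murray_von_neumann r q" using ww q_def by (auto simp: murray_von_neumann_def)
  ultimately show ?thesis by blast
qed

section \<open>Finite kernels and the operator norm\<close>

definition kmul :: "'x set \<Rightarrow> ('x \<Rightarrow> 'x \<Rightarrow> complex) \<Rightarrow> ('x \<Rightarrow> 'x \<Rightarrow> complex) \<Rightarrow> 'x \<Rightarrow> 'x \<Rightarrow> complex" where
  "kmul X \<kappa> \<mu> = (\<lambda>x z. \<Sum>y\<in>X. \<kappa> x y * \<mu> y z)"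

definition kapp :: "'x set \<Rightarrow> ('y \<Rightarrow> 'x \<Rightarrow> complex) \<Rightarrow> ('x \<Rightarrow> complex) \<Rightarrow> 'y \<Rightarrow> complex" where
  "kapp X \<kappa> v = (\<lambda>x. \<Sum>y\<in>X. \<kappa> x y * v y)"

definition knorm :: "'x set \<Rightarrow> ('x \<Rightarrow> complex) \<Rightarrow> real" where
  "knorm X v = L2_set (\<lambda>x. cmod (v x)) X"

text \<open>An upper bound for the operator norm on functions on \<open>X\<close>, kept as a
  relation so that bounds can be composed without forming a supremum.\<close>

definition kbound :: "'x set \<Rightarrow> ('x \<Rightarrow> 'x \<Rightarrow> complex) \<Rightarrow> real \<Rightarrow> bool" where
  "kbound X \<kappa> C \<longleftrightarrow> C \<ge> 0 \<and> (\<forall>v. knorm X (kapp X \<kappa> v) \<le> C * knorm X v)"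

lemma knorm_nonneg [simp]: "knorm X v \<ge> 0"
  by (simp add: knorm_def)

lemma knorm_sq: "(knorm X v)\<^sup>2 = (\<Sum>x\<in>X. (cmod (v x))\<^sup>2)"
  by (simp add: knorm_def L2_set_def sum_nonneg)

lemma knorm_sq_complex: "complex_of_real ((knorm X v)\<^sup>2) = (\<Sum>x\<in>X. v x * cnj (v x))"
  by (simp only: knorm_sq of_real_sum complex_norm_square)

lemma knorm_cong: "(\<And>x. x \<in> X \<Longrightarrow> v x = w x) \<Longrightarrow> knorm X v = knorm X w"
  unfolding knorm_def by (rule L2_set_cong) auto

lemma kapp_cong:
  "(\<And>y. y \<in> X \<Longrightarrow> \<kappa> x y = \<mu> x y) \<Longrightarrow> (\<And>y. y \<in> X \<Longrightarrow> v y = w y) \<Longrightarrow> kapp X \<kappa> v x = kapp X \<mu> w x"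
  unfolding kapp_def by (rule sum.cong) auto

lemma kapp_kmul: "kapp X (kmul X \<kappa> \<mu>) v = kapp X \<kappa> (kapp X \<mu> v)"
proof
  fix x
  have "kapp X (kmul X \<kappa> \<mu>) v x = (\<Sum>z\<in>X. \<Sum>y\<in>X. \<kappa> x y * \<mu> y z * v z)"
    by (simp add: kapp_def kmul_def sum_distrib_right)
  also have "\<dots> = (\<Sum>y\<in>X. \<Sum>z\<in>X. \<kappa> x y * \<mu> y z * v z)" by (rule sum.swap)
  also have "\<dots> = kapp X \<kappa> (kapp X \<mu> v) x"
    by (simp add: kapp_def sum_distrib_left mult.assoc)
  finally show "kapp X (kmul X \<kappa> \<mu>) v x = kapp X \<kappa> (kapp X \<mu> v) x" .
qed

lemma kboundI: "C \<ge> 0 \<Longrightarrow> (\<And>v. knorm X (kapp X \<kappa> v) \<le> C * knorm X v) \<Longrightarrow> kbound X \<kappa> C"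
  by (simp add: kbound_def)

lemma kboundD: "kbound X \<kappa> C \<Longrightarrow> knorm X (kapp X \<kappa> v) \<le> C * knorm X v"
  by (simp add: kbound_def)

lemma kbound_nonneg: "kbound X \<kappa> C \<Longrightarrow> C \<ge> 0"
  by (simp add: kbound_def)

lemma kbound_cong:
  assumes "\<And>x y. x \<in> X \<Longrightarrow> y \<in> X \<Longrightarrow> \<kappa> x y = \<mu> x y"
  shows "kbound X \<kappa> C \<longleftrightarrow> kbound X \<mu> C"
proof -
  have "knorm X (kapp X \<kappa> v) = knorm X (kapp X \<mu> v)" for v
    by (rule knorm_cong, rule kapp_cong) (auto simp: assms)
  then show ?thesis by (simp add: kbound_def)
qed

lemma kbound_mono: "kbound X \<kappa> C \<Longrightarrow> C \<le> D \<Longrightarrow> kbound X \<kappa> D"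
  unfolding kbound_def by (meson knorm_nonneg mult_right_mono order.trans)

lemma kbound_kmul:
  assumes "kbound X \<kappa> C" "kbound X \<mu> D" shows "kbound X (kmul X \<kappa> \<mu>) (C * D)"
proof (rule kboundI)
  show "knorm X (kapp X (kmul X \<kappa> \<mu>) v) \<le> C * D * knorm X v" for v
    using kboundD[OF assms(1), of "kapp X \<mu> v"] kbound_nonneg[OF assms(1)]
      mult_left_mono[OF kboundD[OF assms(2), of v], of C]
    by (simp add: kapp_kmul mult.assoc)
qed (use assms in \<open>simp add: kbound_def\<close>)

lemma kbound_diff:
  assumes "kbound X \<kappa> C" "kbound X \<mu> D" shows "kbound X (\<lambda>x y. \<kappa> x y - \<mu> x y) (C + D)"
proof (rule kboundI)
  fix v
  have "knorm X (kapp X (\<lambda>x y. \<kappa> x y - \<mu> x y) v) \<le> L2_set (\<lambda>x. cmod (kapp X \<kappa> v x) + cmod (kapp X \<mu> v x)) X"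
    unfolding knorm_def
    by (rule L2_set_mono) (auto simp: kapp_def left_diff_distrib sum_subtractf norm_triangle_ineq4)
  also have "\<dots> \<le> knorm X (kapp X \<kappa> v) + knorm X (kapp X \<mu> v)"
    unfolding knorm_def by (rule L2_set_triangle_ineq)
  finally show "knorm X (kapp X (\<lambda>x y. \<kappa> x y - \<mu> x y) v) \<le> (C + D) * knorm X v"
    using kboundD[OF assms(1), of v] kboundD[OF assms(2), of v] by (simp add: algebra_simps)
qed (use assms in \<open>simp add: kbound_def\<close>)

lemma kbound_diag:
  assumes "finite X" "C \<ge> 0" "\<And>x. x \<in> X \<Longrightarrow> cmod (d x) \<le> C"
  shows "kbound X (\<lambda>x y. if x = y then d x else 0) C"
proof (rule kboundI)
  fix v
  have "knorm X (kapp X (\<lambda>x y. if x = y then d x else 0) v) = L2_set (\<lambda>x. cmod (d x * v x)) X"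
    unfolding knorm_def kapp_def
    by (rule L2_set_cong) (auto simp: assms(1) if_distrib[of "\<lambda>z. z * _"] cong: if_cong)
  also have "\<dots> \<le> L2_set (\<lambda>x. C * cmod (v x)) X"
    by (rule L2_set_mono) (auto simp: norm_mult assms mult_right_mono)
  finally show "knorm X (kapp X (\<lambda>x y. if x = y then d x else 0) v) \<le> C * knorm X v"
    by (simp add: knorm_def L2_set_right_distrib assms)
qed (rule assms)

text \<open>Cauchy-Schwarz in each row. The factor \<open>card X\<close> is harmless: in the
  commutator estimate \<open>X\<close> is one fibre with \<open>4 ^ n\<close> coordinates, a number
  fixed before the arcs are chosen.\<close>

lemma kbound_entries:
  fixes \<eta> :: real
  assumes "finite X" "\<eta> \<ge> 0" "\<And>x y. x \<in> X \<Longrightarrow> y \<in> X \<Longrightarrow> cmod (\<kappa> x y) \<le> \<eta>"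
  shows "kbound X \<kappa> (card X * \<eta>)"
proof (rule kboundI)
  fix v
  define s where "s = \<eta> * (sqrt (card X) * knorm X v)"
  have "cmod (kapp X \<kappa> v x) \<le> s" if "x \<in> X" for x
  proof -
    have "cmod (kapp X \<kappa> v x) \<le> (\<Sum>y\<in>X. cmod (\<kappa> x y * v y))"
      unfolding kapp_def by (rule norm_sum)
    also have "\<dots> \<le> (\<Sum>y\<in>X. \<eta> * (\<bar>1\<bar> * \<bar>cmod (v y)\<bar>))"
      by (rule sum_mono) (use that assms in \<open>auto simp: norm_mult mult_right_mono\<close>)
    also have "\<dots> \<le> \<eta> * (L2_set (\<lambda>_. 1) X * knorm X v)"
      unfolding knorm_def
      by (subst sum_distrib_left[symmetric]) (intro mult_left_mono L2_set_mult_ineq assms(2))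
    finally show ?thesis by (simp add: s_def L2_set_def)
  qed
  then have "knorm X (kapp X \<kappa> v) \<le> L2_set (\<lambda>_. s) X"
    unfolding knorm_def by (rule L2_set_mono) auto
  also have "\<dots> = (sqrt (card X) * sqrt (card X)) * \<eta> * knorm X v"
    using assms(2) by (simp add: L2_set_def real_sqrt_mult s_def)
  finally show "knorm X (kapp X \<kappa> v) \<le> card X * \<eta> * knorm X v" by simp
qed (use assms in simp)

text \<open>For a self-adjoint idempotent P the squared norm of Pv is the inner product of Pv with
  v, hence at most the product of their norms.\<close>

lemma kbound_projection:
  assumes X: "finite X"
    and herm: "\<And>x y. x \<in> X \<Longrightarrow> y \<in> X \<Longrightarrow> \<kappa> y x = cnj (\<kappa> x y)"
    and idem: "\<And>x y. x \<in> X \<Longrightarrow> y \<in> X \<Longrightarrow> kmul X \<kappa> \<kappa> x y = \<kappa> x y"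
  shows "kbound X \<kappa> 1"
proof (rule kboundI)
  fix v
  let ?u = "kapp X \<kappa> v"
  have "complex_of_real ((knorm X ?u)\<^sup>2) = (\<Sum>x\<in>X. \<Sum>y\<in>X. ?u x * (\<kappa> y x * cnj (v y)))"
    unfolding knorm_sq_complex
  proof (rule sum.cong[OF refl])
    fix x assume "x \<in> X"
    then have "cnj (?u x) = (\<Sum>y\<in>X. \<kappa> y x * cnj (v y))"
      unfolding kapp_def cnj_sum by (intro sum.cong) (simp_all add: herm[symmetric])
    then show "?u x * cnj (?u x) = (\<Sum>y\<in>X. ?u x * (\<kappa> y x * cnj (v y)))"
      by (simp add: sum_distrib_left)
  qed
  also have "\<dots> = (\<Sum>y\<in>X. kapp X \<kappa> ?u y * cnj (v y))"
    by (subst sum.swap) (simp add: kapp_def[of X \<kappa> ?u] sum_distrib_left sum_distrib_right mult_ac)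
  also have "\<dots> = (\<Sum>y\<in>X. ?u y * cnj (v y))"
    by (rule sum.cong) (auto simp: kapp_kmul[symmetric] idem intro!: kapp_cong)
  finally have "(knorm X ?u)\<^sup>2 = cmod (\<Sum>y\<in>X. ?u y * cnj (v y))"
    by (metis abs_of_nonneg norm_of_real zero_le_power2)
  also have "\<dots> \<le> (\<Sum>y\<in>X. \<bar>cmod (?u y)\<bar> * \<bar>cmod (v y)\<bar>)"
    by (rule order.trans[OF norm_sum]) (simp add: norm_mult)
  also have "\<dots> \<le> knorm X ?u * knorm X v"
    unfolding knorm_def by (rule L2_set_mult_ineq)
  finally show "knorm X ?u \<le> 1 * knorm X v"
    using knorm_nonneg[of X ?u] mult_le_cancel_left_pos[of "knorm X ?u"]
    by (cases "knorm X ?u = 0") (auto simp: power2_eq_square less_le)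
qed simp

text \<open>Pythagoras over the blocks: no constant is lost, however many base points there
  are.\<close>

lemma kbound_block_diagonal:
  assumes "finite B" "finite A" "C \<ge> 0" and F: "\<And>b. b \<in> B \<Longrightarrow> kbound A (F b) C"
  shows "kbound (B \<times> A) (\<lambda>(b, a) (b', a'). if b = b' then F b a a' else 0) C"
proof (rule kboundI)
  fix v
  let ?\<kappa> = "\<lambda>(b, a) (b', a'). if b = b' then F b a a' else 0"
  have sq: "(knorm (B \<times> A) w)\<^sup>2 = (\<Sum>b\<in>B. (knorm A (\<lambda>a. w (b, a)))\<^sup>2)" for w :: "'a \<times> 'b \<Rightarrow> complex"
    by (simp add: knorm_sq sum.cartesian_product case_prod_unfold)
  have app: "kapp (B \<times> A) ?\<kappa> v (b, a) = kapp A (F b) (\<lambda>a. v (b, a)) a" if "b \<in> B" for a b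
  proof -
    have "kapp (B \<times> A) ?\<kappa> v (b, a) = (\<Sum>b'\<in>B. \<Sum>a'\<in>A. (if b = b' then F b' a a' else 0) * v (b', a'))"
      unfolding kapp_def by (subst sum.cartesian_product) (auto intro!: sum.cong)
    also have "\<dots> = (\<Sum>b'\<in>B. if b = b' then kapp A (F b') (\<lambda>a. v (b', a)) a else 0)"
      by (rule sum.cong) (auto simp: kapp_def)
    finally show ?thesis using that assms(1) by simp
  qed
  have "(knorm (B \<times> A) (kapp (B \<times> A) ?\<kappa> v))\<^sup>2 = (\<Sum>b\<in>B. (knorm A (kapp A (F b) (\<lambda>a. v (b, a))))\<^sup>2)"
    by (simp add: sq app)
  also have "\<dots> \<le> (\<Sum>b\<in>B. (C * knorm A (\<lambda>a. v (b, a)))\<^sup>2)"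
    by (intro sum_mono power_mono kboundD F) auto
  also have "\<dots> = (C * knorm (B \<times> A) v)\<^sup>2"
    by (simp add: power_mult_distrib sq sum_distrib_left)
  finally show "knorm (B \<times> A) (kapp (B \<times> A) ?\<kappa> v) \<le> C * knorm (B \<times> A) v"
    by (rule power2_le_imp_le) (simp add: assms)
qed (rule assms)

lemma knorm_isometry:
  assumes "finite P" "finite X"
    and V: "\<And>x y. x \<in> X \<Longrightarrow> y \<in> X \<Longrightarrow> (\<Sum>p\<in>P. cnj (V p x) * V p y) = (if x = y then 1 else 0)"
  shows "knorm P (kapp X V u) = knorm X u"
proof -
  have "complex_of_real ((knorm P (kapp X V u))\<^sup>2) = (\<Sum>p\<in>P. \<Sum>y\<in>X. \<Sum>x\<in>X. u y * cnj (u x) * (cnj (V p x) * V p y))"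
    unfolding knorm_sq_complex
    by (rule sum.cong) (auto simp: kapp_def sum_product cnj_sum intro!: sum.cong)
  also have "\<dots> = (\<Sum>y\<in>X. \<Sum>x\<in>X. \<Sum>p\<in>P. u y * cnj (u x) * (cnj (V p x) * V p y))"
    by (subst sum.swap, rule sum.cong[OF refl], rule sum.swap)
  also have "\<dots> = (\<Sum>y\<in>X. \<Sum>x\<in>X. u y * cnj (u x) * (if x = y then 1 else 0))"
    by (simp add: sum_distrib_left[symmetric] V)
  also have "\<dots> = complex_of_real ((knorm X u)\<^sup>2)"
    unfolding knorm_sq_complex using assms(2)
    by (simp add: if_distrib[of "\<lambda>z. _ * z"] cong: if_cong)
  finally have "(knorm P (kapp X V u))\<^sup>2 = (knorm X u)\<^sup>2" by (simp only: of_real_eq_iff)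
  then show ?thesis by simp
qed

definition conjugate_kernel :: "'x set \<Rightarrow> ('p \<Rightarrow> 'x \<Rightarrow> complex) \<Rightarrow> ('x \<Rightarrow> 'x \<Rightarrow> complex) \<Rightarrow> 'p \<Rightarrow> 'p \<Rightarrow> complex" where
  "conjugate_kernel X V \<kappa> p q = (\<Sum>x\<in>X. \<Sum>y\<in>X. V p x * \<kappa> x y * cnj (V q y))"

text \<open>The two orthonormality relations say that \<open>V\<close> is unitary between two index
  sets of different type, so that both \<open>V\<close> and its adjoint preserve norms.\<close>

lemma kbound_conjugate_kernel:
  assumes P: "finite P" and X: "finite X"
    and V: "\<And>x y. x \<in> X \<Longrightarrow> y \<in> X \<Longrightarrow> (\<Sum>p\<in>P. cnj (V p x) * V p y) = (if x = y then 1 else 0)"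
    and W: "\<And>p q. p \<in> P \<Longrightarrow> q \<in> P \<Longrightarrow> (\<Sum>x\<in>X. V p x * cnj (V q x)) = (if p = q then 1 else 0)"
    and \<kappa>: "kbound X \<kappa> C"
  shows "kbound P (conjugate_kernel X V \<kappa>) C"
proof (rule kboundI)
  fix v
  have "kapp P (conjugate_kernel X V \<kappa>) v p = kapp X V (kapp X \<kappa> (kapp P (\<lambda>x p. cnj (V p x)) v)) p" for p
  proof -
    have "kapp P (conjugate_kernel X V \<kappa>) v p = (\<Sum>q\<in>P. \<Sum>x\<in>X. \<Sum>y\<in>X. V p x * \<kappa> x y * cnj (V q y) * v q)"
      by (simp add: kapp_def conjugate_kernel_def sum_distrib_right)
    also have "\<dots> = (\<Sum>x\<in>X. \<Sum>y\<in>X. \<Sum>q\<in>P. V p x * \<kappa> x y * cnj (V q y) * v q)"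
      by (subst sum.swap, rule sum.cong[OF refl], rule sum.swap)
    finally show ?thesis by (simp add: kapp_def sum_distrib_left mult.assoc)
  qed
  then have "knorm P (kapp P (conjugate_kernel X V \<kappa>) v) =
      knorm X (kapp X \<kappa> (kapp P (\<lambda>x p. cnj (V p x)) v))"
    by (metis knorm_cong knorm_isometry[OF P X V])
  also have "\<dots> \<le> C * knorm X (kapp P (\<lambda>x p. cnj (V p x)) v)" by (rule kboundD[OF \<kappa>])
  also have "knorm X (kapp P (\<lambda>x p. cnj (V p x)) v) = knorm P v"
    by (rule knorm_isometry[OF X P]) (simp add: W)
  finally show "knorm P (kapp P (conjugate_kernel X V \<kappa>) v) \<le> C * knorm P v" .
qed (rule kbound_nonneg[OF \<kappa>])

lemma conjugate_kernel_kmul: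
  assumes P: "finite P" and X: "finite X"
    and V: "\<And>x y. x \<in> X \<Longrightarrow> y \<in> X \<Longrightarrow> (\<Sum>p\<in>P. cnj (V p x) * V p y) = (if x = y then 1 else 0)"
  shows "(\<Sum>q\<in>P. conjugate_kernel X V \<kappa> p q * conjugate_kernel X V \<mu> q r) = conjugate_kernel X V (kmul X \<kappa> \<mu>) p r"
proof -
  define a where "a y = (\<Sum>x\<in>X. V p x * \<kappa> x y)" for y
  define b where "b y = (\<Sum>z\<in>X. \<mu> y z * cnj (V r z))" for y
  have 1: "conjugate_kernel X V \<kappa> p q = (\<Sum>y\<in>X. a y * cnj (V q y))" for q
    unfolding conjugate_kernel_def a_def sum_distrib_right by (rule sum.swap)
  have 2: "conjugate_kernel X V \<mu> q r = (\<Sum>y\<in>X. V q y * b y)" for q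
    by (simp add: conjugate_kernel_def b_def sum_distrib_left mult.assoc)
  have "(\<Sum>q\<in>P. conjugate_kernel X V \<kappa> p q * conjugate_kernel X V \<mu> q r) =
      (\<Sum>q\<in>P. \<Sum>y\<in>X. \<Sum>z\<in>X. a y * b z * (cnj (V q y) * V q z))"
    unfolding 1 2 sum_product by (intro sum.cong refl) (simp add: mult_ac)
  also have "\<dots> = (\<Sum>y\<in>X. \<Sum>z\<in>X. \<Sum>q\<in>P. a y * b z * (cnj (V q y) * V q z))"
    by (subst sum.swap, rule sum.cong[OF refl], rule sum.swap)
  also have "\<dots> = (\<Sum>y\<in>X. a y * b y)"
    by (simp add: sum_distrib_left[symmetric] V X if_distrib[of "\<lambda>z. _ * z"] cong: if_cong)
  also have "\<dots> = (\<Sum>y\<in>X. \<Sum>x\<in>X. \<Sum>z\<in>X. V p x * \<kappa> x y * (\<mu> y z * cnj (V r z)))"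
    by (simp add: a_def b_def sum_product)
  also have "\<dots> = (\<Sum>x\<in>X. \<Sum>z\<in>X. \<Sum>y\<in>X. V p x * \<kappa> x y * (\<mu> y z * cnj (V r z)))"
    by (subst sum.swap, rule sum.cong[OF refl], rule sum.swap)
  also have "\<dots> = conjugate_kernel X V (kmul X \<kappa> \<mu>) p r"
    by (simp add: conjugate_kernel_def kmul_def sum_distrib_left sum_distrib_right mult.assoc)
  finally show ?thesis .
qed

section \<open>Operator norms of matrices and of functions on the circle\<close>

lemma euclidean_norm_eq: "euclidean_norm v = knorm {..<dim_vec v} (vec_index v)"
  by (simp add: euclidean_norm_def knorm_def L2_set_def)

lemma euclidean_norm_mult_mat_vec:
  assumes "M \<in> carrier_mat D D" "v \<in> carrier_vec D"
  shows "euclidean_norm (mult_mat_vec M v) = knorm {..<D} (kapp {..<D} (\<lambda>i j. M $$ (i, j)) (vec_index v))"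
  using assms unfolding euclidean_norm_eq
  by (auto intro!: knorm_cong simp: kapp_def scalar_prod_def atLeast0LessThan)

lemma operator_norm_least:
  assumes M: "M \<in> carrier_mat D D"
    and le: "\<And>v. knorm {..<D} v \<le> 1 \<Longrightarrow> knorm {..<D} (kapp {..<D} (\<lambda>i j. M $$ (i, j)) v) \<le> C"
  shows "operator_norm M \<le> C"
  unfolding operator_norm_def
proof (rule cSUP_least)
  have "0\<^sub>v (dim_col M) \<in> {v \<in> carrier_vec (dim_col M). euclidean_norm v \<le> 1}"
    by (simp add: euclidean_norm_def)
  then show "{v \<in> carrier_vec (dim_col M). euclidean_norm v \<le> 1} \<noteq> {}" by blast
next
  fix v assume "v \<in> {v \<in> carrier_vec (dim_col M). euclidean_norm v \<le> 1}"
  then show "euclidean_norm (mult_mat_vec M v) \<le> C"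
    using le[of "vec_index v"] M
    by (auto simp del: dim_mult_mat_vec simp: euclidean_norm_mult_mat_vec[OF M] euclidean_norm_eq[of v])
qed

lemma operator_norm_le:
  assumes "M \<in> carrier_mat D D" "kbound {..<D} (\<lambda>i j. M $$ (i, j)) C"
  shows "operator_norm M \<le> C"
proof (rule operator_norm_least[OF assms(1)])
  fix v :: "nat \<Rightarrow> complex" assume "knorm {..<D} v \<le> 1"
  then have "C * knorm {..<D} v \<le> C" using kbound_nonneg[OF assms(2)] by (simp add: mult_left_le)
  then show "knorm {..<D} (kapp {..<D} (\<lambda>i j. M $$ (i, j)) v) \<le> C"
    using kboundD[OF assms(2), of v] by linarith
qed

text \<open>A crude estimate through the entries shows that the supremum is over a bounded set;
  homogeneity then extends the bound from the unit ball to all vectors.\<close>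

lemma kbound_operator_norm:
  assumes M: "M \<in> carrier_mat D D"
  shows "kbound {..<D} (\<lambda>i j. M $$ (i, j)) (operator_norm M)"
proof -
  let ?\<kappa> = "\<lambda>i j. M $$ (i, j)"
  define \<eta> where "\<eta> = (\<Sum>i<D. \<Sum>j<D. cmod (M $$ (i, j)))"
  have \<eta>: "\<eta> \<ge> 0" by (simp add: \<eta>_def sum_nonneg)
  have "cmod (M $$ (i, j)) \<le> \<eta>" if "i < D" "j < D" for i j
  proof -
    have "cmod (M $$ (i, j)) \<le> (\<Sum>j<D. cmod (M $$ (i, j)))"
      using that by (intro member_le_sum) auto
    also have "\<dots> \<le> \<eta>"
      unfolding \<eta>_def using that
      by (intro member_le_sum[of i _ "\<lambda>i. \<Sum>j<D. cmod (M $$ (i, j))"]) (auto intro: sum_nonneg)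
    finally show ?thesis .
  qed
  then have B: "kbound {..<D} ?\<kappa> (D * \<eta>)"
    using kbound_entries[of "{..<D}" \<eta> ?\<kappa>] \<eta> by simp
  have bdd: "bdd_above ((\<lambda>v. euclidean_norm (mult_mat_vec M v)) ` {v \<in> carrier_vec (dim_col M). euclidean_norm v \<le> 1})"
  proof (rule bdd_aboveI2)
    fix v assume "v \<in> {v \<in> carrier_vec (dim_col M). euclidean_norm v \<le> 1}"
    then show "euclidean_norm (mult_mat_vec M v) \<le> D * \<eta>"
      using kboundD[OF B, of "vec_index v"] M \<eta>
        mult_left_le[of "knorm {..<D} (vec_index v)" "D * \<eta>"]
      by (auto simp: euclidean_norm_mult_mat_vec[OF M] euclidean_norm_eq[of v])
  qed
  have unit: "knorm {..<D} (kapp {..<D} ?\<kappa> v) \<le> operator_norm M" if "knorm {..<D} v \<le> 1" for v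
  proof -
    have e: "knorm {..<D} (vec_index (Matrix.vec D v)) = knorm {..<D} v" by (rule knorm_cong) simp
    have "Matrix.vec D v \<in> {v \<in> carrier_vec (dim_col M). euclidean_norm v \<le> 1}"
      using that M by (simp add: euclidean_norm_eq e)
    then have "euclidean_norm (mult_mat_vec M (Matrix.vec D v)) \<le> operator_norm M"
      unfolding operator_norm_def by (rule cSUP_upper[OF _ bdd])
    moreover have "knorm {..<D} (kapp {..<D} ?\<kappa> (vec_index (Matrix.vec D v))) = knorm {..<D} (kapp {..<D} ?\<kappa> v)"
      by (intro knorm_cong kapp_cong) simp_all
    ultimately show ?thesis by (simp add: euclidean_norm_mult_mat_vec[OF M])
  qed
  have o0: "operator_norm M \<ge> 0"
    using unit[of "\<lambda>_. 0"] by (simp add: knorm_def kapp_def L2_set_def)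
  show ?thesis
  proof (rule kboundI[OF o0])
    fix v
    show "knorm {..<D} (kapp {..<D} ?\<kappa> v) \<le> operator_norm M * knorm {..<D} v"
    proof (cases "knorm {..<D} v = 0")
      case True
      then show ?thesis using kboundD[OF B, of v] by simp
    next
      case False
      define c where "c = 1 / knorm {..<D} v"
      have c: "c > 0" using False by (simp add: c_def less_le)
      have cn: "c * knorm {..<D} v = 1" using False by (simp add: c_def)
      have s: "knorm {..<D} (\<lambda>i. complex_of_real c * w i) = c * knorm {..<D} w" for w
        using c by (simp add: knorm_def norm_mult L2_set_right_distrib)
      have "kapp {..<D} ?\<kappa> (\<lambda>i. complex_of_real c * v i) = (\<lambda>i. complex_of_real c * kapp {..<D} ?\<kappa> v i)"
        by (simp add: kapp_def sum_distrib_left mult_ac)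
      then have "c * knorm {..<D} (kapp {..<D} ?\<kappa> v) \<le> operator_norm M"
        using unit[of "\<lambda>i. complex_of_real c * v i"] cn by (simp add: s)
      moreover have "knorm {..<D} v > 0" using False knorm_nonneg[of "{..<D}" v] by linarith
      ultimately show ?thesis by (simp add: c_def field_simps)
    qed
  qed
qed

text \<open>Compactness of the parameter interval. Without boundedness the supremum in
  \<open>circle_norm\<close> would say nothing about the values at individual points.\<close>

lemma circle_algebra_entry_bounded:
  assumes f: "f \<in> circle_algebra N"
  obtains \<eta> where "\<eta> \<ge> 0" "\<And>t i j. t \<in> {0..1} \<Longrightarrow> i < N \<Longrightarrow> j < N \<Longrightarrow> cmod (f t $$ (i, j)) \<le> \<eta>"
proof -
  have "\<exists>\<eta>. \<forall>t\<in>{0..1}. cmod (f t $$ (i, j)) \<le> \<eta>" if "i < N" "j < N" for i j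
  proof -
    have "continuous_on {0..1} (\<lambda>t. f t $$ (i, j))"
      using f that by (auto simp: circle_algebra_def)
    then have "compact ((\<lambda>t. f t $$ (i, j)) ` {0..1})"
      by (rule compact_continuous_image) simp
    then show ?thesis by (meson bounded_iff compact_imp_bounded imageI)
  qed
  then obtain \<eta> where \<eta>: "\<And>i j t. i < N \<Longrightarrow> j < N \<Longrightarrow> t \<in> {0..1} \<Longrightarrow> cmod (f t $$ (i, j)) \<le> \<eta> i j"
    by metis
  have "cmod (f t $$ (i, j)) \<le> (\<Sum>i<N. \<Sum>j<N. \<bar>\<eta> i j\<bar>)" if "t \<in> {0..1}" "i < N" "j < N" for t i j
  proof -
    have "cmod (f t $$ (i, j)) \<le> \<bar>\<eta> i j\<bar>" using \<eta>[of i j t] that by force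
    also have "\<dots> \<le> (\<Sum>j<N. \<bar>\<eta> i j\<bar>)" using that by (intro member_le_sum) auto
    also have "\<dots> \<le> (\<Sum>i<N. \<Sum>j<N. \<bar>\<eta> i j\<bar>)"
      using that by (intro member_le_sum[of i _ "\<lambda>i. \<Sum>j<N. \<bar>\<eta> i j\<bar>"]) (auto intro: sum_nonneg)
    finally show ?thesis .
  qed
  then show thesis using that[of "\<Sum>i<N. \<Sum>j<N. \<bar>\<eta> i j\<bar>"] by (auto intro: sum_nonneg)
qed

lemma circle_algebra_carrier: "f \<in> circle_algebra N \<Longrightarrow> t \<in> {0..1} \<Longrightarrow> f t \<in> carrier_mat N N"
  by (auto simp: circle_algebra_def)

lemma kbound_circle_norm:
  assumes f: "f \<in> circle_algebra N" and t: "t \<in> {0..1}"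
  shows "kbound {..<N} (\<lambda>i j. f t $$ (i, j)) (circle_norm f)"
proof -
  obtain \<eta> where \<eta>: "\<eta> \<ge> 0" "\<And>t i j. t \<in> {0..1} \<Longrightarrow> i < N \<Longrightarrow> j < N \<Longrightarrow> cmod (f t $$ (i, j)) \<le> \<eta>"
    using circle_algebra_entry_bounded[OF f] by metis
  have "bdd_above ((\<lambda>t. operator_norm (f t)) ` {0..1})"
  proof (rule bdd_aboveI2)
    fix t :: real assume t: "t \<in> {0..1}"
    show "operator_norm (f t) \<le> card {..<N} * \<eta>"
      by (rule operator_norm_le[OF circle_algebra_carrier[OF f t] kbound_entries]) (use \<eta> t in auto)
  qed
  then have "operator_norm (f t) \<le> circle_norm f"
    unfolding circle_norm_def by (rule cSUP_upper[OF t])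
  then show ?thesis
    using kbound_operator_norm[OF circle_algebra_carrier[OF f t]] kbound_mono by blast
qed

lemma circle_norm_le:
  assumes "\<And>t. t \<in> {0..1} \<Longrightarrow> f t \<in> carrier_mat N N"
    and "\<And>t. t \<in> {0..1} \<Longrightarrow> kbound {..<N} (\<lambda>i j. f t $$ (i, j)) C"
  shows "circle_norm f \<le> C"
  unfolding circle_norm_def by (rule cSUP_least) (simp, rule operator_norm_le[of _ N], auto simp: assms)

text \<open>Supplies the point of the circle and the vector at which an approximant of the given
  positive element is close to its norm.\<close>

lemma less_circle_norm:
  assumes f: "f \<in> circle_algebra N" and less: "r < circle_norm f"
  obtains t v where "t \<in> {0..1}" "knorm {..<N} v \<le> 1" "r < knorm {..<N} (kapp {..<N} (\<lambda>i j. f t $$ (i, j)) v)"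
proof -
  have "\<exists>t\<in>{0..1}. \<exists>v. knorm {..<N} v \<le> 1 \<and> r < knorm {..<N} (kapp {..<N} (\<lambda>i j. f t $$ (i, j)) v)"
  proof (rule ccontr)
    assume "\<not> ?thesis"
    then have "circle_norm f \<le> r"
      unfolding circle_norm_def
      by (intro cSUP_least operator_norm_least[OF circle_algebra_carrier[OF f]]) (auto simp: not_less)
    then show False using less by simp
  qed
  then show thesis using that by blast
qed

section \<open>Periodic functions and the path of unitaries\<close>

text \<open>The 1-periodic extension of the values on [0,1). On the whole line the sheets of the
  coverings are multiplications by signed powers of two, with no case distinctions at the end
  points.\<close>

definition per :: "(real \<Rightarrow> 'b) \<Rightarrow> real \<Rightarrow> 'b" where
  "per g y = g (frac y)"

lemma per_add_int [simp]: "per g (y + of_int z) = per g y"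
  by (simp add: per_def frac_def)

lemma per_eq: "g 0 = g 1 \<Longrightarrow> 0 \<le> y \<Longrightarrow> y \<le> 1 \<Longrightarrow> per g y = g y"
  by (cases "y = 1") (auto simp: per_def frac_eq)

lemma continuous_on_per:
  fixes g :: "real \<Rightarrow> 'b::topological_space"
  assumes g: "continuous_on {0..1} g" and eq: "g 0 = g 1"
  shows "continuous_on UNIV (per g)"
proof -
  have seg: "continuous_on {of_int n..of_int n + 1} (per g)" for n
  proof -
    have cont: "continuous_on {of_int n..of_int n + 1} (\<lambda>x. g (x - of_int n))"
      by (rule continuous_on_compose2[OF g]) (auto intro!: continuous_intros)
    have eq': "per g x = g (x - of_int n)" if "x \<in> {of_int n..of_int n + 1}" for x
      using per_eq[OF eq, of "x - of_int n"] per_add_int[of g "x - of_int n" n] that by simp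
    show ?thesis by (rule iffD2[OF continuous_on_cong[OF refl eq'] cont])
  qed
  have "isCont (per g) y" for y
  proof -
    \<comment> \<open>The two unit segments meeting at \<open>n\<close> together form a
      neighbourhood of every \<open>y\<close> with floor \<open>n\<close>.\<close>
    define n where "n = \<lfloor>y\<rfloor>"
    have "{of_int (n - 1)..of_int (n - 1) + 1} \<union> {of_int n..of_int n + 1} = {of_int n - 1..of_int n + (1::real)}"
      by auto
    then have "continuous_on {of_int n - 1..of_int n + 1} (per g)"
      using continuous_on_closed_Un[OF _ _ seg[of "n - 1"] seg[of n]] by simp
    moreover have "y \<in> interior {of_int n - 1..of_int n + 1}"
      unfolding n_def by (simp add: interior_atLeastAtMost_real) linarith
    ultimately show ?thesis by (rule continuous_on_interior)
  qed
  then show ?thesis by (simp add: continuous_at_imp_continuous_on)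
qed

lemma sum_lessThan_mult:
  fixes F :: "nat \<Rightarrow> 'b::comm_monoid_add"
  shows "(\<Sum>p<a * b. F p) = (\<Sum>i<a. \<Sum>r<b. F (i * b + r))"
proof (induction a)
  case (Suc a)
  have "(\<Sum>p<Suc a * b. F p) = sum F {0..<a * b} + sum F {a * b..<a * b + b}"
    by (subst sum.atLeastLessThan_concat) (simp_all add: atLeast0LessThan add.commute)
  also have "sum F {a * b..<a * b + b} = (\<Sum>r<b. F (a * b + r))"
    using sum.shift_bounds_nat_ivl[of F 0 "a * b" b] by (simp add: atLeast0LessThan add.commute)
  finally show ?case using Suc by (simp add: atLeast0LessThan)
qed simp

lemma sum_shift_periodic:
  fixes Q :: "real \<Rightarrow> 'b::cancel_comm_monoid_add"
  assumes "\<And>y. Q (y + real M) = Q y"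
  shows "(\<Sum>j<M. Q (y + 1 + real j)) = (\<Sum>j<M. Q (y + real j))"
proof -
  have "(\<Sum>j<M. Q (y + real j)) + Q (y + real M) = (\<Sum>j<Suc M. Q (y + real j))" by simp
  also have "\<dots> = Q y + (\<Sum>j<M. Q (y + 1 + real j))"
    by (subst sum.lessThan_Suc_shift) (simp add: add.assoc)
  finally show ?thesis using assms[of y] by (simp add: add.commute)
qed

lemma sum_reflect_periodic:
  fixes Q :: "real \<Rightarrow> 'b::cancel_comm_monoid_add"
  assumes "\<And>y. Q (y + real M) = Q y"
  shows "(\<Sum>j<M. Q (y - real j)) = (\<Sum>j<M. Q (y + real j))"
proof -
  have "(\<Sum>j<M. Q (y - real j)) = (\<Sum>j<M. Q (y + 1 + real (M - Suc j)))"
  proof (rule sum.cong[OF refl])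
    fix j assume "j \<in> {..<M}"
    then have "y + 1 + real (M - Suc j) = y - real j + real M" by (simp add: of_nat_diff)
    then show "Q (y - real j) = Q (y + 1 + real (M - Suc j))" by (simp only: assms)
  qed
  also have "\<dots> = (\<Sum>j<M. Q (y + 1 + real j))" by (rule sum.nat_diff_reindex)
  finally show ?thesis using sum_shift_periodic[of Q M y] assms by simp
qed

definition sg :: "bool \<Rightarrow> real" where
  "sg \<sigma> = (if \<sigma> then 1 else - 1)"

definition word_sign :: "bool list \<Rightarrow> real" where
  "word_sign w = prod_list (map sg w)"

lemma word_sign_simps [simp]: "word_sign [] = 1" "word_sign (\<sigma> # w) = sg \<sigma> * word_sign w"
  by (simp_all add: word_sign_def)

lemma word_sign_cases: "word_sign w = 1 \<or> word_sign w = - 1"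
  by (induction w) (auto simp: sg_def)

text \<open>Write the index as 2 i + g. The factor \<open>C\<close> has period 2 and sees only g,
  while \<open>Q\<close> runs through a full period as i varies. For a negative sign i runs
  backwards, which a sum over a full period does not notice.\<close>

lemma sum_periodic_double:
  fixes C Q :: "real \<Rightarrow> complex"
  assumes C: "\<And>y z. C (y + 2 * of_int z) = C y" and Q: "\<And>y. Q (y + real M) = Q y"
  shows "(\<Sum>j<2 * M. C (sg \<sigma> * (y + real j)) * Q (sg \<sigma> * (y + real j) / 2)) =
    (\<Sum>g<2. C (sg \<sigma> * (y + real g)) * (\<Sum>j<M. Q (sg \<sigma> * (y + real g) / 2 + real j)))"
proof -
  have reflect: "(\<Sum>j<M. Q (z + sg \<sigma> * real j)) = (\<Sum>j<M. Q (z + real j))" for z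
    using sum_reflect_periodic[of Q M z, OF Q] by (cases \<sigma>) (simp_all add: sg_def)
  have "(\<Sum>j<2 * M. C (sg \<sigma> * (y + real j)) * Q (sg \<sigma> * (y + real j) / 2)) =
    (\<Sum>j<M. \<Sum>g<2. C (sg \<sigma> * (y + real (j * 2 + g))) * Q (sg \<sigma> * (y + real (j * 2 + g)) / 2))"
    by (subst mult.commute, subst sum_lessThan_mult) simp
  also have "\<dots> = (\<Sum>j<M. \<Sum>g<2. C (sg \<sigma> * (y + real g)) * Q (sg \<sigma> * (y + real g) / 2 + sg \<sigma> * real j))"
  proof (intro sum.cong refl)
    fix j g :: nat
    have e: "sg \<sigma> * (y + real (j * 2 + g)) = sg \<sigma> * (y + real g) + 2 * of_int (if \<sigma> then int j else - int j)"
      by (auto simp: sg_def algebra_simps)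
    have e': "sg \<sigma> * (y + real (j * 2 + g)) / 2 = sg \<sigma> * (y + real g) / 2 + sg \<sigma> * real j"
      by (simp add: algebra_simps add_divide_distrib)
    show "C (sg \<sigma> * (y + real (j * 2 + g))) * Q (sg \<sigma> * (y + real (j * 2 + g)) / 2) =
        C (sg \<sigma> * (y + real g)) * Q (sg \<sigma> * (y + real g) / 2 + sg \<sigma> * real j)"
      unfolding e' unfolding e C ..
  qed
  also have "\<dots> = (\<Sum>g<2. C (sg \<sigma> * (y + real g)) * (\<Sum>j<M. Q (sg \<sigma> * (y + real g) / 2 + sg \<sigma> * real j)))"
    by (subst sum.swap) (simp add: sum_distrib_left)
  finally show ?thesis by (simp only: reflect)
qed

subsection \<open>The columns of the path\<close>

lemma mat_adjoint_index:
  "i < dim_col A \<Longrightarrow> j < dim_row A \<Longrightarrow> mat_adjoint A $$ (i, j) = cnj ((A :: complex mat) $$ (j, i))"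
  by (simp add: mat_adjoint_def mat_of_rows_index vec_index_conjugate)

lemma mat_adjoint_dim [simp]:
  "dim_row (mat_adjoint A) = dim_col A" "dim_col (mat_adjoint A) = dim_row (A :: complex mat)"
  by (simp_all add: mat_adjoint_def)

text \<open>
  The columns of \<open>c\<close> run continuously through each other, so they are the two halves of one function
  on the double cover of the circle, the first on \<open>[0,1]\<close> and the second on \<open>[1,2]\<close>.
\<close>

definition column_path :: "(real \<Rightarrow> complex mat) \<Rightarrow> nat \<Rightarrow> real \<Rightarrow> complex" where
  "column_path c h y =
     per (\<lambda>x. if x \<le> 1 / 2 then c (2 * x) $$ (h, 0) else c (2 * x - 1) $$ (h, 1)) (y / 2)"

lemma column_path_periodic: "column_path c h (y + 2 * of_int z) = column_path c h y"
  using per_add_int[of _ "y / 2" z] by (simp add: column_path_def add_divide_distrib)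

lemma column_path_periodic1: "column_path c h (y + 2) = column_path c h y"
  using column_path_periodic[of c h y 1] by simp

context
  fixes c :: "real \<Rightarrow> complex mat"
  assumes c: "swap_path c"
begin

lemma swap_path_ends: "h < 2 \<Longrightarrow> g < 2 \<Longrightarrow> c 0 $$ (h, g) = (if h = g then 1 else 0)"
  "h < 2 \<Longrightarrow> g < 2 \<Longrightarrow> c 1 $$ (h, g) = (if h = g then 0 else 1)"
  using c by (auto simp: swap_path_def mat_of_rows_list_def less_2_cases_iff)

lemma swap_path_carrier: "t \<in> {0..1} \<Longrightarrow> c t \<in> carrier_mat 2 2"
  using c by (auto simp: swap_path_def)

lemma swap_path_columns:
  assumes t: "t \<in> {0..1}" and gg: "g < 2" "g' < 2"
  shows "(\<Sum>h<2. cnj (c t $$ (h, g)) * c t $$ (h, g')) = (if g = g' then 1 else 0)"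
proof -
  have d: "dim_row (c t) = 2" "dim_col (c t) = 2" using swap_path_carrier[OF t] by auto
  have "(mat_adjoint (c t) * c t) $$ (g, g') = (1\<^sub>m 2 :: complex mat) $$ (g, g')"
    using c t by (auto simp: swap_path_def)
  then show ?thesis using gg d by (simp add: scalar_prod_def mat_adjoint_index atLeast0LessThan)
qed

lemma swap_path_rows:
  assumes t: "t \<in> {0..1}" and hh: "h < 2" "h' < 2"
  shows "(\<Sum>g<2. c t $$ (h, g) * cnj (c t $$ (h', g))) = (if h = h' then 1 else 0)"
proof -
  have d: "dim_row (c t) = 2" "dim_col (c t) = 2" using swap_path_carrier[OF t] by auto
  have "(c t * mat_adjoint (c t)) $$ (h, h') = (1\<^sub>m 2 :: complex mat) $$ (h, h')"
    using c t by (auto simp: swap_path_def)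
  then show ?thesis using hh d by (simp add: scalar_prod_def mat_adjoint_index atLeast0LessThan)
qed

lemma column_path_0: "h < 2 \<Longrightarrow> t \<in> {0..1} \<Longrightarrow> column_path c h t = c t $$ (h, 0)"
  by (simp add: column_path_def per_def frac_eq)

lemma column_path_1:
  assumes h: "h < 2" and t: "t \<in> {0..1}"
  shows "column_path c h (t + 1) = c t $$ (h, 1)"
proof (cases "t = 1")
  case True
  have "column_path c h (t + 1) = column_path c h 0"
    using column_path_periodic1[of c h 0] True by simp
  then show ?thesis using h True by (simp add: column_path_0 swap_path_ends less_2_cases_iff) auto
next
  case False
  then have f: "frac ((t + 1) / 2) = (t + 1) / 2" using t by (simp only: frac_eq) auto
  have e: "2 * ((t + 1) / 2) - 1 = t" by (simp add: field_simps)
  show ?thesis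
    unfolding column_path_def per_def f e
    using h t by (cases "t = 0") (auto simp: swap_path_ends less_2_cases_iff)
qed

lemma continuous_on_column_path:
  assumes h: "h < 2" shows "continuous_on UNIV (column_path c h)"
proof -
  let ?G = "\<lambda>x. if x \<le> 1 / 2 then c (2 * x) $$ (h, 0) else c (2 * x - 1) $$ (h, 1)"
  have cont: "continuous_on {0..1} (\<lambda>t. c t $$ (h, g))" if "g < 2" for g
    using c h that by (auto simp: swap_path_def)
  have "continuous_on ({0..1/2} \<union> {1/2..1}) ?G"
  proof (rule continuous_on_If)
    show "continuous_on {0..1/2} (\<lambda>x. c (2 * x) $$ (h, 0))"
      by (rule continuous_on_compose2[OF cont[of 0]]) (auto intro!: continuous_intros)
    show "continuous_on {1/2..1} (\<lambda>x. c (2 * x - 1) $$ (h, 1))"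
      by (rule continuous_on_compose2[OF cont[of 1]]) (auto intro!: continuous_intros)
    show "c (2 * x) $$ (h, 0) = c (2 * x - 1) $$ (h, 1)" if "x \<in> {0..1/2}" "\<not> x \<le> 1/2" for x
      using that by simp
    show "c (2 * x) $$ (h, 0) = c (2 * x - 1) $$ (h, 1)" if "x \<in> {1/2..1}" "x \<le> 1/2" for x
    proof -
      have "2 * x = 1" "2 * x - 1 = 0" using that by auto
      then show ?thesis using h by (simp only: swap_path_ends) (auto simp: swap_path_ends less_2_cases_iff)
    qed
  qed auto
  moreover have "{0..1/2} \<union> {1/2..1} = {0..1::real}" by auto
  ultimately have "continuous_on UNIV (per ?G)"
    using h by (intro continuous_on_per) (auto simp: swap_path_ends less_2_cases_iff)
  then show ?thesis
    unfolding column_path_def by (rule continuous_on_compose2) (auto intro!: continuous_intros)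
qed

lemma real_mod_2_cases:
  obtains t g z where "t \<in> {0..1}" "g < (2::nat)" "y = t + real g + 2 * of_int z"
proof -
  have "y = frac y + of_int (\<lfloor>y\<rfloor> mod 2) + 2 * of_int (\<lfloor>y\<rfloor> div 2)"
    proof -
    have "\<lfloor>y\<rfloor> = \<lfloor>y\<rfloor> mod 2 + 2 * (\<lfloor>y\<rfloor> div 2)" by simp
    then have "real_of_int \<lfloor>y\<rfloor> = of_int (\<lfloor>y\<rfloor> mod 2) + 2 * of_int (\<lfloor>y\<rfloor> div 2)"
      by (metis of_int_add of_int_mult of_int_numeral)
    then show ?thesis by (simp add: frac_def)
  qed
  then have "y = frac y + real (nat (\<lfloor>y\<rfloor> mod 2)) + 2 * of_int (\<lfloor>y\<rfloor> div 2)" by simp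
  moreover have "frac y \<in> {0..1}" by (simp add: frac_lt_1 less_imp_le)
  moreover have "nat (\<lfloor>y\<rfloor> mod 2) < 2" by (simp add: nat_less_iff)
  ultimately show thesis by (rule that[rotated 2])
qed

lemma column_path_eq:
  "h < 2 \<Longrightarrow> t \<in> {0..1} \<Longrightarrow> g < 2 \<Longrightarrow> column_path c h (t + real g + 2 * of_int z) = c t $$ (h, g)"
  by (auto simp: column_path_periodic less_2_cases_iff column_path_0 column_path_1)

text \<open>The values at \<open>y\<close> and \<open>y + z\<close> are columns of one and the same
  unitary matrix: the same column for even \<open>z\<close>, different columns for odd
  \<open>z\<close>.\<close>

lemma column_path_orthonormal:
  "(\<Sum>h<2. cnj (column_path c h y) * column_path c h (y + of_int z)) = (if even z then 1 else 0)"
proof -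
  obtain t g u where y: "t \<in> {0..1}" "g < (2::nat)" "y = t + real g + 2 * of_int u"
    by (rule real_mod_2_cases)
  define g' where "g' = nat ((int g + z) mod 2)"
  have g': "g' < 2" by (simp add: g'_def nat_less_iff)
  have ig: "int g' = (int g + z) mod 2" by (simp add: g'_def)
  then have "int g + z = int g' + 2 * ((int g + z) div 2)" by simp
  then have "real g + of_int z = real g' + 2 * of_int ((int g + z) div 2)"
    by (metis of_int_add of_int_mult of_int_numeral of_int_of_nat_eq)
  then have yz: "y + of_int z = t + real g' + 2 * of_int (u + (int g + z) div 2)"
    by (simp add: y(3))
  have "column_path c h y = c t $$ (h, g)" "column_path c h (y + of_int z) = c t $$ (h, g')" if "h < 2" for h
    unfolding yz unfolding y(3) by (rule column_path_eq[OF that y(1)], use y(2) g' in simp)+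
  then have "(\<Sum>h<2. cnj (column_path c h y) * column_path c h (y + of_int z)) =
      (\<Sum>h<2. cnj (c t $$ (h, g)) * c t $$ (h, g'))"
    by (intro sum.cong refl) simp
  also have "\<dots> = (if g = g' then 1 else 0)" using y g' by (simp add: swap_path_columns)
  also have "g = g' \<longleftrightarrow> even z"
    using y(2) ig by presburger
  finally show ?thesis .
qed

text \<open>Two parameters at distance 1 give both columns of one unitary matrix, so this is the
  orthonormality of its rows; being a sum over a full period, it is unaffected by the sign.\<close>

lemma column_path_complete:
  assumes hh: "h < 2" "h' < 2"
  shows "(\<Sum>g<2. column_path c h (sg \<sigma> * (y + real g)) * cnj (column_path c h' (sg \<sigma> * (y + real g)))) =
    (if h = h' then 1 else 0)"
proof -
  let ?P = "\<lambda>y. column_path c h y * cnj (column_path c h' y)"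
  have P2: "?P (y + 2) = ?P y" for y by (simp add: column_path_periodic1)
  have base: "(\<Sum>g<2. ?P (y + real g)) = (if h = h' then 1 else 0)" for y
  proof -
    obtain t g u where y: "t \<in> {0..1}" "g < (2::nat)" "y = t + real g + 2 * of_int u"
      by (rule real_mod_2_cases)
    have "(\<Sum>g<2. ?P (t + real g + 2 * of_int u)) = (if h = h' then 1 else 0)"
      unfolding swap_path_rows[OF y(1) hh, symmetric]
      by (intro sum.cong refl) (use hh y(1) in \<open>simp add: column_path_eq\<close>)
    moreover have "(\<Sum>j<2. ?P (y + real j)) = (\<Sum>g<2. ?P (t + real g + 2 * of_int u))"
    proof (cases "g = 0")
      case False
      then have "y = (t + 2 * of_int u) + 1" using y by simp
      then show ?thesis
        using sum_shift_periodic[of ?P 2 "t + 2 * of_int u"] P2 by (simp add: add_ac)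
    qed (simp add: y add_ac)
    ultimately show ?thesis by simp
  qed
  show ?thesis
  proof (cases \<sigma>)
    case False
    then show ?thesis using sum_reflect_periodic[of ?P 2 "- y"] base[of "- y"] P2
      by (simp add: sg_def)
  qed (simp add: sg_def base)
qed

end

section \<open>Frames that diagonalize the connecting maps\<close>

text \<open>
  In the coordinates of \<^const>\<open>psi\<close> at stage \<open>n\<close>, with \<open>2 m = 4\<^sup>n\<close>, row \<open>p\<close> of the result consists
  of the \<open>2 m\<close>-block \<open>p div (2 * m)\<close> (even for \<open>\<phi>\<^sup>+\<close>, odd for \<open>\<phi>\<^sup>-\<close>) and, inside it, of the row
  \<open>(p div m) mod 2\<close> of the path; it comes from the row \<open>source m p\<close> of the argument.
\<close>

definition source :: "nat \<Rightarrow> nat \<Rightarrow> nat" where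
  "source m p = (let b = p div (2 * m) in (if even b then b div 2 else (3 - b) div 2) * m + p mod m)"

text \<open>Coordinate \<open>p\<close> of the frame vector number \<open>a\<close> over the point
  of the sheet \<open>w\<close> with parameter \<open>y\<close>. The head of the word belongs to the
  connecting map applied last. Each map halves the parameter and, if it is \<phi>-minus, reverses
  it.\<close>

fun frame :: "(real \<Rightarrow> complex mat) \<Rightarrow> nat \<Rightarrow> bool list \<Rightarrow> real \<Rightarrow> nat \<Rightarrow> nat \<Rightarrow> complex" where
  "frame c n [] y p a = (if p = a then 1 else 0)"
| "frame c n (\<sigma> # w) y p a =
    (let m = 4 ^ (n + length w) div 2
     in if even (p div (2 * m)) = \<sigma>
        then column_path c (p div m mod 2) (sg \<sigma> * y) * frame c n w (sg \<sigma> * y / 2) (source m p) a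
        else 0)"

declare frame.simps(2) [simp del]

definition words :: "nat \<Rightarrow> bool list set" where
  "words k = {w. length w = k}"

lemma finite_words [simp]: "finite (words k)"
  using finite_lists_length_eq[of "UNIV :: bool set" k] by (simp add: words_def)

lemma words_0 [simp]: "words 0 = {[]}"
  by (auto simp: words_def)

lemma sum_words_Suc: "(\<Sum>w\<in>words (Suc k). G w) = (\<Sum>\<sigma>\<in>UNIV. \<Sum>w\<in>words k. G (\<sigma> # w))"
proof -
  have "words (Suc k) = (\<lambda>(\<sigma>, w). \<sigma> # w) ` (UNIV \<times> words k)"
    by (auto simp: words_def length_Suc_conv image_iff)
  moreover have "inj_on (\<lambda>(\<sigma>, w). \<sigma> # w) (UNIV \<times> words k)" by (auto simp: inj_on_def)
  ultimately show ?thesis by (simp add: sum.reindex sum.cartesian_product case_prod_unfold)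
qed

lemma block_index_simps:
  fixes b h r m :: nat
  assumes "h < 2" "r < m"
  shows "((b * 2 + h) * m + r) div (2 * m) = b" "((b * 2 + h) * m + r) div m mod 2 = h"
    "((b * 2 + h) * m + r) mod m = r"
proof -
  have "((b * 2 + h) * m + r) div m = b * 2 + h" using assms by simp
  then show "((b * 2 + h) * m + r) div (2 * m) = b" "((b * 2 + h) * m + r) div m mod 2 = h"
    using assms by (simp_all add: mult.commute[of 2 m] div_mult2_eq)
qed (use assms in simp)

text \<open>Among the rows belonging to one sign, the row of the path and the source row determine
  \<open>p\<close>, and every pair occurs; so the sum factors.\<close>

lemma sum_rows:
  fixes C :: "nat \<Rightarrow> complex"
  assumes m: "m > 0"
  shows "(\<Sum>p<8 * m. if even (p div (2 * m)) = \<sigma> then C (p div m mod 2) * G (source m p) else 0) =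
    (\<Sum>h<2. C h) * (\<Sum>q<2 * m. G q)"
proof -
  have "8 * m = 4 * 2 * m" by simp
  then have "(\<Sum>p<8 * m. if even (p div (2 * m)) = \<sigma> then C (p div m mod 2) * G (source m p) else 0) =
    (\<Sum>b<4. \<Sum>h<2. \<Sum>r<m. let p = (b * 2 + h) * m + r in
      if even (p div (2 * m)) = \<sigma> then C (p div m mod 2) * G (source m p) else 0)"
    by (simp only: sum_lessThan_mult Let_def)
  also have "\<dots> = (\<Sum>b<4. \<Sum>h<2. \<Sum>r<m. if even b = \<sigma>
      then C h * G ((if even b then b div 2 else (3 - b) div 2) * m + r) else 0)"
    by (intro sum.cong refl) (simp add: Let_def block_index_simps source_def)
  also have "\<dots> = (\<Sum>b<4. if even b = \<sigma> then (\<Sum>h<2. C h) *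
      (\<Sum>r<m. G ((if even b then b div 2 else (3 - b) div 2) * m + r)) else 0)"
    by (intro sum.cong refl) (simp add: sum_product)
  also have "\<dots> = (\<Sum>h<2. C h) * (\<Sum>i<2. \<Sum>r<m. G (i * m + r))"
  proof -
    have four: "(\<Sum>b<4. X b) = X 0 + X 1 + X 2 + X 3" for X :: "nat \<Rightarrow> complex"
      by (simp add: eval_nat_numeral)
    have two: "(\<Sum>i<2. X i) = X 0 + X 1" for X :: "nat \<Rightarrow> complex"
      by (simp add: eval_nat_numeral)
    show ?thesis unfolding four two by (cases \<sigma>) (simp_all add: algebra_simps)
  qed
  finally show ?thesis by (simp only: sum_lessThan_mult)
qed

lemma source_less:
  assumes "p < 8 * m" shows "source m p < 2 * m"
proof -
  have m: "m > 0" using assms by (cases m) auto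
  have b: "p div (2 * m) < 4" using assms m by (simp add: less_mult_imp_div_less)
  have r: "p mod m < m" using m by simp
  have "(if even (p div (2 * m)) then p div (2 * m) div 2 else (3 - p div (2 * m)) div 2) \<le> 1"
    using b by auto
  then have "(if even (p div (2 * m)) then p div (2 * m) div 2 else (3 - p div (2 * m)) div 2) * m \<le> 1 * m"
    by (rule mult_right_mono) simp
  then show ?thesis unfolding source_def Let_def using r by linarith
qed

lemma four_power_half: "n \<ge> 1 \<Longrightarrow> 2 * (4 ^ n div 2) = (4 ^ n :: nat)"
  by (cases n) auto

lemma frame_periodic: "frame c n w (y + 2 ^ length w * of_int z) p a = frame c n w y p a"
proof (induction w arbitrary: y z p)
  case (Cons \<sigma> w)
  define u where "u = (if \<sigma> then z else - z)"
  have s: "sg \<sigma> * of_int z = of_int u" by (simp add: u_def sg_def)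
  have 1: "sg \<sigma> * (y + 2 ^ length (\<sigma> # w) * of_int z) = sg \<sigma> * y + 2 * of_int (2 ^ length w * u)"
    using s by (simp add: algebra_simps)
  have 2: "sg \<sigma> * (y + 2 ^ length (\<sigma> # w) * of_int z) / 2 = sg \<sigma> * y / 2 + 2 ^ length w * of_int u"
    using s by (simp add: algebra_simps)
  show ?case
    unfolding frame.simps 2 Cons.IH unfolding 1 column_path_periodic ..
qed simp

text \<open>The candidate for the composite of \<open>k\<close> connecting maps: conjugation by the
  frame of the direct sum, over all sheets and all points over \<open>y\<close>, of the values of
  \<open>F\<close> at these points.\<close>

definition frame_sum :: "(real \<Rightarrow> complex mat) \<Rightarrow> nat \<Rightarrow> nat \<Rightarrow> (real \<Rightarrow> nat \<Rightarrow> nat \<Rightarrow> complex) \<Rightarrow> real \<Rightarrow> nat \<Rightarrow> nat \<Rightarrow> complex" where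
  "frame_sum c n k F y p q = (\<Sum>w\<in>words k. \<Sum>j<2 ^ k. \<Sum>a<4 ^ n. \<Sum>b<4 ^ n.
     frame c n w (y + real j) p a * F (word_sign w * (y + real j) / 2 ^ k) a b * cnj (frame c n w (y + real j) q b))"

lemma frame_periodic_nat: "length w = k \<Longrightarrow> frame c n w (y + 2 ^ k) p a = frame c n w y p a"
  using frame_periodic[of c n w y 1] by simp

lemma periodic_word_sign:
  fixes F :: "real \<Rightarrow> nat \<Rightarrow> nat \<Rightarrow> complex"
  assumes "\<And>y z. F (y + of_int z) = F y"
  shows "F (word_sign w * (y + 2 ^ k) / 2 ^ k) = F (word_sign w * y / 2 ^ k)"
proof -
  define z :: int where "z = (if word_sign w = 1 then 1 else - 1)"
  have "word_sign w * (y + 2 ^ k) / 2 ^ k = word_sign w * y / 2 ^ k + of_int z"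
    using word_sign_cases[of w] by (auto simp: z_def field_simps)
  then show ?thesis by (simp only: assms)
qed

context
  fixes c :: "real \<Rightarrow> complex mat" and n :: nat
  assumes c: "swap_path c" and n: "n \<ge> 1"
begin

lemma continuous_on_frame: "continuous_on UNIV (\<lambda>y. frame c n w y p a)"
proof (induction w arbitrary: p)
  case (Cons \<sigma> w)
  define m where "m = (4 ^ (n + length w) div 2 :: nat)"
  have 1: "continuous_on UNIV (\<lambda>y. column_path c (p div m mod 2) (sg \<sigma> * y))"
    by (rule continuous_on_compose2[OF continuous_on_column_path[OF c]]) (auto intro!: continuous_intros)
  have 2: "continuous_on UNIV (\<lambda>y. frame c n w (sg \<sigma> * y / 2) (source m p) a)"
    by (rule continuous_on_compose2[OF Cons.IH]) (auto intro!: continuous_intros)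
  show ?case
    by (cases "even (p div (2 * m)) = \<sigma>")
      (simp_all add: frame.simps(2) Let_def m_def[symmetric] continuous_on_mult[OF 1 2])
qed simp

text \<open>Induction along the word. Different heads occupy different block rows. For equal heads
  the sum factors: the path tests whether \<open>z\<close> is even, and the shorter word then sees
  the shift halved. Hence divisibility by the power of two.\<close>

lemma frame_orthonormal:
  "length w' = length w \<Longrightarrow> a < 4 ^ n \<Longrightarrow> a' < 4 ^ n \<Longrightarrow>
    (\<Sum>p<4 ^ (n + length w). cnj (frame c n w y p a) * frame c n w' (y + of_int z) p a') =
    (if w = w' \<and> 2 ^ length w dvd z \<and> a = a' then 1 else 0)"
proof (induction w arbitrary: w' y z)
  case Nil
  then have "(\<Sum>p<4 ^ n. cnj (if p = a then 1 else 0) * (if p = a' then 1 else (0 :: complex))) =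
      (\<Sum>p<4 ^ n. if p = a then (if a = a' then 1 else 0) else 0)"
    by (intro sum.cong) auto
  moreover have "w' = []" using Nil by simp
  ultimately show ?case using Nil by simp
next
  case (Cons \<sigma> w)
  obtain \<sigma>' v where w': "w' = \<sigma>' # v" and v: "length v = length w"
    using Cons.prems(1) by (cases w') auto
  define m where "m = (4 ^ (n + length w) div 2 :: nat)"
  have m2: "2 * m = 4 ^ (n + length w)" using n by (simp add: m_def four_power_half del: mult_2)
  then have m: "m > 0" by (cases m) auto
  have m8: "4 ^ (n + length (\<sigma> # w)) = 8 * m" using m2 by simp
  show ?case
  proof (cases "\<sigma> = \<sigma>'")
    case False
    have "(\<Sum>p<4 ^ (n + length (\<sigma> # w)). cnj (frame c n (\<sigma> # w) y p a) * frame c n w' (y + of_int z) p a') = 0"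
      unfolding w' frame.simps v Let_def using False by (intro sum.neutral ballI) simp
    then show ?thesis using False w' by simp
  next
    case True
    define u where "u = (if \<sigma> then z else - z)"
    have s: "sg \<sigma> * of_int z = of_int u" by (simp add: u_def sg_def)
    define C where "C h = cnj (column_path c h (sg \<sigma> * y)) * column_path c h (sg \<sigma> * y + of_int u)" for h
    define G where "G q = cnj (frame c n w (sg \<sigma> * y / 2) q a) * frame c n v (sg \<sigma> * y / 2 + of_int u / 2) q a'" for q
    have e: "sg \<sigma> * (y + of_int z) = sg \<sigma> * y + of_int u" using s by (simp add: algebra_simps)
    have "(\<Sum>p<8 * m. cnj (frame c n (\<sigma> # w) y p a) * frame c n w' (y + of_int z) p a') =
      (\<Sum>p<8 * m. if even (p div (2 * m)) = \<sigma> then C (p div m mod 2) * G (source m p) else 0)"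
      unfolding w' True[symmetric] frame.simps v m_def[symmetric] Let_def e C_def G_def add_divide_distrib
      by (intro sum.cong refl) simp
    also have "\<dots> = (\<Sum>h<2. C h) * (\<Sum>q<2 * m. G q)" by (rule sum_rows[OF m])
    also have "(\<Sum>h<2. C h) = (if even u then 1 else 0)"
      unfolding C_def by (rule column_path_orthonormal[OF c])
    also have "(if even u then 1 else 0) * (\<Sum>q<2 * m. G q) =
        (if \<sigma> # w = w' \<and> 2 ^ length (\<sigma> # w) dvd z \<and> a = a' then 1 else 0)"
    proof (cases "even u")
      case ev: True
      then obtain x where x: "u = 2 * x" by blast
      have "(\<Sum>q<2 * m. G q) = (if w = v \<and> 2 ^ length w dvd x \<and> a = a' then 1 else 0)"
        unfolding G_def m2 x using Cons.IH[OF v Cons.prems(2,3), of "sg \<sigma> * y / 2" x] by simp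
      moreover have "2 ^ length (\<sigma> # w) dvd z \<longleftrightarrow> 2 ^ length w dvd x"
      proof -
        have "z = 2 * (if \<sigma> then x else - x)" using x by (cases \<sigma>) (simp_all add: u_def)
        then show ?thesis by (cases \<sigma>) simp_all
      qed
      ultimately show ?thesis using ev True w' by simp
    next
      case False
      then have "odd z" by (cases \<sigma>) (simp_all add: u_def)
      then have "\<not> 2 ^ length (\<sigma> # w) dvd z" by (metis dvd_mult_left length_Cons power_Suc)
      then show ?thesis using False by simp
    qed
    finally show ?thesis unfolding m8 .
  qed
qed

text \<open>Moving \<open>y\<close> by 1 permutes the points of each sheet cyclically, and both the
  frame and the argument of \<open>F\<close> return after a full round.\<close>

lemma frame_sum_periodic:
  assumes F: "\<And>y z. F (y + of_int z) = F y"
  shows "frame_sum c n k F (y + of_int z) = frame_sum c n k F y"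
proof -
  have 1: "frame_sum c n k F (y + 1) p q = frame_sum c n k F y p q" for y p q
    unfolding frame_sum_def
  proof (rule sum.cong[OF refl])
    fix w assume "w \<in> words k"
    then show "(\<Sum>j<2 ^ k. \<Sum>a<4 ^ n. \<Sum>b<4 ^ n. frame c n w (y + 1 + real j) p a *
          F (word_sign w * (y + 1 + real j) / 2 ^ k) a b * cnj (frame c n w (y + 1 + real j) q b)) =
        (\<Sum>j<2 ^ k. \<Sum>a<4 ^ n. \<Sum>b<4 ^ n. frame c n w (y + real j) p a *
          F (word_sign w * (y + real j) / 2 ^ k) a b * cnj (frame c n w (y + real j) q b))"
      by (intro sum_shift_periodic[where M = "2 ^ k"])
        (simp add: words_def frame_periodic_nat periodic_word_sign[of F, OF F])
  qed
  have nat: "frame_sum c n k F (y + real j) = frame_sum c n k F y" for y j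
  proof (induction j)
    case (Suc j)
    then show ?case using 1[of "y + real j"] by (simp add: fun_eq_iff add_ac)
  qed simp
  show ?thesis
  proof (cases "z \<ge> 0")
    case True
    then show ?thesis using nat[of y "nat z"] by simp
  next
    case False
    then show ?thesis using nat[of "y + of_int z" "nat (- z)"] by simp
  qed
qed

text \<open>Only words whose head is the common sign of the block rows of \<open>p\<close> and
  \<open>q\<close> contribute. The right-hand side has the form of the entry formula
  \<open>psi_index\<close>, so that the composite can be computed by induction on
  \<open>k\<close>.\<close>

lemma frame_sum_Suc:
  fixes k :: nat
  assumes F: "\<And>y z. F (y + of_int z) = F y"
  defines "m \<equiv> (4 ^ (n + k) div 2 :: nat)"
  shows "frame_sum c n (Suc k) F y p q =
    (if even (p div (2 * m)) = even (q div (2 * m)) then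
      let s = sg (even (p div (2 * m))) in
      \<Sum>g<2. column_path c (p div m mod 2) (s * (y + real g)) * cnj (column_path c (q div m mod 2) (s * (y + real g))) *
        frame_sum c n k F (s * (y + real g) / 2) (source m p) (source m q)
     else 0)"
proof -
  define \<sigma> where "\<sigma> = even (p div (2 * m))"
  define C where "C y = column_path c (p div m mod 2) y * cnj (column_path c (q div m mod 2) y)" for y
  define Q where "Q w y = (\<Sum>a<4 ^ n. \<Sum>b<4 ^ n. frame c n w y (source m p) a *
    F (word_sign w * y / 2 ^ k) a b * cnj (frame c n w y (source m q) b))" for w y
  have C: "C (y + 2 * of_int z) = C y" for y z by (simp add: C_def column_path_periodic)
  have Q: "Q w (y + real (2 ^ k)) = Q w y" if "w \<in> words k" for w y
    using that unfolding Q_def by (simp add: words_def frame_periodic_nat periodic_word_sign[of F, OF F])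
  define T where "T \<tau> w = (\<Sum>j<2 ^ Suc k. \<Sum>a<4 ^ n. \<Sum>b<4 ^ n. frame c n (\<tau> # w) (y + real j) p a *
    F (word_sign (\<tau> # w) * (y + real j) / 2 ^ Suc k) a b * cnj (frame c n (\<tau> # w) (y + real j) q b))" for \<tau> w
  have zero: "T \<tau> w = 0" if "w \<in> words k" "\<tau> \<noteq> \<sigma> \<or> \<sigma> \<noteq> even (q div (2 * m))" for \<tau> w
    unfolding T_def using that
    by (intro sum.neutral ballI) (auto simp: frame.simps(2) words_def m_def[symmetric] \<sigma>_def Let_def)
  show ?thesis
  proof (cases "\<sigma> = even (q div (2 * m))")
    case True
    have "T \<sigma> w = (\<Sum>g<2. C (sg \<sigma> * (y + real g)) * (\<Sum>j<2 ^ k. Q w (sg \<sigma> * (y + real g) / 2 + real j)))"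
      if w: "w \<in> words k" for w
    proof -
      have "T \<sigma> w = (\<Sum>j<2 * 2 ^ k. C (sg \<sigma> * (y + real j)) * Q w (sg \<sigma> * (y + real j) / 2))"
        unfolding T_def power_Suc
      proof (rule sum.cong[OF refl])
        fix j
        have lw: "length w = k" using w by (simp add: words_def)
        have f: "frame c n (\<sigma> # w) x r a = column_path c (r div m mod 2) (sg \<sigma> * x) * frame c n w (sg \<sigma> * x / 2) (source m r) a"
          if "even (r div (2 * m)) = \<sigma>" for r x a
          using that by (simp add: frame.simps(2) lw m_def[symmetric] Let_def)
        have e: "word_sign (\<sigma> # w) * (y + real j) / (2 * 2 ^ k) = word_sign w * (sg \<sigma> * (y + real j) / 2) / 2 ^ k"
          by simp
        show "(\<Sum>a<4 ^ n. \<Sum>b<4 ^ n. frame c n (\<sigma> # w) (y + real j) p a *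
            F (word_sign (\<sigma> # w) * (y + real j) / (2 * 2 ^ k)) a b * cnj (frame c n (\<sigma> # w) (y + real j) q b)) =
            C (sg \<sigma> * (y + real j)) * Q w (sg \<sigma> * (y + real j) / 2)"
          unfolding e f[OF \<sigma>_def[symmetric]] f[OF True[symmetric]] C_def Q_def sum_distrib_left
          by (intro sum.cong refl) (simp add: mult_ac)
      qed
      also have "\<dots> = (\<Sum>g<2. C (sg \<sigma> * (y + real g)) * (\<Sum>j<2 ^ k. Q w (sg \<sigma> * (y + real g) / 2 + real j)))"
        using C Q[OF w] by (rule sum_periodic_double[where C = C and Q = "Q w" and M = "2 ^ k"])
      finally show ?thesis .
    qed
    then have "(\<Sum>w\<in>words k. T \<sigma> w) = (\<Sum>g<2. C (sg \<sigma> * (y + real g)) *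
        frame_sum c n k F (sg \<sigma> * (y + real g) / 2) (source m p) (source m q))"
      by (simp add: frame_sum_def Q_def sum_distrib_left) (rule sum.swap)
    moreover have "frame_sum c n (Suc k) F y p q = (\<Sum>w\<in>words k. T \<sigma> w)"
      unfolding frame_sum_def sum_words_Suc T_def[symmetric] UNIV_bool
      using zero[of _ "\<not> \<sigma>"] by (cases \<sigma>) simp_all
    ultimately show ?thesis using True by (simp add: \<sigma>_def C_def Let_def)
  next
    case False
    then show ?thesis
      unfolding frame_sum_def sum_words_Suc T_def[symmetric]
      using zero by (simp add: \<sigma>_def)
  qed
qed

text \<open>Applied to the constant identity, \<open>frame_sum\<close> is the matrix of inner
  products of the rows of the frame, and its recursion reduces completeness to that of the
  path.\<close>

lemma frame_complete:
  "p < 4 ^ (n + k) \<Longrightarrow> q < 4 ^ (n + k) \<Longrightarrow>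
    frame_sum c n k (\<lambda>_ a b. if a = b then 1 else 0) y p q = (if p = q then 1 else 0)"
proof (induction k arbitrary: p q y)
  case 0
  have "frame_sum c n 0 (\<lambda>_ a b. if a = b then 1 else 0) y p q =
      (\<Sum>a<4 ^ n. (if p = a then 1 else 0) * cnj (if q = a then 1 else 0))"
    by (simp add: frame_sum_def if_distrib[of "\<lambda>z. _ * z * _"] cong: if_cong)
  also have "\<dots> = (\<Sum>a<4 ^ n. if a = p then if p = q then 1 else 0 else 0)"
    by (intro sum.cong refl) auto
  finally show ?case using 0 by simp
next
  case (Suc k)
  define m where "m = (4 ^ (n + k) div 2 :: nat)"
  have m2: "2 * m = 4 ^ (n + k)" using n by (simp add: m_def four_power_half del: mult_2)
  have lt: "p < 8 * m" "q < 8 * m" using Suc.prems m2 by simp_all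
  have IH: "frame_sum c n k (\<lambda>_ a b. if a = b then 1 else 0) y' (source m p) (source m q) =
      (if source m p = source m q then 1 else 0)" for y'
    using Suc.IH source_less[OF lt(1)] source_less[OF lt(2)] by (simp add: m2)
  let ?hp = "p div m mod 2" and ?hq = "q div m mod 2"
  have key: "frame_sum c n (Suc k) (\<lambda>_ a b. if a = b then 1 else 0) y p q =
    (if even (p div (2 * m)) = even (q div (2 * m)) \<and> source m p = source m q \<and> ?hp = ?hq then 1 else 0)"
    unfolding frame_sum_Suc[of "\<lambda>_ a b. if a = b then 1 else 0", OF refl] m_def[symmetric] Let_def IH
    using column_path_complete[OF c, of ?hp ?hq "even (p div (2 * m))" y]
    by (auto simp: sum_distrib_right[symmetric])
  \<comment> \<open>The sign of the block, the source row and the row of the path determine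
    \<open>p\<close>: within one sign, the block is recovered from its source block.\<close>
  have "p = q" if "even (p div (2 * m)) = even (q div (2 * m))" "source m p = source m q" "?hp = ?hq"
  proof -
    have m: "m > 0" using lt by (cases m) auto
    have b: "p div (2 * m) < 4" "q div (2 * m) < 4" using lt m by (simp_all add: less_mult_imp_div_less)
    have r: "p mod m < m" "q mod m < m" using m by simp_all
    define B where "B b = (if even b then b div 2 else (3 - b) div 2)" for b :: nat
    have BB: "B (p div (2 * m)) * m + p mod m = B (q div (2 * m)) * m + q mod m"
      using that(2) by (simp add: source_def B_def Let_def)
    have inj: "b = b'" if "B b = B b'" "even b = even b'" "b < 4" "b' < 4" for b b'
      using that unfolding B_def by (simp split: if_splits) presburger+
    have eq: "p mod m = q mod m" "B (p div (2 * m)) = B (q div (2 * m))"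
      using BB r m by (metis mod_mult_self3 mod_less, metis div_mult_self3 div_less add.left_neutral add.right_neutral less_not_refl)
    have "p div (2 * m) = q div (2 * m)"
      using inj eq(2) that(1) b by blast
    moreover have "p div m = 2 * (p div (2 * m)) + ?hp" "q div m = 2 * (q div (2 * m)) + ?hq"
      by (simp_all add: mult.commute[of 2 m] div_mult2_eq)
    ultimately have "p div m = q div m" using that(3) by simp
    then show ?thesis using eq(1) by (metis div_mult_mod_eq)
  qed
  then show ?case unfolding key by auto
qed

end

section \<open>Entries of the connecting maps\<close>

lemma inflate_index:
  assumes "C \<in> carrier_mat 2 2" "h < 2" "g < 2" "r < m" "s < m"
  shows "inflate m C $$ (h * m + r, g * m + s) = (if r = s then C $$ (h, g) else 0)"
  using assms by (auto simp: inflate_def less_2_cases_iff)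

lemma inflate_dim [simp]: "dim_row (inflate m C) = 2 * m" "dim_col (inflate m C) = 2 * m"
  by (simp_all add: inflate_def)

lemma sum_delta_index:
  fixes F :: "nat \<Rightarrow> complex"
  assumes "r < m"
  shows "(\<Sum>s<m. if r = s then F s else 0) = F r"
  using assms by simp

lemma phi_plus_index:
  assumes c: "swap_path c" and t: "t \<in> {0..1}"
    and f: "\<And>g. g < 2 \<Longrightarrow> f ((t + real g) / 2) \<in> carrier_mat m m"
    and hr: "h < 2" "h' < 2" "r < m" "r' < m"
  shows "phi_plus c m f t $$ (h * m + r, h' * m + r') =
    (\<Sum>g<2. c t $$ (h, g) * cnj (c t $$ (h', g)) * f ((t + real g) / 2) $$ (r, r'))"
proof -
  let ?I = "inflate m (c t)"
  let ?D = "four_block_mat (f (t / 2)) (0\<^sub>m m m) (0\<^sub>m m m) (f ((t + 1) / 2))"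
  have c2: "c t \<in> carrier_mat 2 2" by (rule swap_path_carrier[OF c t])
  have f0: "f (t / 2) \<in> carrier_mat m m" "f ((t + 1) / 2) \<in> carrier_mat m m"
    using f[of 0] f[of 1] by simp_all
  have D: "?D $$ (g * m + s, g' * m + s') = (if g = g' then f ((t + real g) / 2) $$ (s, s') else 0)"
    if "g < 2" "g' < 2" "s < m" "s' < m" for g g' s s'
    using that f0 by (auto simp: less_2_cases_iff)
  have Dd: "dim_row ?D = 2 * m" "dim_col ?D = 2 * m" using f0 by auto
  have lt: "g * m + s < 2 * m" if "g < 2" "s < m" for g s
    using that by (auto simp: less_2_cases_iff)
  have ID: "(?I * ?D) $$ (h * m + r, g * m + s) = c t $$ (h, g) * f ((t + real g) / 2) $$ (r, s)"
    if g: "g < 2" "s < m" for g s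
  proof -
    have "(?I * ?D) $$ (h * m + r, g * m + s) = (\<Sum>l<2 * m. ?I $$ (h * m + r, l) * ?D $$ (l, g * m + s))"
      using lt[OF hr(1,3)] lt[OF g] Dd by (simp add: scalar_prod_def atLeast0LessThan)
    also have "\<dots> = (\<Sum>i<2. \<Sum>x<m. if r = x then if i = g then c t $$ (h, i) * f ((t + real i) / 2) $$ (x, s) else 0 else 0)"
      unfolding sum_lessThan_mult
      by (intro sum.cong refl) (use g hr in \<open>simp add: inflate_index[OF c2] D\<close>)
    also have "\<dots> = (\<Sum>i<2. if i = g then c t $$ (h, i) * f ((t + real i) / 2) $$ (r, s) else 0)"
      by (simp only: sum_delta_index[OF hr(3)])
    finally show ?thesis using g by simp
  qed
  have "phi_plus c m f t $$ (h * m + r, h' * m + r') =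
      (\<Sum>l<2 * m. (?I * ?D) $$ (h * m + r, l) * cnj (?I $$ (h' * m + r', l)))"
    using lt[OF hr(1,3)] lt[OF hr(2,4)] Dd t
    by (simp add: phi_plus_def scalar_prod_def atLeast0LessThan mat_adjoint_index del: index_mult_mat(1))
      (simp add: scalar_prod_def atLeast0LessThan mat_adjoint_index)
  also have "\<dots> = (\<Sum>g<2. \<Sum>x<m. if r' = x then c t $$ (h, g) * f ((t + real g) / 2) $$ (r, x) * cnj (c t $$ (h', g)) else 0)"
    unfolding sum_lessThan_mult
    by (intro sum.cong refl) (use hr in \<open>simp add: ID inflate_index[OF c2]\<close>)
  also have "\<dots> = (\<Sum>g<2. c t $$ (h, g) * f ((t + real g) / 2) $$ (r, r') * cnj (c t $$ (h', g)))"
    by (simp only: sum_delta_index[OF hr(4)])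
  finally show ?thesis by (simp add: mult_ac)
qed

lemma phi_plus_dim:
  "t \<in> {0..1} \<Longrightarrow> phi_plus c m f t \<in> carrier_mat (2 * m) (2 * m)"
  by (auto simp: phi_plus_def intro!: carrier_matI)

lemma four_block_four_block_index:
  fixes M :: "nat \<Rightarrow> nat \<Rightarrow> 'b::zero mat"
  assumes M: "\<And>b b'. M b b' \<in> carrier_mat d d" and lt: "b < 4" "b' < 4" "x < d" "x' < d"
  shows "four_block_mat
      (four_block_mat (M 0 0) (M 0 1) (M 1 0) (M 1 1)) (four_block_mat (M 0 2) (M 0 3) (M 1 2) (M 1 3))
      (four_block_mat (M 2 0) (M 2 1) (M 3 0) (M 3 1)) (four_block_mat (M 2 2) (M 2 3) (M 3 2) (M 3 3))
      $$ (b * d + x, b' * d + x') = M b b' $$ (x, x')"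
proof -
  have d: "dim_row (M i j) = d" "dim_col (M i j) = d" for i j using M[of i j] by auto
  have "b = 0 \<or> b = 1 \<or> b = 2 \<or> b = 3" "b' = 0 \<or> b' = 1 \<or> b' = 2 \<or> b' = 3" using lt by auto
  then show ?thesis using lt d by (elim disjE) simp_all
qed

lemma row_decomposition:
  assumes "p < 8 * (m :: nat)"
  obtains b h r where "b < 4" "h < 2" "r < m" "p = (b * 2 + h) * m + r"
proof
  have m: "m > 0" using assms by (cases m) auto
  show "p div (2 * m) < 4" using assms m by (simp add: less_mult_imp_div_less)
  show "p div m mod 2 < 2" by simp
  show "p mod m < m" using m by simp
  have "p div m = p div (2 * m) * 2 + p div m mod 2"
    by (simp add: mult.commute[of 2 m] div_mult2_eq)
  then show "p = (p div (2 * m) * 2 + p div m mod 2) * m + p mod m" by (metis div_mult_mod_eq)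
qed

lemma psi_carrier:
  assumes "N \<ge> 1" "t \<in> {0..1}"
  shows "psi c N f t \<in> carrier_mat (4 ^ Suc N) (4 ^ Suc N)"
proof -
  have m: "4 ^ Suc N = 4 * (2 * (4 ^ N div 2 :: nat))" using four_power_half[OF assms(1)] by simp
  have "1 - t \<in> {0..1}" using assms by simp
  then have "dim_row (phi_plus c (4 ^ N div 2) (block (4 ^ N div 2) f i j) t) = 2 * (4 ^ N div 2)"
    "dim_col (phi_plus c (4 ^ N div 2) (block (4 ^ N div 2) f i j) t) = 2 * (4 ^ N div 2)"
    "dim_row (phi_minus c (4 ^ N div 2) (block (4 ^ N div 2) f i j) t) = 2 * (4 ^ N div 2)"
    "dim_col (phi_minus c (4 ^ N div 2) (block (4 ^ N div 2) f i j) t) = 2 * (4 ^ N div 2)" for i j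
    using assms phi_plus_dim[of t c "4 ^ N div 2" "block (4 ^ N div 2) f i j"]
      phi_plus_dim[of "1 - t" c "4 ^ N div 2" "block (4 ^ N div 2) f i j"]
    by (auto simp: phi_minus_def simp del: One_nat_def)
  then show ?thesis unfolding m using assms by (auto simp: psi_def Let_def intro!: carrier_matI)
qed

text \<open>Evaluating the periodic extensions at negative parameters absorbs the reversal in
  \<phi>-minus, so that one formula with a sign covers both kinds of blocks.\<close>

lemma psi_index:
  assumes c: "swap_path c" and N: "N \<ge> 1" and g: "g \<in> circle_algebra (4 ^ N)" and t: "t \<in> {0..1}"
  defines "m \<equiv> (4 ^ N div 2 :: nat)"
  assumes pq: "p < 8 * m" "q < 8 * m"
  shows "psi c N g t $$ (p, q) =
    (if even (p div (2 * m)) = even (q div (2 * m)) then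
      let s = sg (even (p div (2 * m))) in
      \<Sum>i<2. column_path c (p div m mod 2) (s * (t + real i)) * cnj (column_path c (q div m mod 2) (s * (t + real i))) *
        per g (s * (t + real i) / 2) $$ (source m p, source m q)
     else 0)"
proof -
  obtain b h r where p: "b < 4" "h < 2" "r < m" "p = (b * 2 + h) * m + r"
    using row_decomposition[OF pq(1)] by metis
  obtain b' h' r' where q: "b' < 4" "h' < 2" "r' < m" "q = (b' * 2 + h') * m + r'"
    using row_decomposition[OF pq(2)] by metis
  have t': "1 - t \<in> {0..1}" using t by simp
  have g01: "g 0 = g 1" using g by (auto simp: circle_algebra_def)
  \<comment> \<open>The array of \<open>psi\<close> as a function of the block position. In odd
    positions \<open>3 - b\<close> reverses the order of the two source blocks; this is the exchange
    of diagonal and of off-diagonal entries in the \<phi>-minus part.\<close>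
  define M where "M b b' = (if even b = even b' then
      if even b then phi_plus c m (block m g (b div 2) (b' div 2)) t
      else phi_minus c m (block m g ((3 - b) div 2) ((3 - b') div 2)) t
    else 0\<^sub>m (2 * m) (2 * m))" for b b'
  have Mc: "M b b' \<in> carrier_mat (2 * m) (2 * m)" for b b'
    using phi_plus_dim[OF t, of c m] phi_plus_dim[OF t', of c m] t by (auto simp: M_def phi_minus_def)
  have psi: "psi c N g t = four_block_mat
      (four_block_mat (M 0 0) (M 0 1) (M 1 0) (M 1 1)) (four_block_mat (M 0 2) (M 0 3) (M 1 2) (M 1 3))
      (four_block_mat (M 2 0) (M 2 1) (M 3 0) (M 3 1)) (four_block_mat (M 2 2) (M 2 3) (M 3 2) (M 3 3))"
    using t by (simp add: psi_def Let_def M_def m_def[symmetric])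
  have lt: "h * m + r < 2 * m" "h' * m + r' < 2 * m"
    using p q by (auto simp: less_2_cases_iff)
  have pe: "p = b * (2 * m) + (h * m + r)" and qe: "q = b' * (2 * m) + (h' * m + r')"
    using p q by (simp_all add: algebra_simps)
  have "psi c N g t $$ (p, q) = M b b' $$ (h * m + r, h' * m + r')"
    unfolding psi pe qe by (rule four_block_four_block_index[OF Mc p(1) q(1) lt])
  also have "\<dots> = (if even b = even b' then
      let s = sg (even b) in
      \<Sum>i<2. column_path c h (s * (t + real i)) * cnj (column_path c h' (s * (t + real i))) *
        per g (s * (t + real i) / 2) $$ (source m p, source m q)
     else 0)"
  proof (cases "even b = even b'")
    case False
    then show ?thesis using lt by (simp add: M_def)
  next
    case True
    define B where "B b = (if even b then b div 2 else (3 - b) div 2)" for b :: nat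
    have src: "source m p = B b * m + r" "source m q = B b' * m + r'"
      using p q by (simp_all add: source_def block_index_simps B_def Let_def)
    have phi: "phi_plus c m (block m g (B b) (B b')) x $$ (h * m + r, h' * m + r') =
        (\<Sum>i<2. c x $$ (h, i) * cnj (c x $$ (h', i)) * g ((x + real i) / 2) $$ (source m p, source m q))"
      if x: "x \<in> {0..1}" for x
    proof -
      have x': "(x + real i) / 2 \<in> {0..1}" if "i < 2" for i
        using x that by (auto simp: less_2_cases_iff)
      show ?thesis
        using p(1-3) q(1-3) x'
        by (subst phi_plus_index[OF c x]) (auto simp: block_def src intro!: sum.cong)
    qed
    show ?thesis
    proof (cases "even b")
      case ev: True
      have "M b b' $$ (h * m + r, h' * m + r') =
          (\<Sum>i<2. c t $$ (h, i) * cnj (c t $$ (h', i)) * g ((t + real i) / 2) $$ (source m p, source m q))"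
        using phi[OF t] True ev by (simp add: M_def B_def)
      also have "\<dots> = (\<Sum>i<2. column_path c h (t + real i) * cnj (column_path c h' (t + real i)) *
          per g ((t + real i) / 2) $$ (source m p, source m q))"
      proof (intro sum.cong refl)
        fix i :: nat assume "i \<in> {..<2}"
        then have i: "i < 2" by simp
        have "per g ((t + real i) / 2) = g ((t + real i) / 2)"
          by (rule per_eq[where g = g, OF g01]) (use t i in \<open>auto simp: less_2_cases_iff\<close>)
        moreover have "column_path c h (t + real i) = c t $$ (h, i)" "column_path c h' (t + real i) = c t $$ (h', i)"
          using column_path_eq[OF c p(2) t i, of 0] column_path_eq[OF c q(2) t i, of 0] by simp_all
        ultimately show "c t $$ (h, i) * cnj (c t $$ (h', i)) * g ((t + real i) / 2) $$ (source m p, source m q) =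
          column_path c h (t + real i) * cnj (column_path c h' (t + real i)) *
          per g ((t + real i) / 2) $$ (source m p, source m q)" by simp
      qed
      finally show ?thesis using True ev by (simp add: sg_def)
    next
      case od: False
      let ?T = "\<lambda>i. column_path c h (- (t + real i)) * cnj (column_path c h' (- (t + real i))) *
          per g (- (t + real i) / 2) $$ (source m p, source m q)"
      \<comment> \<open>Column \<open>i\<close> at the reversed parameter \<open>1 - t\<close> is
        the continued path at \<open>- (t + (1 - i))\<close>, up to its period 2; halving this turns
        the shift by 2 into a full turn for \<open>g\<close>.\<close>
      have T: "?T (1 - i) = c (1 - t) $$ (h, i) * cnj (c (1 - t) $$ (h', i)) * g ((1 - t + real i) / 2) $$ (source m p, source m q)"
        if i: "i < 2" for i
      proof -
        have e: "- (t + real (1 - i)) = (1 - t) + real i + 2 * of_int (- 1)"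
          using i by (auto simp: less_2_cases_iff)
        have e2: "- (t + real (1 - i)) / 2 = (1 - t + real i) / 2 + of_int (- 1)"
          unfolding e by (simp add: field_simps)
        have "per g ((1 - t + real i) / 2) = g ((1 - t + real i) / 2)"
          by (rule per_eq[where g = g, OF g01]) (use t i in \<open>auto simp: less_2_cases_iff\<close>)
        then show ?thesis
          unfolding e2 per_add_int unfolding e column_path_eq[OF c p(2) t' i] column_path_eq[OF c q(2) t' i] by simp
      qed
      have "M b b' $$ (h * m + r, h' * m + r') =
          (\<Sum>i<2. c (1 - t) $$ (h, i) * cnj (c (1 - t) $$ (h', i)) * g ((1 - t + real i) / 2) $$ (source m p, source m q))"
        using phi[OF t'] True od t by (simp add: M_def B_def phi_minus_def)
      also have "\<dots> = (\<Sum>i<2. ?T (1 - i))"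
        by (intro sum.cong refl T[symmetric]) simp
      also have "\<dots> = (\<Sum>i<2. ?T i)"
        using sum.nat_diff_reindex[of ?T 2] by (simp add: numeral_2_eq_2)
      finally show ?thesis using True od by (simp add: sg_def)
    qed
  qed
  also have "b = p div (2 * m)" "h = p div m mod 2" using p by (simp_all add: block_index_simps)
  moreover have "b' = q div (2 * m)" "h' = q div m mod 2" using q by (simp_all add: block_index_simps)
  ultimately show ?thesis by (simp only:)
qed

section \<open>Composite connecting maps as conjugated diagonal kernels\<close>

lemma sum_Times: "(\<Sum>x\<in>A \<times> B. G x) = (\<Sum>a\<in>A. \<Sum>b\<in>B. G (a, b))"
  by (simp add: sum.cartesian_product)

definition entries :: "circle_mat \<Rightarrow> real \<Rightarrow> nat \<Rightarrow> nat \<Rightarrow> complex" where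
  "entries f y a b = per f y $$ (a, b)"

lemma entries_periodic: "entries f (y + of_int z) = entries f y"
  by (simp add: entries_def fun_eq_iff)

lemma continuous_on_entries:
  assumes f: "f \<in> circle_algebra N" and "a < N" "b < N"
  shows "continuous_on UNIV (\<lambda>y. entries f y a b)"
proof -
  have "continuous_on UNIV (per (\<lambda>t. f t $$ (a, b)))"
    using assms by (intro continuous_on_per) (auto simp: circle_algebra_def)
  then show ?thesis by (simp add: entries_def per_def)
qed

lemma entries_eq: "f \<in> circle_algebra N \<Longrightarrow> t \<in> {0..1} \<Longrightarrow> entries f t a b = f t $$ (a, b)"
  unfolding entries_def by (subst per_eq) (auto simp: circle_algebra_def)

text \<open>
  Over \<open>t\<close>, the index \<open>((w, j), a)\<close> stands for the coordinate \<open>a\<close> of the fibre at the point of the sheet \<open>w\<close> that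
  is called \<open>point k t (w, j)\<close> below; the points of a sheet form the fibre of a \<open>2\<^sup>k\<close>-fold covering.
\<close>

definition base_points :: "nat \<Rightarrow> (bool list \<times> nat) set" where
  "base_points k = words k \<times> {..<2 ^ k}"

definition indices :: "nat \<Rightarrow> nat \<Rightarrow> ((bool list \<times> nat) \<times> nat) set" where
  "indices n k = base_points k \<times> {..<4 ^ n}"

definition frame_column :: "(real \<Rightarrow> complex mat) \<Rightarrow> nat \<Rightarrow> real \<Rightarrow> nat \<Rightarrow> (bool list \<times> nat) \<times> nat \<Rightarrow> complex" where
  "frame_column c n t p x = frame c n (fst (fst x)) (t + real (snd (fst x))) p (snd x)"

definition rotate_base :: "nat \<Rightarrow> bool list \<times> nat \<Rightarrow> bool list \<times> nat" where
  "rotate_base k b = (fst b, (snd b + 1) mod 2 ^ k)"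

definition rotate_index :: "nat \<Rightarrow> (bool list \<times> nat) \<times> nat \<Rightarrow> (bool list \<times> nat) \<times> nat" where
  "rotate_index k x = (rotate_base k (fst x), snd x)"

lemma finite_base_points [simp]: "finite (base_points k)"
  by (simp add: base_points_def)

lemma finite_indices [simp]: "finite (indices n k)"
  by (simp add: indices_def)

lemma bij_betw_rotate_index: "bij_betw (rotate_index k) (indices n k) (indices n k)"
proof (rule bij_betw_byWitness[where f' = "\<lambda>x. ((fst (fst x), (snd (fst x) + (2 ^ k - 1)) mod 2 ^ k), snd x)"])
  have a: "((j + 1) mod 2 ^ k + (2 ^ k - 1)) mod 2 ^ k = j" if "j < 2 ^ k" for j :: nat
  proof -
    have "((j + 1) mod 2 ^ k + (2 ^ k - 1)) mod 2 ^ k = (j + 1 + (2 ^ k - 1)) mod 2 ^ k" by (rule mod_add_left_eq)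
    also have "j + 1 + (2 ^ k - 1) = j + 2 ^ k" by simp
    finally show ?thesis using that by simp
  qed
  have b: "((j + (2 ^ k - 1)) mod 2 ^ k + 1) mod 2 ^ k = j" if "j < 2 ^ k" for j :: nat
  proof -
    have "((j + (2 ^ k - 1)) mod 2 ^ k + 1) mod 2 ^ k = (j + (2 ^ k - 1) + 1) mod 2 ^ k" by (rule mod_add_left_eq)
    also have "j + (2 ^ k - 1) + 1 = j + 2 ^ k" by simp
    finally show ?thesis using that by simp
  qed
  show "\<forall>x\<in>indices n k. ((fst (fst (rotate_index k x)), (snd (fst (rotate_index k x)) + (2 ^ k - 1)) mod 2 ^ k), snd (rotate_index k x)) = x"
    using a by (auto simp: rotate_index_def rotate_base_def indices_def base_points_def)
  show "\<forall>x\<in>indices n k. rotate_index k ((fst (fst x), (snd (fst x) + (2 ^ k - 1)) mod 2 ^ k), snd x) = x"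
    using b by (auto simp: rotate_index_def rotate_base_def indices_def base_points_def)
qed (auto simp: rotate_index_def rotate_base_def indices_def base_points_def)

lemma sum_indices: "(\<Sum>x\<in>indices n k. G x) = (\<Sum>w\<in>words k. \<Sum>j<2 ^ k. \<Sum>a<4 ^ n. G ((w, j), a))"
  by (simp add: indices_def base_points_def sum_Times)

definition point :: "nat \<Rightarrow> real \<Rightarrow> bool list \<times> nat \<Rightarrow> real" where
  "point k t b = word_sign (fst b) * (t + real (snd b)) / 2 ^ k"

definition diagonal_kernel :: "nat \<Rightarrow> circle_mat \<Rightarrow> real \<Rightarrow> (bool list \<times> nat) \<times> nat \<Rightarrow> (bool list \<times> nat) \<times> nat \<Rightarrow> complex" where
  "diagonal_kernel k f t = (\<lambda>(b, i) (b', i'). if b = b' then entries f (point k t b) i i' else 0)"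

context
  fixes c :: "real \<Rightarrow> complex mat" and n :: nat
  assumes c: "swap_path c" and n: "n \<ge> 1"
begin

lemma continuous_on_frame_sum:
  assumes F: "\<And>a b. a < 4 ^ n \<Longrightarrow> b < 4 ^ n \<Longrightarrow> continuous_on UNIV (\<lambda>y. F y a b)"
  shows "continuous_on UNIV (\<lambda>y. frame_sum c n k F y p q)"
proof -
  have fr: "continuous_on UNIV (\<lambda>y. frame c n w (y + real j) p a)" for w j p a
    by (rule continuous_on_compose2[OF continuous_on_frame[OF c n]]) (auto intro!: continuous_intros)
  have Fc: "continuous_on UNIV (\<lambda>y. F (word_sign w * (y + real j) / 2 ^ k) a b)"
    if "a < 4 ^ n" "b < 4 ^ n" for w j a b
    by (rule continuous_on_compose2[OF F[OF that]]) (auto intro!: continuous_intros)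
  show ?thesis
    unfolding frame_sum_def
    by (intro continuous_on_sum continuous_on_mult continuous_on_cnj fr Fc) auto
qed

lemma frame_sum_in_circle_algebra:
  assumes F: "\<And>y z. F (y + of_int z) = F y"
    and cont: "\<And>a b. a < 4 ^ n \<Longrightarrow> b < 4 ^ n \<Longrightarrow> continuous_on UNIV (\<lambda>y. F y a b)"
    and ext: "g \<in> {0..1} \<rightarrow>\<^sub>E carrier_mat (4 ^ (n + k)) (4 ^ (n + k))"
    and eq: "\<And>t p q. t \<in> {0..1} \<Longrightarrow> p < 4 ^ (n + k) \<Longrightarrow> q < 4 ^ (n + k) \<Longrightarrow> g t $$ (p, q) = frame_sum c n k F t p q"
  shows "g \<in> circle_algebra (4 ^ (n + k))"
proof -
  have car: "g t \<in> carrier_mat (4 ^ (n + k)) (4 ^ (n + k))" if "t \<in> {0..1}" for t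
    using ext that by (rule PiE_mem)
  have "g 0 = g 1"
  proof (rule eq_matI)
    show "dim_row (g 0) = dim_row (g 1)" "dim_col (g 0) = dim_col (g 1)"
      using car[of 0] car[of 1] by auto
    fix p q assume "p < dim_row (g 1)" "q < dim_col (g 1)"
    then have "p < 4 ^ (n + k)" "q < 4 ^ (n + k)" using car[of 1] by auto
    then show "g 0 $$ (p, q) = g 1 $$ (p, q)"
      using eq[of 0 p q] eq[of 1 p q] frame_sum_periodic[OF c n, of F k 0 1, OF F] by simp
  qed
  moreover have "continuous_on {0..1} (\<lambda>t. g t $$ (p, q))" if "p < 4 ^ (n + k)" "q < 4 ^ (n + k)" for p q
  proof -
    have "continuous_on {0..1} (\<lambda>y. frame_sum c n k F y p q)"
      using continuous_on_frame_sum[OF cont] by (rule continuous_on_subset) auto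
    then show ?thesis by (rule iffD2[OF continuous_on_cong[OF refl eq], rotated 3]) (use that in auto)
  qed
  ultimately show ?thesis using ext by (simp add: circle_algebra_def)
qed

text \<open>Membership and the formula are proved together: the entry formula for the next map
  presupposes a function on the circle, and the equal end values of that function come from the
  periodicity of the frame sum.\<close>

lemma connecting_frame_sum:
  assumes f: "f \<in> stage_algebra n"
  shows "connecting (psi c) n k f \<in> stage_algebra (n + k) \<and>
    (\<forall>y. \<forall>p<4 ^ (n + k). \<forall>q<4 ^ (n + k).
      entries (connecting (psi c) n k f) y p q = frame_sum c n k (entries f) y p q)"
proof (induction k)
  case 0
  have "frame_sum c n 0 (entries f) y p q = entries f y p q" if "p < 4 ^ n" "q < 4 ^ n" for y p q
  proof -
    have "frame_sum c n 0 (entries f) y p q =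
        (\<Sum>a<4 ^ n. \<Sum>b<4 ^ n. (if p = a then 1 else 0) * entries f y a b * cnj (if q = b then 1 else 0))"
      by (simp add: frame_sum_def)
    also have "\<dots> = (\<Sum>a<4 ^ n. \<Sum>b<4 ^ n. if b = q then if a = p then entries f y p q else 0 else 0)"
      by (intro sum.cong refl) auto
    also have "\<dots> = entries f y p q" using that by simp
    finally show ?thesis .
  qed
  then show ?case using f by simp
next
  case (Suc k)
  define g where "g = connecting (psi c) n k f"
  define N where "N = n + k"
  define m where "m = (4 ^ N div 2 :: nat)"
  have N: "N \<ge> 1" using n by (simp add: N_def)
  have g: "g \<in> circle_algebra (4 ^ N)"
    and ge: "\<And>y p q. p < 4 ^ N \<Longrightarrow> q < 4 ^ N \<Longrightarrow> entries g y p q = frame_sum c n k (entries f) y p q"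
    using Suc by (auto simp: g_def N_def)
  have m2: "2 * m = 4 ^ N" using N by (simp add: m_def four_power_half del: mult_2)
  have m8: "4 ^ Suc N = 8 * m" using m2 by simp
  have psi: "connecting (psi c) n (Suc k) f = psi c N g" by (simp add: g_def N_def)
  have eq: "psi c N g t $$ (p, q) = frame_sum c n (Suc k) (entries f) t p q"
    if t: "t \<in> {0..1}" and pq: "p < 4 ^ Suc N" "q < 4 ^ Suc N" for t p q
  proof -
    have lt: "p < 8 * m" "q < 8 * m" using pq m8 by simp_all
    have "per g x $$ (source m p, source m q) = frame_sum c n k (entries f) x (source m p) (source m q)" for x
      using ge[of "source m p" "source m q" x] source_less[OF lt(1)] source_less[OF lt(2)]
      by (simp add: m2 entries_def)
    then show ?thesis
      unfolding frame_sum_Suc[OF c n, of "entries f", OF entries_periodic] N_def[symmetric] m_def[symmetric]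
      using psi_index[OF c N g t, of p q] lt by (simp only: m_def[symmetric])
  qed
  have ext: "psi c N g \<in> {0..1} \<rightarrow>\<^sub>E carrier_mat (4 ^ (n + Suc k)) (4 ^ (n + Suc k))"
  proof (rule PiE_I)
    show "psi c N g t \<in> carrier_mat (4 ^ (n + Suc k)) (4 ^ (n + Suc k))" if "t \<in> {0..1}" for t
      using psi_carrier[OF N that, of c g] by (simp add: N_def)
  qed (auto simp: psi_def)
  have mem: "psi c N g \<in> circle_algebra (4 ^ (n + Suc k))"
    by (rule frame_sum_in_circle_algebra[of "entries f", OF entries_periodic continuous_on_entries[OF f] ext eq])
      (simp_all add: N_def)
  moreover have "entries (psi c N g) y p q = frame_sum c n (Suc k) (entries f) y p q"
    if "p < 4 ^ (n + Suc k)" "q < 4 ^ (n + Suc k)" for y p q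
  proof -
    have "entries (psi c N g) y p q = psi c N g (frac y) $$ (p, q)" by (simp add: entries_def per_def)
    also have "\<dots> = frame_sum c n (Suc k) (entries f) (frac y) p q"
      using that by (intro eq) (simp_all add: N_def frac_lt_1 less_imp_le)
    also have "\<dots> = frame_sum c n (Suc k) (entries f) y p q"
      using frame_sum_periodic[OF c n, of "entries f" "Suc k" "frac y" "\<lfloor>y\<rfloor>", OF entries_periodic]
      by (simp add: frac_def)
    finally show ?thesis .
  qed
  ultimately show ?case unfolding psi by simp
qed

text \<open>The monodromy of the frame: a turn adds 1 to the parameter, and at the last point the
  period of the frame brings it back to index 0.\<close>

lemma frame_column_rotate:
  assumes "x \<in> indices n k" shows "frame_column c n 0 p (rotate_index k x) = frame_column c n 1 p x"
proof -
  obtain w j a where x: "x = ((w, j), a)" by (metis prod.exhaust)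
  have lt: "length w = k" "j < 2 ^ k" using assms by (auto simp: x indices_def base_points_def words_def)
  show ?thesis
  proof (cases "j + 1 = 2 ^ k")
    case True
    then have "1 + real j = 0 + 2 ^ k" by (metis add.commute add_0 of_nat_1 of_nat_add of_nat_numeral of_nat_power)
    then show ?thesis
      using True frame_periodic_nat[OF lt(1), of c n 0] by (simp add: x frame_column_def rotate_index_def rotate_base_def)
  next
    case False
    then have "(j + 1) mod 2 ^ k = j + 1" using lt by simp
    then show ?thesis by (simp add: x frame_column_def rotate_index_def rotate_base_def add.commute)
  qed
qed

lemma frame_column_orthonormal:
  assumes "x \<in> indices n k" "y \<in> indices n k"
  shows "(\<Sum>p<4 ^ (n + k). cnj (frame_column c n t p x) * frame_column c n t p y) = (if x = y then 1 else 0)"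
proof -
  obtain w j a v i b where xy: "x = ((w, j), a)" "y = ((v, i), b)" by (metis prod.exhaust)
  have lt: "length w = k" "length v = length w" "j < 2 ^ k" "i < 2 ^ k" "a < 4 ^ n" "b < 4 ^ n"
    using assms by (auto simp: xy indices_def base_points_def words_def)
  have "t + real i = t + real j + of_int (int i - int j)" by simp
  then have "(\<Sum>p<4 ^ (n + k). cnj (frame_column c n t p x) * frame_column c n t p y) =
      (if w = v \<and> 2 ^ length w dvd (int i - int j) \<and> a = b then 1 else 0)"
    using frame_orthonormal[OF c n lt(2,5,6), of "t + real j" "int i - int j"] lt(1)
    by (simp add: frame_column_def xy)
  \<comment> \<open>Two indices in one fibre differ by less than the degree of the covering.\<close>
  also have "2 ^ length w dvd (int i - int j) \<longleftrightarrow> j = i"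
  proof
    assume "2 ^ length w dvd (int i - int j)"
    moreover have "\<bar>int i - int j\<bar> < 2 ^ k"
    proof -
      have "int i < 2 ^ k" "int j < 2 ^ k"
        using lt(3,4) by (metis of_nat_less_iff of_nat_numeral of_nat_power)+
      then show ?thesis by linarith
    qed
    ultimately show "j = i" using lt(1) dvd_imp_le_int[of "int i - int j" "2 ^ k"] by force
  qed simp
  finally show ?thesis by (simp add: xy conj_ac)
qed

lemma frame_column_complete:
  assumes "p < 4 ^ (n + k)" "q < 4 ^ (n + k)"
  shows "(\<Sum>x\<in>indices n k. frame_column c n t p x * cnj (frame_column c n t q x)) = (if p = q then 1 else 0)"
proof -
  have "(\<Sum>x\<in>indices n k. frame_column c n t p x * cnj (frame_column c n t q x)) =
      (\<Sum>w\<in>words k. \<Sum>j<2 ^ k. \<Sum>a<4 ^ n. frame c n w (t + real j) p a * cnj (frame c n w (t + real j) q a))"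
    by (simp add: sum_indices frame_column_def)
  also have "\<dots> = frame_sum c n k (\<lambda>_ a b. if a = b then 1 else 0) t p q"
    unfolding frame_sum_def
    by (intro sum.cong refl) (simp add: if_distrib[of "\<lambda>z. _ * z * _"] if_distrib[of "\<lambda>z. z * _"] cong: if_cong)
  finally show ?thesis using frame_complete[OF c n assms] by simp
qed

lemma frame_sum_conjugate_kernel:
  "frame_sum c n k (entries f) t p q = conjugate_kernel (indices n k) (frame_column c n t) (diagonal_kernel k f t) p q"
proof -
  have inner: "(\<Sum>y\<in>indices n k. frame_column c n t p ((w, j), a) * diagonal_kernel k f t ((w, j), a) y * cnj (frame_column c n t q y)) =
      (\<Sum>b<4 ^ n. frame c n w (t + real j) p a * entries f (word_sign w * (t + real j) / 2 ^ k) a b * cnj (frame c n w (t + real j) q b))"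
    if w: "w \<in> words k" "j < 2 ^ k" for w j a
  proof -
    have "(\<Sum>y\<in>indices n k. frame_column c n t p ((w, j), a) * diagonal_kernel k f t ((w, j), a) y * cnj (frame_column c n t q y)) =
        (\<Sum>d\<in>base_points k. \<Sum>b<4 ^ n. frame_column c n t p ((w, j), a) * diagonal_kernel k f t ((w, j), a) (d, b) * cnj (frame_column c n t q (d, b)))"
      by (simp add: indices_def sum_Times)
    also have "\<dots> = (\<Sum>d\<in>base_points k. if d = (w, j) then (\<Sum>b<4 ^ n. frame c n w (t + real j) p a *
        entries f (word_sign w * (t + real j) / 2 ^ k) a b * cnj (frame c n w (t + real j) q b)) else 0)"
      by (intro sum.cong refl) (auto simp: diagonal_kernel_def frame_column_def point_def)
    finally show ?thesis using w by (simp add: base_points_def)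
  qed
  show ?thesis
    unfolding conjugate_kernel_def frame_sum_def
      sum_indices[where G = "\<lambda>x. \<Sum>y\<in>indices n k. frame_column c n t p x * diagonal_kernel k f t x y * cnj (frame_column c n t q y)"]
    by (intro sum.cong refl) (simp add: inner)
qed

text \<open>At each parameter the composite is unitarily equivalent to a block diagonal matrix whose
  blocks are values of \<open>f\<close>. This is what bounds the norm in the limit by the norm in a
  stage.\<close>

lemma circle_norm_connecting_le:
  assumes f: "f \<in> stage_algebra n"
  shows "circle_norm (connecting (psi c) n k f) \<le> circle_norm f"
proof (rule circle_norm_le)
  have mem: "connecting (psi c) n k f \<in> stage_algebra (n + k)" using connecting_frame_sum[OF f] by blast
  fix t :: real assume t: "t \<in> {0..1}"
  show "connecting (psi c) n k f t \<in> carrier_mat (4 ^ (n + k)) (4 ^ (n + k))"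
    by (rule circle_algebra_carrier[OF mem t])
  have "kbound {..<4 ^ n} (entries f y) (circle_norm f)" for y
    using kbound_circle_norm[OF f, of "frac y"]
    by (simp add: entries_def[abs_def] per_def frac_lt_1 less_imp_le)
  moreover have "circle_norm f \<ge> 0" using kbound_circle_norm[OF f t] kbound_nonneg by blast
  ultimately have "kbound (indices n k) (diagonal_kernel k f t) (circle_norm f)"
    unfolding indices_def diagonal_kernel_def by (intro kbound_block_diagonal) simp_all
  then have "kbound {..<4 ^ (n + k)} (conjugate_kernel (indices n k) (frame_column c n t) (diagonal_kernel k f t)) (circle_norm f)"
    by (intro kbound_conjugate_kernel) (simp_all add: frame_column_orthonormal frame_column_complete)
  moreover have "conjugate_kernel (indices n k) (frame_column c n t) (diagonal_kernel k f t) i j = connecting (psi c) n k f t $$ (i, j)"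
    if "i < 4 ^ (n + k)" "j < 4 ^ (n + k)" for i j
    using that connecting_frame_sum[OF f, of k] entries_eq[OF mem t, of i j]
    by (simp add: frame_sum_conjugate_kernel[symmetric])
  ultimately show "kbound {..<4 ^ (n + k)} (\<lambda>i j. connecting (psi c) n k f t $$ (i, j)) (circle_norm f)"
    by (subst (asm) kbound_cong) auto
qed

end

section \<open>Kernels as elements of the stages\<close>

definition half_sign :: "nat \<Rightarrow> nat \<Rightarrow> complex" where
  "half_sign N p = (if p < 4 ^ N div 2 then 1 else - 1)"

text \<open>The \<phi>-minus blocks receive the two halves of the previous stage in exchanged order,
  so the grading there is minus the previous one; each such letter in the word contributes one
  sign.\<close>

lemma frame_sign:
  assumes n: "n \<ge> 1"
  shows "p < 4 ^ (n + length w) \<Longrightarrow>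
    half_sign (n + length w) p * frame c n w y p a = complex_of_real (word_sign w) * half_sign n a * frame c n w y p a"
proof (induction w arbitrary: p y)
  case (Cons \<sigma> w)
  define m where "m = (4 ^ (n + length w) div 2 :: nat)"
  have m2: "2 * m = 4 ^ (n + length w)" using n by (simp add: m_def four_power_half del: mult_2)
  have lt: "p < 8 * m" using Cons.prems m2 by simp
  obtain b h r where p: "b < 4" "h < 2" "r < m" "p = (b * 2 + h) * m + r"
    using row_decomposition[OF lt] by metis
  have b: "p div (2 * m) = b" using p by (simp add: block_index_simps)
  define B where "B = (if even b then b div 2 else (3 - b) div 2)"
  have src: "source m p = B * m + r" using p by (simp add: source_def block_index_simps B_def Let_def)
  have m4: "4 ^ (n + length (\<sigma> # w)) div 2 = 4 * m" using m2 by simp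
  \<comment> \<open>The four block rows have size \<open>2 * m\<close>, so the upper half consists
    of the rows with \<open>b < 2\<close>.\<close>
  have half: "p < 4 * m \<longleftrightarrow> b < 2"
  proof
    assume lt4: "p < 4 * m"
    have "b * (2 * m) \<le> p" using p(4) by (simp add: algebra_simps)
    then have "b * (2 * m) < 2 * (2 * m)" using lt4 by linarith
    then show "b < 2" by simp
  next
    assume "b < 2"
    then have "(b * 2 + h + 1) * m \<le> 4 * m" using p(2) by (intro mult_right_mono) auto
    then show "p < 4 * m" using p(3,4) by (simp add: algebra_simps)
  qed
  have "source m p < m \<longleftrightarrow> B = 0" using p(3) by (cases B) (auto simp: src)
  also have "B = 0 \<longleftrightarrow> (if even b then b < 2 else \<not> b < 2)"
    using p(1) by (auto simp: B_def)
  finally have sg: "half_sign (n + length (\<sigma> # w)) p = (if even b then 1 else - 1) * half_sign (n + length w) (source m p)"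
    using half unfolding half_sign_def m4 m_def[symmetric] by (simp del: power_Suc)
  have IH: "half_sign (n + length w) (source m p) * frame c n w (sg \<sigma> * y / 2) (source m p) a =
      complex_of_real (word_sign w) * half_sign n a * frame c n w (sg \<sigma> * y / 2) (source m p) a"
    using Cons.IH source_less[OF lt] m2 by metis
  show ?case
  proof (cases "even b = \<sigma>")
    case True
    then have s: "(if even b then 1 else - 1 :: complex) = complex_of_real (sg \<sigma>)" by (auto simp: sg_def)
    have fr: "frame c n (\<sigma> # w) y p a = column_path c (p div m mod 2) (sg \<sigma> * y) * frame c n w (sg \<sigma> * y / 2) (source m p) a"
      using True by (simp add: frame.simps(2) m_def[symmetric] Let_def b)
    have "half_sign (n + length (\<sigma> # w)) p * frame c n (\<sigma> # w) y p a =
        complex_of_real (sg \<sigma>) * column_path c (p div m mod 2) (sg \<sigma> * y) *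
        (half_sign (n + length w) (source m p) * frame c n w (sg \<sigma> * y / 2) (source m p) a)"
      by (simp only: sg s fr mult_ac)
    also have "\<dots> = complex_of_real (sg \<sigma>) * column_path c (p div m mod 2) (sg \<sigma> * y) *
        (complex_of_real (word_sign w) * half_sign n a * frame c n w (sg \<sigma> * y / 2) (source m p) a)"
      by (simp only: IH)
    finally show ?thesis by (simp only: fr word_sign_simps of_real_mult mult_ac)
  next
    case False
    then show ?thesis by (simp add: frame.simps(2) m_def[symmetric] Let_def b)
  qed
qed (auto simp: half_sign_def)

lemma sign_unitary_index:
  assumes "N \<ge> 1" "p < 4 ^ N" "q < 4 ^ N"
  shows "sign_unitary N $$ (p, q) = (if p = q then half_sign N p else 0)"
proof -
  define m where "m = (4 ^ N div 2 :: nat)"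
  have "4 ^ N = m + m" using four_power_half[OF assms(1)] by (simp add: m_def)
  then have "p < m + m" "q < m + m" using assms by simp_all
  then show ?thesis by (auto simp: sign_unitary_def Let_def half_sign_def m_def[symmetric])
qed

lemma sign_unitary_dim [simp]:
  assumes "N \<ge> 1"
  shows "dim_row (sign_unitary N) = 4 ^ N" "dim_col (sign_unitary N) = 4 ^ N"
proof -
  have "4 ^ N div 2 + 4 ^ N div 2 = (4 ^ N :: nat)" using four_power_half[OF assms] by linarith
  then show "dim_row (sign_unitary N) = 4 ^ N" "dim_col (sign_unitary N) = 4 ^ N"
    by (simp_all add: sign_unitary_def Let_def)
qed

lemma conjugate_sign_unitary_index:
  assumes N: "N \<ge> 1" and M: "M \<in> carrier_mat (4 ^ N) (4 ^ N)" and pq: "p < 4 ^ N" "q < 4 ^ N"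
  shows "(sign_unitary N * M * mat_adjoint (sign_unitary N)) $$ (p, q) = half_sign N p * half_sign N q * M $$ (p, q)"
proof -
  have d: "dim_row M = 4 ^ N" "dim_col M = 4 ^ N" using M by auto
  have SM: "(sign_unitary N * M) $$ (p, r) = half_sign N p * M $$ (p, r)" if "r < 4 ^ N" for r
  proof -
    have "(sign_unitary N * M) $$ (p, r) = (\<Sum>i<4 ^ N. sign_unitary N $$ (p, i) * M $$ (i, r))"
      using N d pq that by (simp add: scalar_prod_def atLeast0LessThan)
    also have "\<dots> = (\<Sum>i<4 ^ N. if i = p then half_sign N p * M $$ (p, r) else 0)"
      by (intro sum.cong refl) (use N pq in \<open>auto simp: sign_unitary_index\<close>)
    finally show ?thesis using pq by simp
  qed
  have "(sign_unitary N * M * mat_adjoint (sign_unitary N)) $$ (p, q) =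
      (\<Sum>i<4 ^ N. (sign_unitary N * M) $$ (p, i) * mat_adjoint (sign_unitary N) $$ (i, q))"
    using N d pq by (subst index_mult_mat) (simp_all add: scalar_prod_def atLeast0LessThan)
  also have "\<dots> = (\<Sum>i<4 ^ N. if i = q then half_sign N p * half_sign N q * M $$ (p, q) else 0)"
    by (intro sum.cong refl) (use N pq in \<open>auto simp: SM mat_adjoint_index sign_unitary_index half_sign_def\<close>)
  finally show ?thesis using pq by simp
qed

lemma alpha_in_circle_algebra:
  assumes N: "N \<ge> 1" and f: "f \<in> circle_algebra (4 ^ N)"
  shows "alpha N f \<in> circle_algebra (4 ^ N)"
proof -
  have "continuous_on {0..1} (\<lambda>t. alpha N f t $$ (p, q))" if "p < 4 ^ N" "q < 4 ^ N" for p q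
  proof -
    have "continuous_on {0..1} (\<lambda>t. half_sign N p * half_sign N q * f t $$ (p, q))"
      using f that by (intro continuous_intros) (auto simp: circle_algebra_def)
    then show ?thesis
      by (rule iffD2[OF continuous_on_cong[OF refl], rotated])
        (simp add: alpha_def conjugate_sign_unitary_index[OF N circle_algebra_carrier[OF f]] that)
  qed
  moreover have "alpha N f t \<in> carrier_mat (4 ^ N) (4 ^ N)" if "t \<in> {0..1}" for t
    using that N by (auto simp: alpha_def intro!: carrier_matI)
  ultimately show ?thesis using f by (auto simp: circle_algebra_def alpha_def)
qed

lemma alpha_index:
  assumes "N \<ge> 1" "f \<in> circle_algebra (4 ^ N)" "t \<in> {0..1}" "p < 4 ^ N" "q < 4 ^ N"
  shows "alpha N f t $$ (p, q) = half_sign N p * half_sign N q * f t $$ (p, q)"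
  using assms conjugate_sign_unitary_index[OF assms(1) circle_algebra_carrier[OF assms(2,3)]]
  by (simp add: alpha_def)

section \<open>Closed kernels and the algebra operations\<close>

type_synonym kernel = "real \<Rightarrow> (bool list \<times> nat) \<times> nat \<Rightarrow> (bool list \<times> nat) \<times> nat \<Rightarrow> complex"

definition stage_element :: "(real \<Rightarrow> complex mat) \<Rightarrow> nat \<Rightarrow> nat \<Rightarrow> kernel \<Rightarrow> circle_mat" where
  "stage_element c n k \<kappa> = (\<lambda>t\<in>{0..1}. mat (4 ^ (n + k)) (4 ^ (n + k))
     (\<lambda>(p, q). conjugate_kernel (indices n k) (frame_column c n t) (\<kappa> t) p q))"

text \<open>
  Following the base points around the circle permutes them by \<^const>\<open>rotate_base\<close>; a kernel that is
  compatible with this permutation describes a function on the circle.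
\<close>

definition closed_kernel :: "nat \<Rightarrow> nat \<Rightarrow> kernel \<Rightarrow> bool" where
  "closed_kernel n k \<kappa> \<longleftrightarrow> (\<forall>x\<in>indices n k. \<forall>y\<in>indices n k. continuous_on {0..1} (\<lambda>t. \<kappa> t x y) \<and>
     \<kappa> 1 x y = \<kappa> 0 (rotate_index k x) (rotate_index k y))"

lemma rotate_index_in: "x \<in> indices n k \<Longrightarrow> rotate_index k x \<in> indices n k"
  by (auto simp: rotate_index_def rotate_base_def indices_def base_points_def)

lemma closed_kernel_kmul:
  assumes c: "swap_path c" and n: "n \<ge> 1" and "closed_kernel n k \<kappa>" "closed_kernel n k \<mu>"
  shows "closed_kernel n k (\<lambda>t. kmul (indices n k) (\<kappa> t) (\<mu> t))"
  unfolding closed_kernel_def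
proof (intro ballI conjI)
  fix x z assume xz: "x \<in> indices n k" "z \<in> indices n k"
  show "continuous_on {0..1} (\<lambda>t. kmul (indices n k) (\<kappa> t) (\<mu> t) x z)"
    unfolding kmul_def using assms xz by (intro continuous_intros) (auto simp: closed_kernel_def)
  have "kmul (indices n k) (\<kappa> 1) (\<mu> 1) x z =
      (\<Sum>y\<in>indices n k. \<kappa> 0 (rotate_index k x) (rotate_index k y) * \<mu> 0 (rotate_index k y) (rotate_index k z))"
    unfolding kmul_def using assms xz by (intro sum.cong refl) (simp add: closed_kernel_def)
  also have "\<dots> = kmul (indices n k) (\<kappa> 0) (\<mu> 0) (rotate_index k x) (rotate_index k z)"
    unfolding kmul_def
    by (rule sum.reindex_bij_betw[OF bij_betw_rotate_index])
  finally show "kmul (indices n k) (\<kappa> 1) (\<mu> 1) x z =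
      kmul (indices n k) (\<kappa> 0) (\<mu> 0) (rotate_index k x) (rotate_index k z)" .
qed

lemma closed_kernel_add:
  "closed_kernel n k \<kappa> \<Longrightarrow> closed_kernel n k \<mu> \<Longrightarrow> closed_kernel n k (\<lambda>t x y. \<kappa> t x y + \<mu> t x y)"
  by (auto simp: closed_kernel_def intro!: continuous_on_add)

lemma closed_kernel_scale: "closed_kernel n k \<kappa> \<Longrightarrow> closed_kernel n k (\<lambda>t x y. a * \<kappa> t x y)"
  by (auto simp: closed_kernel_def intro!: continuous_on_mult)

lemma closed_kernel_diff:
  "closed_kernel n k \<kappa> \<Longrightarrow> closed_kernel n k \<mu> \<Longrightarrow> closed_kernel n k (\<lambda>t x y. \<kappa> t x y - \<mu> t x y)"
  by (auto simp: closed_kernel_def intro!: continuous_on_diff)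

lemma closed_kernel_star: "closed_kernel n k \<kappa> \<Longrightarrow> closed_kernel n k (\<lambda>t x y. cnj (\<kappa> t y x))"
  by (auto simp: closed_kernel_def intro!: continuous_on_cnj)

lemma closed_kernel_one:
  assumes "swap_path c" "n \<ge> 1"
  shows "closed_kernel n k (\<lambda>t x y. if x = y then 1 else 0)"
  using bij_betw_rotate_index[of k n] by (auto simp: closed_kernel_def bij_betw_def inj_on_eq_iff)

lemma stage_element_carrier [simp]:
  "t \<in> {0..1} \<Longrightarrow> stage_element c n k \<kappa> t \<in> carrier_mat (4 ^ (n + k)) (4 ^ (n + k))"
  by (simp add: stage_element_def)

lemma stage_element_dim [simp]:
  "0 \<le> t \<Longrightarrow> t \<le> 1 \<Longrightarrow> dim_row (stage_element c n k \<kappa> t) = 4 ^ (n + k)"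
  "0 \<le> t \<Longrightarrow> t \<le> 1 \<Longrightarrow> dim_col (stage_element c n k \<kappa> t) = 4 ^ (n + k)"
  by (simp_all add: stage_element_def)

lemma stage_element_index:
  "t \<in> {0..1} \<Longrightarrow> p < 4 ^ (n + k) \<Longrightarrow> q < 4 ^ (n + k) \<Longrightarrow>
    stage_element c n k \<kappa> t $$ (p, q) = conjugate_kernel (indices n k) (frame_column c n t) (\<kappa> t) p q"
  by (simp add: stage_element_def)

lemma circle_mat_eqI:
  assumes "\<And>t. t \<notin> {0..1} \<Longrightarrow> f t = g t"
    and "\<And>t. t \<in> {0..1} \<Longrightarrow> f t \<in> carrier_mat D D" "\<And>t. t \<in> {0..1} \<Longrightarrow> g t \<in> carrier_mat D D"
    and "\<And>t p q. t \<in> {0..1} \<Longrightarrow> p < D \<Longrightarrow> q < D \<Longrightarrow> f t $$ (p, q) = g t $$ (p, q)"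
  shows "f = (g :: circle_mat)"
proof
  fix t
  show "f t = g t"
  proof (cases "t \<in> {0..1}")
    case True
    show ?thesis using assms(2,3)[OF True] by (intro eq_matI) (auto simp: assms(4)[OF True])
  qed (rule assms(1))
qed

lemma stage_element_cong:
  assumes "\<And>t x y. t \<in> {0..1} \<Longrightarrow> x \<in> indices n k \<Longrightarrow> y \<in> indices n k \<Longrightarrow> \<kappa> t x y = \<mu> t x y"
  shows "stage_element c n k \<kappa> = stage_element c n k \<mu>"
proof (rule circle_mat_eqI[where D = "4 ^ (n + k)"])
  fix t p q assume "t \<in> {0..1::real}" "p < (4::nat) ^ (n + k)" "q < (4::nat) ^ (n + k)"
  then show "stage_element c n k \<kappa> t $$ (p, q) = stage_element c n k \<mu> t $$ (p, q)"
    by (simp only: stage_element_index conjugate_kernel_def) (intro sum.cong refl, simp add: assms)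
qed (auto simp: stage_element_def)

lemma stage_element_add:
  "circle_add (stage_element c n k \<kappa>) (stage_element c n k \<mu>) = stage_element c n k (\<lambda>t x y. \<kappa> t x y + \<mu> t x y)"
proof (rule circle_mat_eqI[where D = "4 ^ (n + k)"])
  fix t p q assume "t \<in> {0..1::real}" "p < (4::nat) ^ (n + k)" "q < (4::nat) ^ (n + k)"
  then show "circle_add (stage_element c n k \<kappa>) (stage_element c n k \<mu>) t $$ (p, q) =
      stage_element c n k (\<lambda>t x y. \<kappa> t x y + \<mu> t x y) t $$ (p, q)"
    by (simp add: circle_add_def stage_element_index conjugate_kernel_def algebra_simps sum.distrib)
qed (auto simp: circle_add_def stage_element_def)

lemma stage_element_scale:
  "circle_scale a (stage_element c n k \<kappa>) = stage_element c n k (\<lambda>t x y. a * \<kappa> t x y)"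
proof (rule circle_mat_eqI[where D = "4 ^ (n + k)"])
  fix t p q assume "t \<in> {0..1::real}" "p < (4::nat) ^ (n + k)" "q < (4::nat) ^ (n + k)"
  then show "circle_scale a (stage_element c n k \<kappa>) t $$ (p, q) = stage_element c n k (\<lambda>t x y. a * \<kappa> t x y) t $$ (p, q)"
    by (simp add: circle_scale_def stage_element_index conjugate_kernel_def sum_distrib_left mult_ac)
qed (auto simp: circle_scale_def stage_element_def)

lemma stage_element_star:
  "circle_star (stage_element c n k \<kappa>) = stage_element c n k (\<lambda>t x y. cnj (\<kappa> t y x))"
proof (rule circle_mat_eqI[where D = "4 ^ (n + k)"])
  fix t p q assume "t \<in> {0..1::real}" "p < (4::nat) ^ (n + k)" "q < (4::nat) ^ (n + k)"
  then have "circle_star (stage_element c n k \<kappa>) t $$ (p, q) =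
      (\<Sum>x\<in>indices n k. \<Sum>y\<in>indices n k. frame_column c n t p y * cnj (\<kappa> t x y) * cnj (frame_column c n t q x))"
    by (simp add: circle_star_def mat_adjoint_index stage_element_index conjugate_kernel_def cnj_sum mult_ac)
  also have "\<dots> = (\<Sum>y\<in>indices n k. \<Sum>x\<in>indices n k. frame_column c n t p y * cnj (\<kappa> t x y) * cnj (frame_column c n t q x))"
    by (rule sum.swap)
  finally show "circle_star (stage_element c n k \<kappa>) t $$ (p, q) = stage_element c n k (\<lambda>t x y. cnj (\<kappa> t y x)) t $$ (p, q)"
    using \<open>t \<in> _\<close> \<open>p < _\<close> \<open>q < _\<close> by (simp add: stage_element_index conjugate_kernel_def)
qed (auto simp: circle_star_def stage_element_def intro!: carrier_matI)

lemma stage_element_mult: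
  assumes c: "swap_path c" and n: "n \<ge> 1"
  shows "circle_mult (stage_element c n k \<kappa>) (stage_element c n k \<mu>) =
    stage_element c n k (\<lambda>t. kmul (indices n k) (\<kappa> t) (\<mu> t))"
proof (rule circle_mat_eqI[where D = "4 ^ (n + k)"])
  fix t p q assume t: "t \<in> {0..1::real}" and pq: "p < (4::nat) ^ (n + k)" "q < (4::nat) ^ (n + k)"
  have "circle_mult (stage_element c n k \<kappa>) (stage_element c n k \<mu>) t $$ (p, q) =
      (\<Sum>r<4 ^ (n + k). stage_element c n k \<kappa> t $$ (p, r) * stage_element c n k \<mu> t $$ (r, q))"
    using t pq by (simp add: circle_mult_def scalar_prod_def atLeast0LessThan)
  also have "\<dots> = (\<Sum>r<4 ^ (n + k). conjugate_kernel (indices n k) (frame_column c n t) (\<kappa> t) p r *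
      conjugate_kernel (indices n k) (frame_column c n t) (\<mu> t) r q)"
    by (intro sum.cong refl) (simp add: stage_element_index[OF t] pq)
  also have "\<dots> = conjugate_kernel (indices n k) (frame_column c n t) (kmul (indices n k) (\<kappa> t) (\<mu> t)) p q"
    by (rule conjugate_kernel_kmul) (simp_all add: frame_column_orthonormal[OF c n] finite_indices)
  finally show "circle_mult (stage_element c n k \<kappa>) (stage_element c n k \<mu>) t $$ (p, q) =
      stage_element c n k (\<lambda>t. kmul (indices n k) (\<kappa> t) (\<mu> t)) t $$ (p, q)"
    by (simp add: stage_element_index[OF t pq])
qed (auto simp: circle_mult_def stage_element_def)

lemma stage_element_one:
  assumes c: "swap_path c" and n: "n \<ge> 1"
  shows "stage_element c n k (\<lambda>t x y. if x = y then 1 else 0) = circle_one (4 ^ (n + k))"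
proof (rule circle_mat_eqI[where D = "4 ^ (n + k)"])
  fix t p q assume t: "t \<in> {0..1::real}" and pq: "p < (4::nat) ^ (n + k)" "q < (4::nat) ^ (n + k)"
  have "conjugate_kernel (indices n k) (frame_column c n t) (\<lambda>x y. if x = y then 1 else 0) p q =
      (\<Sum>x\<in>indices n k. frame_column c n t p x * cnj (frame_column c n t q x))"
    unfolding conjugate_kernel_def
    by (intro sum.cong refl)
      (simp add: finite_indices if_distrib[of "\<lambda>z. _ * z * _"] if_distrib[of "\<lambda>z. z * _"] cong: if_cong)
  then show "stage_element c n k (\<lambda>t x y. if x = y then 1 else 0) t $$ (p, q) = circle_one (4 ^ (n + k)) t $$ (p, q)"
    using t pq by (simp add: stage_element_index frame_column_complete[OF c n] circle_one_def)
qed (auto simp: circle_one_def stage_element_def)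

lemma stage_element_diagonal:
  assumes c: "swap_path c" and n: "n \<ge> 1" and f: "f \<in> stage_algebra n"
  shows "stage_element c n k (diagonal_kernel k f) = connecting (psi c) n k f"
proof (rule circle_mat_eqI[where D = "4 ^ (n + k)"])
  have mem: "connecting (psi c) n k f \<in> stage_algebra (n + k)"
    using connecting_frame_sum[OF c n f] by blast
  fix t :: real
  show "connecting (psi c) n k f t \<in> carrier_mat (4 ^ (n + k)) (4 ^ (n + k))" if "t \<in> {0..1}"
    by (rule circle_algebra_carrier[OF mem that])
  show "stage_element c n k (diagonal_kernel k f) t = connecting (psi c) n k f t" if "t \<notin> {0..1}"
    using mem that by (auto simp: stage_element_def circle_algebra_def)
  fix p q assume t: "t \<in> {0..1}" and pq: "p < (4::nat) ^ (n + k)" "q < (4::nat) ^ (n + k)"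
  then show "stage_element c n k (diagonal_kernel k f) t $$ (p, q) = connecting (psi c) n k f t $$ (p, q)"
    using connecting_frame_sum[OF c n f, of k] entries_eq[OF mem t, of p q]
    by (simp add: stage_element_index frame_sum_conjugate_kernel[OF c n])
qed simp

text \<open>At \<open>t = 1\<close> both the frame and the kernel are those at \<open>t = 0\<close>
  after rotating the indices; a change of the summation variables identifies the two end
  values.\<close>

lemma stage_element_in_stage_algebra:
  assumes c: "swap_path c" and n: "n \<ge> 1" and \<kappa>: "closed_kernel n k \<kappa>"
  shows "stage_element c n k \<kappa> \<in> stage_algebra (n + k)"
proof -
  have fin: "finite (indices n k)" by (rule finite_indices)
  have col: "continuous_on {0..1} (\<lambda>t. frame_column c n t p x)" for p x
    unfolding frame_column_def
    by (rule continuous_on_compose2[OF continuous_on_frame[OF c n]]) (auto intro!: continuous_intros)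
  have "continuous_on {0..1} (\<lambda>t. stage_element c n k \<kappa> t $$ (p, q))"
    if "p < 4 ^ (n + k)" "q < 4 ^ (n + k)" for p q
  proof -
    have "continuous_on {0..1} (\<lambda>t. conjugate_kernel (indices n k) (frame_column c n t) (\<kappa> t) p q)"
      unfolding conjugate_kernel_def using \<kappa>
      by (intro continuous_on_sum continuous_on_mult continuous_on_cnj col) (auto simp: closed_kernel_def)
    then show ?thesis
      by (rule iffD2[OF continuous_on_cong[OF refl], rotated]) (simp add: stage_element_index that)
  qed
  moreover have PiE: "stage_element c n k \<kappa> \<in> {0..1} \<rightarrow>\<^sub>E carrier_mat (4 ^ (n + k)) (4 ^ (n + k))"
    by (auto simp: stage_element_def)
  moreover have "stage_element c n k \<kappa> 0 = stage_element c n k \<kappa> 1"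
  proof (rule eq_matI)
    fix p q assume "p < dim_row (stage_element c n k \<kappa> 1)" "q < dim_col (stage_element c n k \<kappa> 1)"
    then have pq: "p < 4 ^ (n + k)" "q < 4 ^ (n + k)" by simp_all
    let ?r = "rotate_index k" and ?V = "frame_column c n"
    have "conjugate_kernel (indices n k) (?V 1) (\<kappa> 1) p q =
        (\<Sum>x\<in>indices n k. \<Sum>y\<in>indices n k. ?V 0 p (?r x) * \<kappa> 0 (?r x) (?r y) * cnj (?V 0 q (?r y)))"
      unfolding conjugate_kernel_def using \<kappa>
      by (intro sum.cong refl) (simp add: closed_kernel_def frame_column_rotate[OF c n])
    also have "\<dots> = (\<Sum>x\<in>indices n k. \<Sum>y\<in>indices n k. ?V 0 p (?r x) * \<kappa> 0 (?r x) y * cnj (?V 0 q y))"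
      by (intro sum.cong refl sum.reindex_bij_betw[OF bij_betw_rotate_index])
    also have "\<dots> = (\<Sum>x\<in>indices n k. \<Sum>y\<in>indices n k. ?V 0 p x * \<kappa> 0 x y * cnj (?V 0 q y))"
      by (rule sum.reindex_bij_betw[OF bij_betw_rotate_index])
    finally show "stage_element c n k \<kappa> 0 $$ (p, q) = stage_element c n k \<kappa> 1 $$ (p, q)"
      using pq by (simp add: stage_element_index conjugate_kernel_def)
  qed simp_all
  ultimately show ?thesis
    using PiE by (simp add: circle_algebra_def)
qed

definition index_sign :: "nat \<Rightarrow> (bool list \<times> nat) \<times> nat \<Rightarrow> complex" where
  "index_sign n x = complex_of_real (word_sign (fst (fst x))) * half_sign n (snd x)"

lemma index_sign_sq [simp]: "index_sign n x * index_sign n x = 1"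
  using word_sign_cases[of "fst (fst x)"] by (auto simp: index_sign_def half_sign_def)

lemma index_sign_cancel [simp]: "index_sign n x * (index_sign n x * z) = z"
  by (simp add: mult.assoc[symmetric])

text \<open>Each frame column is an eigenvector of the sign unitary, with eigenvalue
  \<open>index_sign\<close>; so in the frame \<alpha> just multiplies entries by signs.\<close>

lemma alpha_stage_element:
  assumes c: "swap_path c" and n: "n \<ge> 1" and \<kappa>: "closed_kernel n k \<kappa>"
  shows "alpha (n + k) (stage_element c n k \<kappa>) =
    stage_element c n k (\<lambda>t x y. index_sign n x * index_sign n y * \<kappa> t x y)"
proof (rule circle_mat_eqI[where D = "4 ^ (n + k)"])
  have N: "n + k \<ge> 1" using n by simp
  note mem = stage_element_in_stage_algebra[OF c n \<kappa>]
  have sgn: "half_sign (n + k) p * frame_column c n t p x = index_sign n x * frame_column c n t p x"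
    if "p < 4 ^ (n + k)" "x \<in> indices n k" for t p x
    using frame_sign[OF n, of p "fst (fst x)" c "t + real (snd (fst x))" "snd x"] that
    by (auto simp: indices_def base_points_def words_def frame_column_def index_sign_def)
  have cnj_sign: "cnj (index_sign n x) = index_sign n x" "cnj (half_sign (n + k) p) = half_sign (n + k) p" for x p
    by (simp_all add: index_sign_def half_sign_def)
  fix t :: real
  show "alpha (n + k) (stage_element c n k \<kappa>) t \<in> carrier_mat (4 ^ (n + k)) (4 ^ (n + k))" if "t \<in> {0..1}"
    by (rule circle_algebra_carrier[OF alpha_in_circle_algebra[OF N mem] that])
  fix p q assume t: "t \<in> {0..1}" and pq: "p < (4::nat) ^ (n + k)" "q < (4::nat) ^ (n + k)"
  have "alpha (n + k) (stage_element c n k \<kappa>) t $$ (p, q) = (\<Sum>x\<in>indices n k. \<Sum>y\<in>indices n k.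
      (half_sign (n + k) p * frame_column c n t p x) * \<kappa> t x y * cnj (half_sign (n + k) q * frame_column c n t q y))"
    using pq t by (simp add: alpha_index[OF N mem] stage_element_index conjugate_kernel_def sum_distrib_left cnj_sign mult_ac)
  also have "\<dots> = (\<Sum>x\<in>indices n k. \<Sum>y\<in>indices n k.
      (index_sign n x * frame_column c n t p x) * \<kappa> t x y * cnj (index_sign n y * frame_column c n t q y))"
    by (intro sum.cong refl) (simp only: sgn[OF pq(1)] sgn[OF pq(2)])
  finally show "alpha (n + k) (stage_element c n k \<kappa>) t $$ (p, q) =
      stage_element c n k (\<lambda>t x y. index_sign n x * index_sign n y * \<kappa> t x y) t $$ (p, q)"
    using pq t by (simp add: stage_element_index conjugate_kernel_def cnj_sign mult_ac)
qed (auto simp: alpha_def stage_element_def)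

lemma circle_norm_stage_element_le:
  assumes c: "swap_path c" and n: "n \<ge> 1"
    and \<kappa>: "\<And>t. t \<in> {0..1} \<Longrightarrow> kbound (indices n k) (\<kappa> t) C"
  shows "circle_norm (stage_element c n k \<kappa>) \<le> C"
proof (rule circle_norm_le)
  fix t :: real assume t: "t \<in> {0..1}"
  show "stage_element c n k \<kappa> t \<in> carrier_mat (4 ^ (n + k)) (4 ^ (n + k))" using t by simp
  have "kbound {..<4 ^ (n + k)} (conjugate_kernel (indices n k) (frame_column c n t) (\<kappa> t)) C"
    using \<kappa>[OF t]
    by (intro kbound_conjugate_kernel) (simp_all add: frame_column_orthonormal[OF c n] frame_column_complete[OF c n] finite_indices)
  then show "kbound {..<4 ^ (n + k)} (\<lambda>i j. stage_element c n k \<kappa> t $$ (i, j)) C"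
    using t by (subst kbound_cong) (auto simp: stage_element_index)
qed

section \<open>The Rokhlin kernels\<close>

text \<open>For real \<open>z\<close> of norm 1 on every cell this is the projection onto the span
  of the restrictions of \<open>z\<close> to the cells.\<close>

definition cell_kernel :: "('x \<Rightarrow> 'c) \<Rightarrow> ('x \<Rightarrow> complex) \<Rightarrow> 'x \<Rightarrow> 'x \<Rightarrow> complex" where
  "cell_kernel c z x y = (if c x = c y then z x * z y else 0)"

lemma kmul_cell_kernel:
  assumes "(\<Sum>y\<in>X. if c y = c x then z y * z y else 0) = 1"
  shows "kmul X (cell_kernel c z) (cell_kernel c z) x u = cell_kernel c z x u"
proof -
  have "kmul X (cell_kernel c z) (cell_kernel c z) x u =
      (\<Sum>y\<in>X. (if c y = c x then z y * z y else 0) * cell_kernel c z x u)"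
    unfolding kmul_def by (intro sum.cong refl) (auto simp: cell_kernel_def)
  then show ?thesis using assms by (simp add: sum_distrib_right[symmetric])
qed

text \<open>With J the permutation operator of \<open>\<iota>\<close> this is P (1 + \<epsilon> J) /
  2. If P commutes with J, the signs 1 and -1 give the projections onto the two eigenspaces of J in
  the range of P.\<close>

definition reflected :: "('x \<Rightarrow> 'x) \<Rightarrow> complex \<Rightarrow> ('x \<Rightarrow> 'x \<Rightarrow> complex) \<Rightarrow> 'x \<Rightarrow> 'x \<Rightarrow> complex" where
  "reflected \<iota> \<epsilon> P x y = (P x y + \<epsilon> * P x (\<iota> y)) / 2"

text \<open>Since J squares to 1 and commutes with P, the product is P (1 + \<epsilon> J)(1 +
  \<delta> J) / 4. Keeping both scalars free yields idempotence and orthogonality from one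
  computation.\<close>

lemma kmul_reflected:
  assumes \<iota>: "bij_betw \<iota> X X" "\<And>x. x \<in> X \<Longrightarrow> \<iota> (\<iota> x) = x"
    and P: "\<And>x y. x \<in> X \<Longrightarrow> y \<in> X \<Longrightarrow> P (\<iota> x) (\<iota> y) = P x y"
    and idem: "\<And>x y. x \<in> X \<Longrightarrow> y \<in> X \<Longrightarrow> kmul X P P x y = P x y"
    and xy: "x \<in> X" "u \<in> X"
  shows "kmul X (reflected \<iota> \<epsilon> P) (reflected \<iota> \<delta> P) x u =
    ((1 + \<epsilon> * \<delta>) * P x u + (\<epsilon> + \<delta>) * P x (\<iota> u)) / 4"
proof -
  have \<iota>X: "\<iota> y \<in> X" if "y \<in> X" for y using \<iota>(1) that by (auto simp: bij_betw_def)
  have shift: "(\<Sum>y\<in>X. P x (\<iota> y) * P y v) = P x (\<iota> v)" if v: "v \<in> X" for v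
  proof -
    have "(\<Sum>y\<in>X. P x (\<iota> y) * P y v) = (\<Sum>y\<in>X. P x (\<iota> y) * P (\<iota> y) (\<iota> v))"
      by (intro sum.cong refl) (simp add: P v)
    also have "\<dots> = kmul X P P x (\<iota> v)"
      unfolding kmul_def by (rule sum.reindex_bij_betw[OF \<iota>(1)])
    finally show ?thesis by (simp add: idem xy \<iota>X v)
  qed
  have "kmul X (reflected \<iota> \<epsilon> P) (reflected \<iota> \<delta> P) x u =
      (\<Sum>y\<in>X. 1 / 4 * (P x y * P y u) + \<delta> / 4 * (P x y * P y (\<iota> u)) +
        \<epsilon> / 4 * (P x (\<iota> y) * P y u) + \<epsilon> * \<delta> / 4 * (P x (\<iota> y) * P y (\<iota> u)))"
    unfolding kmul_def reflected_def by (intro sum.cong refl) (simp add: field_simps)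
  also have "\<dots> = 1 / 4 * (\<Sum>y\<in>X. P x y * P y u) + \<delta> / 4 * (\<Sum>y\<in>X. P x y * P y (\<iota> u)) +
        \<epsilon> / 4 * (\<Sum>y\<in>X. P x (\<iota> y) * P y u) + \<epsilon> * \<delta> / 4 * (\<Sum>y\<in>X. P x (\<iota> y) * P y (\<iota> u))"
    by (simp only: sum.distrib sum_distrib_left)
  also have "(\<Sum>y\<in>X. P x y * P y u) = P x u"
    using idem xy by (simp add: kmul_def)
  also have "(\<Sum>y\<in>X. P x y * P y (\<iota> u)) = P x (\<iota> u)"
    using idem xy \<iota>X by (simp add: kmul_def)
  also have "(\<Sum>y\<in>X. P x (\<iota> y) * P y u) = P x (\<iota> u)" by (rule shift[OF xy(2)])
  also have "(\<Sum>y\<in>X. P x (\<iota> y) * P y (\<iota> u)) = P x u"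
    using shift[OF \<iota>X[OF xy(2)]] \<iota>(2)[OF xy(2)] by simp
  finally show ?thesis by (simp add: field_simps)
qed

lemma reflected_herm:
  assumes \<iota>: "bij_betw \<iota> X X" "\<And>x. x \<in> X \<Longrightarrow> \<iota> (\<iota> x) = x"
    and P: "\<And>x y. x \<in> X \<Longrightarrow> y \<in> X \<Longrightarrow> P (\<iota> x) (\<iota> y) = P x y"
    and herm: "\<And>x y. P y x = cnj (P x y)" and \<epsilon>: "cnj \<epsilon> = \<epsilon>" and xy: "x \<in> X" "y \<in> X"
  shows "reflected \<iota> \<epsilon> P y x = cnj (reflected \<iota> \<epsilon> P x y)"
proof -
  have \<iota>X: "\<iota> x \<in> X" "\<iota> y \<in> X" using \<iota>(1) xy by (auto simp: bij_betw_def)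
  have "P y (\<iota> x) = P (\<iota> y) x" using P[OF \<iota>X(2) xy(1)] \<iota>(2)[OF xy(2)] by simp
  then show ?thesis
    using herm[of y x] herm[of "\<iota> y" x] by (simp add: reflected_def \<epsilon>)
qed

text \<open>Changing one letter is enough to reverse the product of the signs, and it is an
  involution on the words of a given length.\<close>

definition flip :: "bool list \<Rightarrow> bool list" where
  "flip w = (case w of [] \<Rightarrow> [] | \<sigma> # v \<Rightarrow> (\<not> \<sigma>) # v)"

lemma flip_simps [simp]: "flip (flip w) = w" "length (flip w) = length w"
  by (auto simp: flip_def split: list.split)

lemma word_sign_flip: "w \<noteq> [] \<Longrightarrow> word_sign (flip w) = - word_sign w"
  by (auto simp: flip_def sg_def split: list.split)

text \<open>\<open>K\<close> arcs with \<open>L\<close> points of each fibre. With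
  \<open>L \<ge> 2\<close> the first and the last position of an arc are different, so the path of
  removed vectors has orthogonal ends.\<close>

locale rokhlin_cells =
  fixes n k K L :: nat
  assumes KL: "K * L = 2 ^ k" and L2: "L \<ge> 2"
begin

lemma K_pos: "K > 0"
  using KL by (cases K) auto

lemma k_pos: "k > 0"
proof (rule ccontr)
  assume "\<not> k > 0"
  then have "K * L = 1" using KL by simp
  then show False using L2 by simp
qed

lemma arc_less: "j < 2 ^ k \<Longrightarrow> j div L < K"
  using KL by (simp add: less_mult_imp_div_less)

definition cell :: "(bool list \<times> nat) \<times> nat \<Rightarrow> bool list \<times> nat \<times> nat" where
  "cell x = (fst (fst x), snd (fst x) div L, snd x)"

definition edge :: "real \<Rightarrow> nat \<Rightarrow> complex" where
  "edge t i = complex_of_real (if i = 0 then sqrt (1 - t) else if i = L - 1 then sqrt t else 0)"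

definition edge_vector :: "real \<Rightarrow> (bool list \<times> nat) \<times> nat \<Rightarrow> complex" where
  "edge_vector t x = edge t (snd (fst x) mod L)"

definition defect :: kernel where
  "defect t = cell_kernel cell (edge_vector t)"

definition bulk :: kernel where
  "bulk t x y = (if x = y then 1 else 0) - defect t x y"

text \<open>Indices on a negative sheet run backwards along the circle. So the reversed arc number
  describes the same arc of the circle, and keeping the position inside the arc amounts to
  reflecting that arc.\<close>

definition mirror :: "(bool list \<times> nat) \<times> nat \<Rightarrow> (bool list \<times> nat) \<times> nat" where
  "mirror x = ((flip (fst (fst x)), (K - 1 - snd (fst x) div L) * L + snd (fst x) mod L), snd x)"

definition rokhlin_kernel :: "complex \<Rightarrow> kernel" where
  "rokhlin_kernel \<epsilon> t = reflected mirror \<epsilon> (bulk t)"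

lemma sum_edge: "t \<in> {0..1} \<Longrightarrow> (\<Sum>i<L. edge t i * edge t i) = 1"
proof -
  assume t: "t \<in> {0..1}"
  have "(\<Sum>i<L. edge t i * edge t i) = (\<Sum>i<L. (if i = 0 then complex_of_real (1 - t) else 0) + (if i = L - 1 then complex_of_real t else 0))"
    using t L2 by (intro sum.cong refl) (auto simp: edge_def simp flip: of_real_mult)
  then show ?thesis using L2 by (simp add: sum.distrib)
qed

lemma sum_edge_vector:
  assumes t: "t \<in> {0..1}" and x: "x \<in> indices n k"
  shows "(\<Sum>y\<in>indices n k. if cell y = cell x then edge_vector t y * edge_vector t y else 0) = 1"
proof -
  obtain w j a where xe: "x = ((w, j), a)" by (metis prod.exhaust)
  have lt: "w \<in> words k" "j < 2 ^ k" "a < 4 ^ n" using x by (auto simp: xe indices_def base_points_def)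
  have L: "L > 0" using L2 by simp
  have "(\<Sum>y\<in>indices n k. if cell y = cell x then edge_vector t y * edge_vector t y else 0) =
      (\<Sum>v\<in>words k. if v = w then (\<Sum>i<2 ^ k. if i div L = j div L then (\<Sum>b<4 ^ n. if b = a then edge t (i mod L) * edge t (i mod L) else 0) else 0) else 0)"
    unfolding sum_indices by (intro sum.cong refl) (auto simp: cell_def edge_vector_def xe intro!: sum.cong)
  also have "\<dots> = (\<Sum>i<2 ^ k. if i div L = j div L then edge t (i mod L) * edge t (i mod L) else 0)"
    using lt by (simp cong: if_cong)
  also have "\<dots> = (\<Sum>A<K. \<Sum>s<L. if (A * L + s) div L = j div L then edge t ((A * L + s) mod L) * edge t ((A * L + s) mod L) else 0)"
    unfolding KL[symmetric] by (rule sum_lessThan_mult)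
  also have "\<dots> = (\<Sum>A<K. if A = j div L then (\<Sum>s<L. edge t s * edge t s) else 0)"
    by (intro sum.cong refl) (auto intro!: sum.cong sum.neutral)
  also have "\<dots> = 1" using sum_edge[OF t] arc_less[OF lt(2)] by simp
  finally show ?thesis .
qed

lemma defect_herm: "defect t y x = cnj (defect t x y)"
  by (simp add: defect_def cell_kernel_def edge_vector_def edge_def mult.commute)

lemma defect_idem:
  "t \<in> {0..1} \<Longrightarrow> x \<in> indices n k \<Longrightarrow> kmul (indices n k) (defect t) (defect t) x y = defect t x y"
  unfolding defect_def by (rule kmul_cell_kernel[OF sum_edge_vector])

lemma bulk_herm: "bulk t y x = cnj (bulk t x y)"
  using defect_herm[of t x y] by (simp add: bulk_def)

lemma bulk_idem:
  assumes "t \<in> {0..1}" "x \<in> indices n k" "y \<in> indices n k"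
  shows "kmul (indices n k) (bulk t) (bulk t) x y = bulk t x y"
proof -
  let ?I = "\<lambda>x y. if x = y then 1 else (0 :: complex)"
  have "kmul (indices n k) (bulk t) (bulk t) x y =
      (\<Sum>u\<in>indices n k. (if u = x then ?I x y else 0) - (if u = x then defect t x y else 0) - (if u = y then defect t x y else 0)
        + defect t x u * defect t u y)"
    unfolding kmul_def bulk_def by (intro sum.cong refl) (auto simp: algebra_simps)
  also have "\<dots> = ?I x y - defect t x y - defect t x y + kmul (indices n k) (defect t) (defect t) x y"
    using assms by (simp add: sum.distrib sum_subtractf kmul_def)
  finally show ?thesis using assms by (simp add: defect_idem bulk_def)
qed

lemma mirror_arith:
  assumes "j < 2 ^ k"
  shows "((K - 1 - j div L) * L + j mod L) div L = K - 1 - j div L"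
    "((K - 1 - j div L) * L + j mod L) mod L = j mod L"
    "(K - 1 - j div L) * L + j mod L < 2 ^ k"
proof -
  have L: "L > 0" using L2 by simp
  show "((K - 1 - j div L) * L + j mod L) div L = K - 1 - j div L"
    "((K - 1 - j div L) * L + j mod L) mod L = j mod L" using L by simp_all
  have "(K - 1 - j div L) * L + j mod L < (K - 1 - j div L) * L + L" using L by simp
  also have "\<dots> = (K - 1 - j div L + 1) * L" by simp
  also have "\<dots> \<le> K * L" using K_pos by (intro mult_right_mono) auto
  finally show "(K - 1 - j div L) * L + j mod L < 2 ^ k" using KL by simp
qed

lemma mirror_in: "x \<in> indices n k \<Longrightarrow> mirror x \<in> indices n k"
  using mirror_arith(3) by (auto simp: mirror_def indices_def base_points_def words_def)

lemma mirror_mirror: "x \<in> indices n k \<Longrightarrow> mirror (mirror x) = x"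
proof -
  assume x: "x \<in> indices n k"
  obtain w j a where xe: "x = ((w, j), a)" by (metis prod.exhaust)
  have j: "j < 2 ^ k" using x by (auto simp: xe indices_def base_points_def)
  have "K - 1 - (K - 1 - j div L) = j div L" using arc_less[OF j] by simp
  then show ?thesis using mirror_arith[OF j] by (simp add: mirror_def xe)
qed

lemma bij_betw_mirror: "bij_betw mirror (indices n k) (indices n k)"
  by (rule bij_betw_byWitness[where f' = mirror]) (auto simp: mirror_mirror mirror_in)

lemma mirror_eq_iff: "x \<in> indices n k \<Longrightarrow> y \<in> indices n k \<Longrightarrow> mirror x = mirror y \<longleftrightarrow> x = y"
  using mirror_mirror by metis

lemma edge_vector_mirror: "x \<in> indices n k \<Longrightarrow> edge_vector t (mirror x) = edge_vector t x"
  using mirror_arith by (auto simp: edge_vector_def mirror_def indices_def base_points_def)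

lemma cell_mirror_iff:
  assumes "x \<in> indices n k" "y \<in> indices n k"
  shows "cell (mirror x) = cell (mirror y) \<longleftrightarrow> cell x = cell y"
proof -
  obtain w j a v i b where xy: "x = ((w, j), a)" "y = ((v, i), b)" by (metis prod.exhaust)
  have lt: "j < 2 ^ k" "i < 2 ^ k" using assms by (auto simp: xy indices_def base_points_def)
  have "flip w = flip v \<longleftrightarrow> w = v" by (metis flip_simps(1))
  moreover have "K - 1 - j div L = K - 1 - i div L \<longleftrightarrow> j div L = i div L"
    using arc_less[OF lt(1)] arc_less[OF lt(2)] by auto
  ultimately show ?thesis
    using mirror_arith(1)[OF lt(1)] mirror_arith(1)[OF lt(2)] by (simp add: cell_def mirror_def xy)
qed

lemma bulk_mirror:
  "x \<in> indices n k \<Longrightarrow> y \<in> indices n k \<Longrightarrow> bulk t (mirror x) (mirror y) = bulk t x y"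
  by (simp add: bulk_def defect_def cell_kernel_def cell_mirror_iff edge_vector_mirror mirror_eq_iff)

lemma rokhlin_kernel_herm:
  "cnj \<epsilon> = \<epsilon> \<Longrightarrow> x \<in> indices n k \<Longrightarrow> y \<in> indices n k \<Longrightarrow> rokhlin_kernel \<epsilon> t y x = cnj (rokhlin_kernel \<epsilon> t x y)"
  unfolding rokhlin_kernel_def
  by (rule reflected_herm[where P = "bulk t" and \<iota> = mirror, OF bij_betw_mirror mirror_mirror bulk_mirror bulk_herm])

lemma kmul_rokhlin_kernel:
  assumes "t \<in> {0..1}" "x \<in> indices n k" "y \<in> indices n k"
  shows "kmul (indices n k) (rokhlin_kernel \<epsilon> t) (rokhlin_kernel \<delta> t) x y =
    ((1 + \<epsilon> * \<delta>) * bulk t x y + (\<epsilon> + \<delta>) * bulk t x (mirror y)) / 4"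
  unfolding rokhlin_kernel_def
  by (rule kmul_reflected[where P = "bulk t" and \<iota> = mirror, OF bij_betw_mirror mirror_mirror bulk_mirror bulk_idem]) (use assms in auto)

lemma rokhlin_kernel_idem:
  assumes "t \<in> {0..1}" "x \<in> indices n k" "y \<in> indices n k" "\<epsilon> * \<epsilon> = 1"
  shows "kmul (indices n k) (rokhlin_kernel \<epsilon> t) (rokhlin_kernel \<epsilon> t) x y = rokhlin_kernel \<epsilon> t x y"
  unfolding kmul_rokhlin_kernel[OF assms(1-3)] assms(4)
  by (simp add: rokhlin_kernel_def reflected_def field_simps)

lemma rokhlin_kernel_orthogonal:
  "t \<in> {0..1} \<Longrightarrow> x \<in> indices n k \<Longrightarrow> y \<in> indices n k \<Longrightarrow>
    kmul (indices n k) (rokhlin_kernel 1 t) (rokhlin_kernel (- 1) t) x y = 0"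
  by (simp add: kmul_rokhlin_kernel)

lemma rokhlin_kernel_sum:
  "(if x = y then 1 else 0) - rokhlin_kernel 1 t x y - rokhlin_kernel (- 1) t x y = defect t x y"
  by (simp add: rokhlin_kernel_def reflected_def bulk_def field_simps)

subsection \<open>Closing up\<close>

lemma rotate_mod:
  assumes "j < 2 ^ k"
  shows "(j + 1) mod 2 ^ k mod L = (j + 1) mod L"
    "(j + 1) mod 2 ^ k div L = (if j mod L = L - 1 then (j div L + 1) mod K else j div L)"
    "(j + 1) mod L = (if j mod L = L - 1 then 0 else j mod L + 1)"
proof -
  have L: "L > 0" using L2 by simp
  show 1: "(j + 1) mod 2 ^ k mod L = (j + 1) mod L"
    by (rule mod_mod_cancel) (simp add: KL[symmetric])
  have s: "Suc (j mod L) = L \<longleftrightarrow> j mod L = L - 1" using L by auto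
  show 3: "(j + 1) mod L = (if j mod L = L - 1 then 0 else j mod L + 1)"
    by (simp add: mod_Suc s)
  have "(j + 1) div L = (if j mod L = L - 1 then j div L + 1 else j div L)"
    by (simp add: div_Suc s mod_Suc)
  moreover have "(j + 1) mod 2 ^ k div L = (j + 1) div L mod K"
    unfolding KL[symmetric] mult.commute[of K L] by (simp add: mod_mult2_eq L)
  ultimately show "(j + 1) mod 2 ^ k div L = (if j mod L = L - 1 then (j div L + 1) mod K else j div L)"
    using arc_less[OF assms] by simp
qed

lemma edge_ends: "edge 0 i = (if i = 0 then 1 else 0)" "edge 1 i = (if i = L - 1 then 1 else 0)"
  using L2 by (auto simp: edge_def)

text \<open>At the ends the removed vector is supported at one position, the first for
  \<open>t = 0\<close> and the last for \<open>t = 1\<close>. Rotation takes the last position of an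
  arc to the first one of the next, so these end kernels match.\<close>

lemma bulk_ends:
  "bulk 0 x y = (if x = y \<and> snd (fst x) mod L \<noteq> 0 then 1 else 0)"
  "bulk 1 x y = (if x = y \<and> snd (fst x) mod L \<noteq> L - 1 then 1 else 0)"
proof -
  have "x = y" if "cell x = cell y" "snd (fst x) mod L = snd (fst y) mod L"
  proof -
    have "snd (fst x) = snd (fst y)"
      using that by (metis cell_def div_mult_mod_eq fst_conv snd_conv)
    then show ?thesis using that(1) by (simp add: cell_def prod_eq_iff)
  qed
  then show "bulk 0 x y = (if x = y \<and> snd (fst x) mod L \<noteq> 0 then 1 else 0)"
    "bulk 1 x y = (if x = y \<and> snd (fst x) mod L \<noteq> L - 1 then 1 else 0)"
    by (auto simp: bulk_def defect_def cell_kernel_def edge_vector_def edge_ends)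
qed

lemma rotate_pos_iff:
  assumes "x \<in> indices n k"
  shows "snd (fst (rotate_index k x)) mod L = 0 \<longleftrightarrow> snd (fst x) mod L = L - 1"
proof -
  have "snd (fst x) < 2 ^ k" using assms by (auto simp: indices_def base_points_def)
  then have "snd (fst (rotate_index k x)) mod L = (if snd (fst x) mod L = L - 1 then 0 else snd (fst x) mod L + 1)"
    by (simp only: rotate_index_def rotate_base_def fst_conv snd_conv rotate_mod(1,3))
  then show ?thesis by (cases "snd (fst x) mod L = L - 1") simp_all
qed

lemma rotate_index_eq_iff:
  "x \<in> indices n k \<Longrightarrow> y \<in> indices n k \<Longrightarrow> rotate_index k x = rotate_index k y \<longleftrightarrow> x = y"
  using bij_betw_rotate_index[of k n] by (auto simp: bij_betw_def inj_on_eq_iff)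

text \<open>Inside an arc both sheets just advance the position. From the last position a point and
  its mirror image each pass to the following index arc, and these arcs are in general no longer
  mirror images; hence the excluded position.\<close>

lemma mirror_rotate:
  assumes x: "x \<in> indices n k" and e: "snd (fst x) mod L \<noteq> L - 1"
  shows "mirror (rotate_index k x) = rotate_index k (mirror x)"
proof -
  obtain w j a where xe: "x = ((w, j), a)" by (metis prod.exhaust)
  have j: "j < 2 ^ k" using x by (auto simp: xe indices_def base_points_def)
  define i where "i = (K - 1 - j div L) * L + j mod L"
  have i: "i div L = K - 1 - j div L" "i mod L = j mod L" "i < 2 ^ k"
    using mirror_arith[OF j] by (simp_all add: i_def)
  have "(j + 1) mod 2 ^ k div L = j div L" "(j + 1) mod 2 ^ k mod L = j mod L + 1"
    using rotate_mod[OF j] e by (simp_all add: xe)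
  moreover have "(i + 1) mod 2 ^ k = i + 1"
  proof -
    have "(i + 1) mod 2 ^ k mod L = i mod L + 1" "(i + 1) mod 2 ^ k div L = i div L"
      using rotate_mod[OF i(3)] e i(2) by (simp_all add: xe)
    then have "(i + 1) mod 2 ^ k = i div L * L + (i mod L + 1)" by (metis div_mult_mod_eq)
    then show ?thesis by simp
  qed
  ultimately show ?thesis by (simp add: mirror_def rotate_index_def rotate_base_def xe i_def)
qed

lemma continuous_on_edge: "continuous_on {0..1} (\<lambda>t. edge t i)"
  unfolding edge_def by (cases "i = 0"; cases "i = L - 1") (auto intro!: continuous_intros)

lemma continuous_on_bulk: "continuous_on {0..1} (\<lambda>t. bulk t x y)"
  unfolding bulk_def defect_def cell_kernel_def edge_vector_def
  by (cases "cell x = cell y") (auto intro!: continuous_intros continuous_on_edge)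

lemma closed_kernel_bulk: "closed_kernel n k bulk"
  by (auto simp: closed_kernel_def continuous_on_bulk bulk_ends rotate_index_eq_iff rotate_pos_iff)

text \<open>The position at which reflection and rotation fail to commute is harmless: there the
  bulk vanishes at \<open>t = 1\<close>, and at its image under rotation the bulk vanishes at
  \<open>t = 0\<close>.\<close>

lemma closed_kernel_bulk_mirror: "closed_kernel n k (\<lambda>t x y. bulk t x (mirror y))"
  unfolding closed_kernel_def
proof (intro ballI conjI continuous_on_bulk)
  fix x y assume xy: "x \<in> indices n k" "y \<in> indices n k"
  let ?p = "\<lambda>x. snd (fst x) mod L"
  have pm: "?p (mirror u) = ?p u" if "u \<in> indices n k" for u
    using that mirror_arith(2) by (auto simp: mirror_def indices_def base_points_def)
  have "(x = mirror y \<and> ?p x \<noteq> L - 1) \<longleftrightarrow> (rotate_index k x = mirror (rotate_index k y) \<and> ?p (rotate_index k x) \<noteq> 0)"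
  proof (cases "?p y = L - 1")
    case True
    then have "?p (mirror (rotate_index k y)) = 0" using pm[OF rotate_index_in[OF xy(2)]] rotate_pos_iff[OF xy(2)] by simp
    then show ?thesis using pm[OF xy(2)] True by auto
  next
    case False
    then show ?thesis
      using mirror_rotate[OF xy(2)] rotate_pos_iff[OF xy(1)] rotate_index_eq_iff[OF xy(1) mirror_in[OF xy(2)]] by auto
  qed
  then show "bulk 1 x (mirror y) = bulk 0 (rotate_index k x) (mirror (rotate_index k y))"
    by (simp add: bulk_ends)
qed

lemma closed_kernel_defect: "closed_kernel n k defect"
proof -
  have "closed_kernel n k (\<lambda>t x y. if x = y then 1 else 0)"
    by (auto simp: closed_kernel_def rotate_index_eq_iff)
  from closed_kernel_diff[OF this closed_kernel_bulk] show ?thesis by (simp add: bulk_def)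
qed

lemma closed_kernel_rokhlin_kernel: "closed_kernel n k (rokhlin_kernel \<epsilon>)"
  using closed_kernel_scale[OF closed_kernel_add[OF closed_kernel_bulk closed_kernel_scale[OF closed_kernel_bulk_mirror, of \<epsilon>]], of "1 / 2"]
  by (simp add: rokhlin_kernel_def[abs_def] reflected_def[abs_def])

subsection \<open>Signs and locality\<close>

lemma bulk_nonzero_cell: "bulk t x y \<noteq> 0 \<Longrightarrow> cell x = cell y"
  by (auto simp: bulk_def defect_def cell_kernel_def split: if_splits)

text \<open>The sign is constant on cells, so the bulk is invariant, and it changes under
  \<open>mirror\<close>, so the reflected half changes sign. This is why \<alpha> exchanges the two
  projections exactly.\<close>

lemma sign_rokhlin_kernel:
  assumes "x \<in> indices n k" "y \<in> indices n k"
  shows "index_sign n x * index_sign n y * rokhlin_kernel \<epsilon> t x y = rokhlin_kernel (- \<epsilon>) t x y"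
proof -
  have eq: "index_sign n u = index_sign n v" if "cell u = cell v" for u v
    using that by (simp add: cell_def index_sign_def)
  have "fst (fst y) \<noteq> []" using assms(2) k_pos by (auto simp: indices_def base_points_def words_def)
  then have mir: "index_sign n (mirror y) = - index_sign n y"
    by (simp add: index_sign_def mirror_def word_sign_flip)
  have 1: "index_sign n x * index_sign n y * bulk t x y = bulk t x y"
    using bulk_nonzero_cell[of t x y] eq[of x y] index_sign_sq[of n y] by (cases "bulk t x y = 0") auto
  have 2: "index_sign n x * index_sign n y * bulk t x (mirror y) = - bulk t x (mirror y)"
    using bulk_nonzero_cell[of t x "mirror y"] eq[of x "mirror y"] index_sign_sq[of n y] mir
    by (cases "bulk t x (mirror y) = 0") auto
  have "index_sign n x * index_sign n y * rokhlin_kernel \<epsilon> t x y =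
      (index_sign n x * index_sign n y * bulk t x y + \<epsilon> * (index_sign n x * index_sign n y * bulk t x (mirror y))) / 2"
    by (simp add: rokhlin_kernel_def reflected_def algebra_simps)
  also have "\<dots> = rokhlin_kernel (- \<epsilon>) t x y"
    unfolding 1 2 by (simp add: rokhlin_kernel_def reflected_def)
  finally show ?thesis .
qed

text \<open>The number of the arc counted along the circle; on negative sheets this is the reverse
  of the order of the indices.\<close>

definition arc :: "bool list \<times> nat \<Rightarrow> nat" where
  "arc b = (if word_sign (fst b) = 1 then snd b div L else K - 1 - snd b div L)"

lemma arc_mirror: "x \<in> indices n k \<Longrightarrow> arc (fst (mirror x)) = arc (fst x)"
proof -
  assume x: "x \<in> indices n k"
  obtain w j a where xe: "x = ((w, j), a)" by (metis prod.exhaust)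
  have j: "j < 2 ^ k" and w: "w \<noteq> []" using x k_pos by (auto simp: xe indices_def base_points_def words_def)
  have "K - 1 - (K - 1 - j div L) = j div L" using arc_less[OF j] by simp
  then show ?thesis
    using mirror_arith[OF j] word_sign_flip[OF w] word_sign_cases[of w] by (auto simp: mirror_def xe arc_def)
qed

lemma rokhlin_kernel_nonzero:
  assumes "x \<in> indices n k" "y \<in> indices n k" "rokhlin_kernel \<epsilon> t x y \<noteq> 0"
  shows "arc (fst x) = arc (fst y)" "snd x = snd y"
proof -
  have arc: "arc (fst u) = arc (fst v)" if "cell u = cell v" for u v
    using that by (simp add: cell_def arc_def)
  have "cell x = cell y \<or> cell x = cell (mirror y)"
    using assms(3) bulk_nonzero_cell[of t x y] bulk_nonzero_cell[of t x "mirror y"]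
    by (cases "bulk t x y = 0") (auto simp: rokhlin_kernel_def reflected_def)
  then show "arc (fst x) = arc (fst y)" "snd x = snd y"
    using arc[of x y] arc[of x "mirror y"] arc_mirror[OF assms(2)] by (auto simp: cell_def mirror_def)
qed

text \<open>Together with the vanishing off equal coordinates, this says that the kernel is a scalar
  kernel on the base points tensored with the identity of the fibre.\<close>

lemma rokhlin_kernel_shift: "rokhlin_kernel \<epsilon> t (b, i) (b', i) = rokhlin_kernel \<epsilon> t (b, i') (b', i')"
  by (simp add: rokhlin_kernel_def reflected_def bulk_def defect_def cell_kernel_def cell_def edge_vector_def mirror_def)

lemma point_near_arc:
  assumes b: "b \<in> base_points k" and t: "t \<in> {0..1}"
  obtains z :: int where "\<bar>point k t b + of_int z - real (arc b) / real K\<bar> \<le> 1 / real K"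
proof -
  obtain w j where be: "b = (w, j)" by (metis prod.exhaust)
  have j: "j < 2 ^ k" using b by (simp add: be base_points_def)
  define A where "A = j div L"
  have A: "A < K" using arc_less[OF j] by (simp add: A_def)
  have K: "real K > 0" using K_pos by simp
  have L: "real L > 0" using L2 by simp
  define y where "y = (t + real j) / 2 ^ k"
  have KLr: "(2::real) ^ k = real K * real L" using KL by (metis of_nat_mult of_nat_numeral of_nat_power)
  have "j = A * L + j mod L" by (simp add: A_def)
  moreover have "j mod L + 1 \<le> L" using L2 by (simp add: Suc_leI)
  ultimately have "A * L \<le> j" "j + 1 \<le> (A + 1) * L" by (auto simp: algebra_simps)
  then have "real A * real L \<le> real j" "real j + 1 \<le> (real A + 1) * real L"
    by (metis of_nat_le_iff of_nat_mult, metis of_nat_1 of_nat_add of_nat_le_iff of_nat_mult)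
  then have "real A * real L \<le> t + real j" "t + real j \<le> (real A + 1) * real L" using t by auto
  then have "real A * real L / (real K * real L) \<le> y" "y \<le> (real A + 1) * real L / (real K * real L)"
    unfolding y_def KLr by - (rule divide_right_mono, assumption, simp)+
  then have y: "real A / real K \<le> y" "y \<le> (real A + 1) / real K"
    using L by simp_all
  show thesis
  proof (cases "word_sign w = 1")
    case True
    then have "point k t b = y" "arc b = A" by (simp_all add: point_def be y_def arc_def A_def)
    then show thesis using y K by (intro that[of 0]) (simp add: abs_le_iff add_divide_distrib)
  next
    case False
    then have "point k t b = - y" "arc b = K - 1 - A"
      using word_sign_cases[of w]
      by (auto simp: point_def be y_def arc_def A_def add_divide_distrib diff_divide_distrib)
    moreover have "real (K - 1 - A) / real K = 1 - (real A + 1) / real K"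
      using A K by (simp add: of_nat_diff field_simps)
    \<comment> \<open>On a negative sheet the point is \<open>- y\<close>; one full turn brings it
      into the arc whose left end is \<open>arc b / K\<close>.\<close>
    ultimately show thesis using y K by (intro that[of 1]) (simp add: abs_le_iff add_divide_distrib)
  qed
qed

end

section \<open>Commutators with block diagonal kernels\<close>

context rokhlin_cells
begin

definition block_kernel :: "(bool list \<times> nat \<Rightarrow> nat \<Rightarrow> nat \<Rightarrow> complex) \<Rightarrow> (bool list \<times> nat) \<times> nat \<Rightarrow> (bool list \<times> nat) \<times> nat \<Rightarrow> complex" where
  "block_kernel F = (\<lambda>(b, i) (b', i'). if b = b' then F b i i' else 0)"

lemma diagonal_kernel_block: "diagonal_kernel k f t = block_kernel (\<lambda>b. entries f (point k t b))"
  by (simp add: diagonal_kernel_def block_kernel_def)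

lemma kmul_block_kernel_left:
  assumes "b \<in> base_points k"
  shows "kmul (indices n k) (block_kernel F) \<mu> (b, i) z = (\<Sum>i'<4 ^ n. F b i i' * \<mu> (b, i') z)"
proof -
  have "kmul (indices n k) (block_kernel F) \<mu> (b, i) z =
      (\<Sum>b'\<in>base_points k. if b' = b then (\<Sum>i'<4 ^ n. F b i i' * \<mu> (b, i') z) else 0)"
    unfolding kmul_def indices_def sum_Times by (intro sum.cong refl) (simp add: block_kernel_def)
  then show ?thesis using assms by simp
qed

lemma kmul_block_kernel_right:
  assumes "b \<in> base_points k"
  shows "kmul (indices n k) \<mu> (block_kernel F) z (b, i) = (\<Sum>i'<4 ^ n. \<mu> z (b, i') * F b i' i)"
proof -
  have "kmul (indices n k) \<mu> (block_kernel F) z (b, i) =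
      (\<Sum>b'\<in>base_points k. if b' = b then (\<Sum>i'<4 ^ n. \<mu> z (b, i') * F b i' i) else 0)"
    unfolding kmul_def indices_def sum_Times by (intro sum.cong refl) (simp add: block_kernel_def)
  then show ?thesis using assms by simp
qed

text \<open>The Rokhlin kernel acts as a scalar on the fibre coordinates, so multiplying by a block
  diagonal kernel on either side differs only in the base point at which the block is taken.\<close>

lemma rokhlin_kernel_block_commutator:
  assumes "(b, i) \<in> indices n k" "(b', i') \<in> indices n k"
  shows "kmul (indices n k) (rokhlin_kernel \<epsilon> t) (block_kernel F) (b, i) (b', i') -
      kmul (indices n k) (block_kernel F) (rokhlin_kernel \<epsilon> t) (b, i) (b', i') =
    rokhlin_kernel \<epsilon> t (b, i) (b', i) * (F b' i i' - F b i i')"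
proof -
  let ?e = "rokhlin_kernel \<epsilon> t"
  have b: "b \<in> base_points k" "b' \<in> base_points k" "i < 4 ^ n" "i' < 4 ^ n"
    using assms by (auto simp: indices_def)
  have zero: "?e (b, l) (b', l') = 0" if "l \<noteq> l'" "l < 4 ^ n" "l' < 4 ^ n" for l l'
    using rokhlin_kernel_nonzero(2)[of "(b, l)" "(b', l')" \<epsilon> t] that b by (auto simp: indices_def)
  have "(\<Sum>l<4 ^ n. ?e (b, i) (b', l) * F b' l i') = (\<Sum>l<4 ^ n. if l = i then ?e (b, i) (b', i) * F b' i i' else 0)"
    by (intro sum.cong refl) (use zero b in auto)
  moreover have "(\<Sum>l<4 ^ n. F b i l * ?e (b, l) (b', i')) = (\<Sum>l<4 ^ n. if l = i' then F b i i' * ?e (b, i) (b', i) else 0)"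
    by (intro sum.cong refl) (use zero b rokhlin_kernel_shift[of \<epsilon> t b i' b' i] in auto)
  ultimately show ?thesis
    unfolding kmul_block_kernel_left[OF b(1)] kmul_block_kernel_right[OF b(2)]
    using b by (simp add: algebra_simps)
qed

lemma kbound_rokhlin_kernel:
  assumes "t \<in> {0..1}" "\<epsilon> * \<epsilon> = 1" "cnj \<epsilon> = \<epsilon>"
  shows "kbound (indices n k) (rokhlin_kernel \<epsilon> t) 1"
  by (rule kbound_projection[OF finite_indices rokhlin_kernel_herm[OF assms(3)] rokhlin_kernel_idem[OF assms(1) _ _ assms(2)]])

lemma kbound_defect: "t \<in> {0..1} \<Longrightarrow> kbound (indices n k) (defect t) 1"
  by (rule kbound_projection[OF finite_indices defect_herm defect_idem])

text \<open>The kernel links only points of the same arc, so subtracting from \<open>f\<close> a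
  matrix that is constant on each arc leaves the commutator unchanged. The remainder is small, and
  twice its norm bounds the commutator.\<close>

lemma kbound_rokhlin_commutator:
  fixes \<eta> :: real
  assumes t: "t \<in> {0..1}" and \<epsilon>: "\<epsilon> * \<epsilon> = 1" "cnj \<epsilon> = \<epsilon>" and \<eta>: "\<eta> \<ge> 0"
    and near: "\<And>b i i'. b \<in> base_points k \<Longrightarrow> i < 4 ^ n \<Longrightarrow> i' < 4 ^ n \<Longrightarrow>
      cmod (entries f (point k t b) i i' - C (arc b) i i') \<le> \<eta>"
  shows "kbound (indices n k) (\<lambda>x y. kmul (indices n k) (rokhlin_kernel \<epsilon> t) (diagonal_kernel k f t) x y -
    kmul (indices n k) (diagonal_kernel k f t) (rokhlin_kernel \<epsilon> t) x y) (2 * 4 ^ n * \<eta>)"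
proof -
  define G where "G b i i' = entries f (point k t b) i i' - C (arc b) i i'" for b i i'
  have "kbound {..<4 ^ n} (G b) (card {..<(4::nat) ^ n} * \<eta>)" if "b \<in> base_points k" for b
    using near that \<eta> by (intro kbound_entries) (auto simp: G_def)
  then have G: "kbound (indices n k) (block_kernel G) (4 ^ n * \<eta>)"
    unfolding indices_def block_kernel_def using \<eta> by (intro kbound_block_diagonal) auto
  note e = kbound_rokhlin_kernel[OF t \<epsilon>]
  have "kbound (indices n k) (\<lambda>x y. kmul (indices n k) (rokhlin_kernel \<epsilon> t) (block_kernel G) x y -
      kmul (indices n k) (block_kernel G) (rokhlin_kernel \<epsilon> t) x y) (1 * (4 ^ n * \<eta>) + 4 ^ n * \<eta> * 1)"
    by (rule kbound_diff[OF kbound_kmul[OF e G] kbound_kmul[OF G e]])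
  moreover have "kmul (indices n k) (rokhlin_kernel \<epsilon> t) (diagonal_kernel k f t) x y -
      kmul (indices n k) (diagonal_kernel k f t) (rokhlin_kernel \<epsilon> t) x y =
      kmul (indices n k) (rokhlin_kernel \<epsilon> t) (block_kernel G) x y -
      kmul (indices n k) (block_kernel G) (rokhlin_kernel \<epsilon> t) x y"
    if xy: "x \<in> indices n k" "y \<in> indices n k" for x y
  proof -
    obtain b i b' i' where e: "x = (b, i)" "y = (b', i')" by (metis prod.exhaust)
    have in': "(b', i) \<in> indices n k" using xy by (auto simp: e indices_def)
    have "arc b = arc b'" if "rokhlin_kernel \<epsilon> t (b, i) (b', i) \<noteq> 0"
      using rokhlin_kernel_nonzero(1)[OF xy(1)[unfolded e] in' that] by simp
    then show ?thesis
      unfolding diagonal_kernel_block e rokhlin_kernel_block_commutator[OF xy[unfolded e]]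
      by (cases "rokhlin_kernel \<epsilon> t (b, i) (b', i) = 0") (simp_all add: G_def)
  qed
  ultimately show ?thesis by (subst kbound_cong) (simp_all add: algebra_simps)
qed

end

section \<open>Moving the defect\<close>

text \<open>On each sheet a window has room for \<open>K * 4 ^ n\<close> slots at distance two, one
  for each cell. The bounds keep all slots and their predecessors inside one period of the
  index.\<close>

locale rokhlin_comparison = rokhlin_cells +
  fixes start :: "bool list \<Rightarrow> nat"
  assumes start: "\<And>w. w \<in> words k \<Longrightarrow> 1 \<le> start w \<and> start w + 2 * (K * 4 ^ n) \<le> 2 ^ k"
begin

text \<open>\<open>K * l + A\<close> numbers the pairs with \<open>A < K\<close>; the factor 2
  leaves the predecessor of every slot free.\<close>

definition slot :: "bool list \<Rightarrow> nat \<Rightarrow> nat \<Rightarrow> nat" where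
  "slot w A l = start w + 2 * (K * l + A)"

text \<open>
  While \<open>t\<close> runs from \<open>0\<close> to \<open>1\<close>, the vector moves from the base point \<open>slot w A l\<close> to the predecessor
  of \<open>slot w (A + 1) l\<close>, which is the base point that the rotation moves there. All the positions
  used are different.
\<close>

definition slot_vector :: "real \<Rightarrow> bool list \<times> nat \<times> nat \<Rightarrow> bool list \<times> nat \<Rightarrow> real" where
  "slot_vector t c b = (case c of (w, A, l) \<Rightarrow> if fst b = w then
     (if snd b = slot w A l then sqrt (1 - t) else 0) +
     (if Suc (snd b) = slot w ((A + 1) mod K) l then sqrt t else 0) else 0)"

text \<open>The operator that takes the edge vector of each cell to the slot vector of this cell
  tensored with \<open>\<Xi>\<close> and vanishes on the orthogonal complement of the edge vectors,
  the bulk.\<close>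

definition transfer :: "(real \<Rightarrow> bool list \<times> nat \<Rightarrow> nat \<Rightarrow> complex) \<Rightarrow> kernel" where
  "transfer \<Xi> t x y = \<Xi> t (fst x) (snd x) * complex_of_real (slot_vector t (cell y) (fst x)) * edge_vector t y"

lemma slot_inj:
  assumes "A < K" "A' < K" "slot w A l = slot w A' l'"
  shows "A = A' \<and> l = l'"
proof -
  have e: "K * l + A = K * l' + A'" using assms(3) by (simp add: slot_def)
  have "(K * l + A) div K = l" "(K * l' + A') div K = l'" using assms(1,2) K_pos by simp_all
  then show ?thesis using e by simp
qed

lemma Suc_mod_inj: "A < K \<Longrightarrow> A' < K \<Longrightarrow> (A + 1) mod K = (A' + 1) mod K \<Longrightarrow> A = A'"
  by (cases "A + 1 = K"; cases "A' + 1 = K") auto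

lemma slot_parity: "slot w A l \<noteq> Suc (slot w A' l')"
  unfolding slot_def by presburger

lemma slot_bounds:
  assumes "w \<in> words k" "A < K" "l < 4 ^ n"
  shows "start w \<le> slot w A l" "slot w A l < start w + 2 * (K * 4 ^ n)" "slot w A l < 2 ^ k" "slot w A l \<ge> 1"
proof -
  have "K * l + A < K * (l + 1)" using assms by simp
  also have "\<dots> \<le> K * 4 ^ n" using assms by (intro mult_left_mono) auto
  finally have "slot w A l < start w + 2 * (K * 4 ^ n)" by (simp add: slot_def)
  then show "start w \<le> slot w A l" "slot w A l < start w + 2 * (K * 4 ^ n)" "slot w A l < 2 ^ k" "slot w A l \<ge> 1"
    using start[OF assms(1)] by (auto simp: slot_def)
qed

definition slot_average :: "(bool list \<times> nat \<Rightarrow> real) \<Rightarrow> real \<Rightarrow> bool list \<times> nat \<times> nat \<Rightarrow> real" where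
  "slot_average N t c = (case c of (w, A, l) \<Rightarrow> (1 - t) * N (w, slot w A l) + t * N (w, slot w ((A + 1) mod K) l - 1))"

text \<open>Slots on one sheet all have the same parity and predecessors the other, and each
  position determines its cell; so vectors of different cells have disjoint supports. The weight
  \<open>N\<close> is carried along because the fibre vector depends on the base point.\<close>

lemma slot_vector_gram:
  assumes t: "t \<in> {0..1}" and c: "w \<in> words k" "A < K" "l < 4 ^ n" and c': "A' < K" "l' < 4 ^ n"
  shows "(\<Sum>b\<in>base_points k. N b * (slot_vector t (w, A, l) b * slot_vector t (w', A', l') b)) =
    (if (w, A, l) = (w', A', l') then slot_average N t (w, A, l) else 0)"
proof (cases "w = w'")
  case False
  then have "(\<Sum>b\<in>base_points k. N b * (slot_vector t (w, A, l) b * slot_vector t (w', A', l') b)) = 0"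
    by (intro sum.neutral) (auto simp: slot_vector_def)
  then show ?thesis using False by simp
next
  case True
  define s0 where "s0 = slot w A l"
  define s1 where "s1 = slot w ((A + 1) mod K) l - 1"
  have m: "(A + 1) mod K < K" "(A' + 1) mod K < K" using K_pos by simp_all
  have s1: "Suc s1 = slot w ((A + 1) mod K) l" "s1 < 2 ^ k" "s0 < 2 ^ k"
    using slot_bounds[OF c(1) m(1) c(3)] slot_bounds[OF c] by (auto simp: s1_def s0_def)
  have sq: "\<bar>1 - t\<bar> = 1 - t" "\<bar>t\<bar> = t" using t by simp_all
  have i0: "s0 = slot w A' l' \<longleftrightarrow> A = A' \<and> l = l'"
    using slot_inj[OF c(2) c'(1)] by (auto simp: s0_def)
  have i1: "Suc s1 = slot w ((A' + 1) mod K) l' \<longleftrightarrow> A = A' \<and> l = l'"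
  proof
    assume "Suc s1 = slot w ((A' + 1) mod K) l'"
    then have "slot w ((A + 1) mod K) l = slot w ((A' + 1) mod K) l'" using s1(1) by simp
    from slot_inj[OF m this] Suc_mod_inj[OF c(2) c'(1)] show "A = A' \<and> l = l'" by blast
  qed (use s1(1) in simp)
  have p0: "Suc s0 \<noteq> slot w B x" for B x using slot_parity[of w B x A l] by (simp add: s0_def)
  have p1: "s1 \<noteq> slot w B x" for B x
    using slot_parity[of w "(A + 1) mod K" l B x] s1(1) by metis
  have "(\<Sum>b\<in>base_points k. N b * (slot_vector t (w, A, l) b * slot_vector t (w', A', l') b)) =
      (\<Sum>v\<in>words k. if v = w then (\<Sum>j<2 ^ k.
        (if j = s0 then if A = A' \<and> l = l' then (1 - t) * N (w, s0) else 0 else 0) +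
        (if j = s1 then if A = A' \<and> l = l' then t * N (w, s1) else 0 else 0)) else 0)"
    unfolding base_points_def sum_Times
  proof (intro sum.cong refl)
    fix v assume "v \<in> words k"
    have "N (w, j) * (slot_vector t (w, A, l) (w, j) * slot_vector t (w, A', l') (w, j)) =
        (if j = s0 then if A = A' \<and> l = l' then (1 - t) * N (w, s0) else 0 else 0) +
        (if j = s1 then if A = A' \<and> l = l' then t * N (w, s1) else 0 else 0)" for j
    proof -
      have "s0 \<noteq> s1" using p1[of A l] by (auto simp: s0_def)
      have c1: "slot_vector t (w, A, l) (w, j) = (if j = s0 then sqrt (1 - t) else 0) + (if j = s1 then sqrt t else 0)"
        by (simp only: slot_vector_def prod.case fst_conv snd_conv s0_def[symmetric] s1(1)[symmetric] nat.inject if_True refl)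
      have c2: "slot_vector t (w, A', l') (w, s0) = (if A = A' \<and> l = l' then sqrt (1 - t) else 0)"
        using i0 p0 by (auto simp: slot_vector_def)
      have c3: "slot_vector t (w, A', l') (w, s1) = (if A = A' \<and> l = l' then sqrt t else 0)"
        using i1 p1 by (auto simp: slot_vector_def)
      show ?thesis
        unfolding c1 using \<open>s0 \<noteq> s1\<close> by (auto simp: c2 c3 sq)
    qed
    then show "(\<Sum>j<2 ^ k. N (v, j) * (slot_vector t (w, A, l) (v, j) * slot_vector t (w', A', l') (v, j))) =
        (if v = w then (\<Sum>j<2 ^ k.
        (if j = s0 then if A = A' \<and> l = l' then (1 - t) * N (w, s0) else 0 else 0) +
        (if j = s1 then if A = A' \<and> l = l' then t * N (w, s1) else 0 else 0)) else 0)"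
      using True by (simp add: slot_vector_def)
  qed
  also have "\<dots> = (if A = A' \<and> l = l' then (1 - t) * N (w, s0) + t * N (w, s1) else 0)"
    using c s1 by (simp add: sum.distrib)
  finally show ?thesis using True by (simp add: slot_average_def s0_def s1_def)
qed

text \<open>Cells stay orthogonal under the transfer, so its adjoint times itself is the defect with
  one scalar for each cell. A constant \<open>\<Xi>\<close> shows that the transfer is a
  contraction; the images of a vector under the values of \<open>g\<close> give the compression of
  the positive element.\<close>

lemma kmul_transfer:
  assumes t: "t \<in> {0..1}" and xy: "x \<in> indices n k" "y \<in> indices n k"
  shows "kmul (indices n k) (\<lambda>x y. cnj (transfer \<Xi> t y x)) (transfer \<Xi> t) x y =
    defect t x y * complex_of_real (slot_average (\<lambda>b. (knorm {..<4 ^ n} (\<Xi> t b))\<^sup>2) t (cell y))"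
proof -
  let ?N = "\<lambda>b. (knorm {..<4 ^ n} (\<Xi> t b))\<^sup>2"
  obtain w A l where cx: "cell x = (w, A, l)" by (metis prod.exhaust)
  obtain w' A' l' where cy: "cell y = (w', A', l')" by (metis prod.exhaust)
  have c: "w \<in> words k" "A < K" "l < 4 ^ n" "A' < K" "l' < 4 ^ n"
    using xy cx cy arc_less by (auto simp: cell_def indices_def base_points_def)
  have ev: "cnj (edge_vector t x) = edge_vector t x" by (simp add: edge_vector_def edge_def)
  have "kmul (indices n k) (\<lambda>x y. cnj (transfer \<Xi> t y x)) (transfer \<Xi> t) x y =
      (\<Sum>b\<in>base_points k. \<Sum>i<4 ^ n. edge_vector t x * edge_vector t y *
        complex_of_real (slot_vector t (cell x) b * slot_vector t (cell y) b) * (\<Xi> t b i * cnj (\<Xi> t b i)))"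
    unfolding kmul_def indices_def sum_Times
    by (intro sum.cong refl) (simp add: transfer_def ev mult_ac)
  also have "\<dots> = (\<Sum>b\<in>base_points k. edge_vector t x * edge_vector t y *
      complex_of_real (?N b * (slot_vector t (cell x) b * slot_vector t (cell y) b)))"
  proof (rule sum.cong[OF refl])
    fix b
    let ?E = "edge_vector t x * edge_vector t y * complex_of_real (slot_vector t (cell x) b * slot_vector t (cell y) b)"
    have "(\<Sum>i<4 ^ n. ?E * (\<Xi> t b i * cnj (\<Xi> t b i))) = ?E * complex_of_real (?N b)"
      by (simp only: knorm_sq_complex sum_distrib_left)
    then show "(\<Sum>i<4 ^ n. ?E * (\<Xi> t b i * cnj (\<Xi> t b i))) = edge_vector t x * edge_vector t y *
        complex_of_real (?N b * (slot_vector t (cell x) b * slot_vector t (cell y) b))"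
      by (simp only: of_real_mult mult_ac)
  qed
  also have "\<dots> = edge_vector t x * edge_vector t y *
      complex_of_real (\<Sum>b\<in>base_points k. ?N b * (slot_vector t (cell x) b * slot_vector t (cell y) b))"
    by (simp only: of_real_sum sum_distrib_left)
  also have "\<dots> = edge_vector t x * edge_vector t y *
      complex_of_real (if cell x = cell y then slot_average ?N t (cell x) else 0)"
    unfolding cx cy slot_vector_gram[OF t c] ..
  finally show ?thesis by (simp add: defect_def cell_kernel_def)
qed

lemma kmul_diagonal_transfer:
  assumes "x \<in> indices n k"
  shows "kmul (indices n k) (diagonal_kernel k g t) (transfer \<Xi> t) x y =
    transfer (\<lambda>t b. kapp {..<4 ^ n} (entries g (point k t b)) (\<Xi> t b)) t x y"
proof -
  obtain b i where x: "x = (b, i)" by (metis prod.exhaust)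
  then have b: "b \<in> base_points k" using assms by (simp add: indices_def)
  show ?thesis
    unfolding x diagonal_kernel_block kmul_block_kernel_left[OF b]
    by (simp add: transfer_def kapp_def sum_distrib_right mult.assoc)
qed

text \<open>At \<open>t = 1\<close> only columns at the last position of an arc survive; rotation
  makes them the first position of the next cell. On the other side the slot vector has arrived at
  the predecessor of the next slot, which rotation moves into that slot.\<close>

lemma closed_kernel_transfer:
  "closed_kernel n k (transfer (\<lambda>t b. \<xi>))"
  unfolding closed_kernel_def
proof (intro ballI conjI)
  fix x y assume xy: "x \<in> indices n k" "y \<in> indices n k"
  have cont_if: "continuous_on {0..1} (\<lambda>t. if P then f t else 0)" if "continuous_on {0..1} f"
    for P and f :: "real \<Rightarrow> real"
    using that by (cases P) auto
  have "continuous_on {0..1} (\<lambda>t. slot_vector t c b)" for c b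
    unfolding slot_vector_def by (cases c) (auto intro!: cont_if continuous_intros)
  then show "continuous_on {0..1} (\<lambda>t. transfer (\<lambda>t b. \<xi>) t x y)"
    unfolding transfer_def edge_vector_def
    by (intro continuous_on_mult continuous_on_of_real continuous_on_edge continuous_on_const)
  obtain v i a w j l where e: "x = ((v, i), a)" "y = ((w, j), l)" by (metis prod.exhaust)
  have lt: "w \<in> words k" "j < 2 ^ k" "i < 2 ^ k" "l < 4 ^ n" "v \<in> words k" using xy by (auto simp: e indices_def base_points_def)
  have pos: "snd (fst (rotate_index k y)) mod L = 0 \<longleftrightarrow> j mod L = L - 1"
    using rotate_pos_iff[OF xy(2)] by (simp add: e)
  show "transfer (\<lambda>t b. \<xi>) 1 x y = transfer (\<lambda>t b. \<xi>) 0 (rotate_index k x) (rotate_index k y)"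
  proof (cases "j mod L = L - 1")
    case False
    then show ?thesis using pos by (simp add: transfer_def edge_vector_def edge_ends e)
  next
    case True
    have m: "(j div L + 1) mod K < K" using K_pos by simp
    have cell: "cell (rotate_index k y) = (w, (j div L + 1) mod K, l)"
      using rotate_mod(2)[OF lt(2)] True by (simp add: cell_def rotate_index_def rotate_base_def e)
    \<comment> \<open>Slots lie strictly between 0 and \<open>2 ^ k\<close>, so the index that wraps
      around to 0 hits none of them.\<close>
    have "(i + 1) mod 2 ^ k = slot w ((j div L + 1) mod K) l \<longleftrightarrow> Suc i = slot w ((j div L + 1) mod K) l"
      using slot_bounds(3,4)[OF lt(1) m lt(4)] lt(3) by (cases "Suc i = 2 ^ k") auto
    then have "slot_vector 1 (w, j div L, l) (v, i) =
        slot_vector 0 (w, (j div L + 1) mod K, l) (v, (i + 1) mod 2 ^ k)"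
      by (simp only: slot_vector_def prod.case fst_conv snd_conv) simp
    moreover have "edge_vector 0 (rotate_index k y) = edge_vector 1 y"
      using pos True by (simp add: edge_vector_def edge_ends e)
    moreover have "cell y = (w, j div L, l)" by (simp add: cell_def e)
    moreover have "fst (rotate_index k x) = (v, (i + 1) mod 2 ^ k)" "snd (rotate_index k x) = a" "fst x = (v, i)" "snd x = a"
      by (simp_all add: rotate_index_def rotate_base_def e)
    ultimately show ?thesis by (simp only: transfer_def cell)
  qed
qed

text \<open>A convex combination of two values. The window starts one place before
  \<open>start w\<close>, because predecessors of slots are used as well.\<close>

lemma slot_average_near:
  assumes t: "t \<in> {0..1}" and x: "x \<in> indices n k"
    and N: "\<And>w j. w \<in> words k \<Longrightarrow> j < 2 ^ k \<Longrightarrow> start w \<le> j + 1 \<Longrightarrow> j < start w + 2 * (K * 4 ^ n) \<Longrightarrow> \<bar>N (w, j) - \<rho>\<bar> \<le> \<delta>"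
  shows "\<bar>slot_average N t (cell x) - \<rho>\<bar> \<le> \<delta>"
proof -
  obtain w A l where cx: "cell x = (w, A, l)" by (metis prod.exhaust)
  have c: "w \<in> words k" "A < K" "l < 4 ^ n"
    using x cx arc_less by (auto simp: cell_def indices_def base_points_def)
  have m: "(A + 1) mod K < K" using K_pos by simp
  note s0 = slot_bounds[OF c] and s1 = slot_bounds[OF c(1) m c(3)]
  have 0: "\<bar>N (w, slot w A l) - \<rho>\<bar> \<le> \<delta>" using s0 c by (intro N) auto
  have 1: "\<bar>N (w, slot w ((A + 1) mod K) l - 1) - \<rho>\<bar> \<le> \<delta>" using s1 c by (intro N) auto
  have "slot_average N t (cell x) - \<rho> =
      (1 - t) * (N (w, slot w A l) - \<rho>) + t * (N (w, slot w ((A + 1) mod K) l - 1) - \<rho>)"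
    by (simp add: slot_average_def cx algebra_simps)
  also have "\<bar>\<dots>\<bar> \<le> (1 - t) * \<delta> + t * \<delta>"
    using t mult_left_mono[OF 0, of "1 - t"] mult_left_mono[OF 1, of t]
    by (intro order.trans[OF abs_triangle_ineq]) (auto simp: abs_mult)
  finally show ?thesis by (simp add: algebra_simps)
qed

lemma kbound_defect_scaled:
  assumes t: "t \<in> {0..1}" and \<delta>: "\<delta> \<ge> 0" and h: "\<And>x. x \<in> indices n k \<Longrightarrow> \<bar>h x\<bar> \<le> \<delta>"
  shows "kbound (indices n k) (\<lambda>x y. defect t x y * complex_of_real (h y)) \<delta>"
proof -
  let ?d = "\<lambda>x y. if x = y then complex_of_real (h x) else 0"
  have "kbound (indices n k) (kmul (indices n k) (defect t) ?d) (1 * \<delta>)"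
    by (intro kbound_kmul kbound_defect t kbound_diag) (use \<delta> h in auto)
  moreover have "kmul (indices n k) (defect t) ?d x y = defect t x y * complex_of_real (h y)"
    if "y \<in> indices n k" for x y
    using that by (simp add: kmul_def if_distrib[of "\<lambda>z. _ * z"] cong: if_cong)
  ultimately show ?thesis by (subst (asm) kbound_cong) auto
qed

end

section \<open>The direct limit\<close>

lemma periodic_uniformly_continuous:
  fixes F :: "real \<Rightarrow> 'b::metric_space"
  assumes F: "continuous_on UNIV F" and per: "\<And>y z. F (y + of_int z) = F y" and \<eta>: "\<eta> > 0"
  obtains \<delta> where "\<delta> > 0" "\<And>y y'. \<bar>y - y'\<bar> < \<delta> \<Longrightarrow> dist (F y) (F y') < \<eta>"
proof -
  have "uniformly_continuous_on {-1..2} F"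
    by (rule compact_uniformly_continuous) (auto intro: continuous_on_subset[OF F])
  then obtain d where d: "d > 0" "\<And>y y'. y \<in> {-1..2} \<Longrightarrow> y' \<in> {-1..2} \<Longrightarrow> dist y' y < d \<Longrightarrow> dist (F y') (F y) < \<eta>"
    unfolding uniformly_continuous_on_def using \<eta> by metis
  \<comment> \<open>One integer translation moves \<open>y\<close> into [0,1); then the cap 1 on the
    distance keeps \<open>y'\<close> in the compact interval.\<close>
  have "dist (F y) (F y') < \<eta>" if "\<bar>y - y'\<bar> < min d 1" for y y'
  proof -
    have "y = frac y + of_int \<lfloor>y\<rfloor>" "y' = (y' - of_int \<lfloor>y\<rfloor>) + of_int \<lfloor>y\<rfloor>" by (simp_all add: frac_def)
    then have e: "F y = F (frac y)" "F y' = F (y' - of_int \<lfloor>y\<rfloor>)" using per by metis+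
    define r r' where "r = frac y" and "r' = y' - of_int \<lfloor>y\<rfloor>"
    have "0 \<le> r" "r < 1" by (simp_all add: r_def frac_lt_1)
    moreover have "r - r' = y - y'" by (simp add: r_def r'_def frac_def)
    ultimately have "r \<in> {-1..2}" "r' \<in> {-1..2}" "dist r r' < d"
      using that by (auto simp: dist_real_def)
    then show ?thesis unfolding e r_def[symmetric] r'_def[symmetric] using d(2) by blast
  qed
  then show thesis using that[of "min d 1"] d(1) by simp
qed

lemma finite_common_threshold:
  fixes P :: "'i \<Rightarrow> real \<Rightarrow> bool"
  assumes "finite I" "\<And>i. i \<in> I \<Longrightarrow> \<exists>\<delta>>0. P i \<delta>" "\<And>i \<delta> \<delta>'. P i \<delta> \<Longrightarrow> \<delta>' \<le> \<delta> \<Longrightarrow> P i \<delta>'"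
  shows "\<exists>\<delta>>0. \<forall>i\<in>I. P i \<delta>"
  using assms(1,2)
proof (induction I)
  case (insert i I)
  then obtain d where "d > 0" "\<forall>i\<in>I. P i d" by auto
  moreover obtain d' where "d' > 0" "P i d'" using insert by auto
  ultimately show ?case using assms(3) by (intro exI[of _ "min d d'"]) (auto intro: assms(3))
qed (auto intro: exI[of _ 1])

text \<open>Round \<open>u * M\<close> down and clamp the result so that a window of length
  \<open>R\<close> fits; the rounding and the clamping together move it by at most
  \<open>R + 1\<close>.\<close>

lemma start_position_exists:
  fixes u :: real and M R :: nat
  assumes u: "0 \<le> u" "u \<le> 1" and M: "R + 1 \<le> M"
  shows "\<exists>s\<ge>1. s + R \<le> M \<and> \<bar>real s / real M - u\<bar> \<le> (real R + 1) / real M"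
proof -
  define v where "v = nat \<lfloor>u * real M\<rfloor>"
  define s where "s = min (max 1 v) (M - R)"
  have uM: "0 \<le> u * real M" "u * real M \<le> real M" using u by (simp_all add: mult_left_le_one_le)
  have v: "real v \<le> u * real M" "u * real M < real v + 1"
    using uM by (simp_all add: v_def of_nat_nat)
  have s1: "s \<ge> 1" "s + R \<le> M" using M by (auto simp: s_def)
  have "real s = min (max 1 (real v)) (real M - real R)"
    using M by (simp add: s_def of_nat_diff of_nat_min of_nat_max)
  moreover have "\<bar>min (max 1 x) (real M - real R) - q\<bar> \<le> real R + 1"
    if "x \<le> q" "q < x + 1" "0 \<le> q" "q \<le> real M" "real R + 1 \<le> real M" for x q :: real
    using that by (auto simp: min_def max_def abs_le_iff)
  moreover have "real R + 1 \<le> real M" using M by linarith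
  ultimately have "\<bar>real s - u * real M\<bar> \<le> real R + 1" using v uM by simp
  moreover have "real M > 0" using M by simp
  moreover have "real s / real M - u = (real s - u * real M) / real M" using \<open>real M > 0\<close> by (simp add: field_simps)
  ultimately have "\<bar>real s / real M - u\<bar> \<le> (real R + 1) / real M" by (simp add: abs_divide divide_right_mono)
  then show ?thesis using s1 by blast
qed

text \<open>The point with index j over 1 is the point with index j + 1 over 0, up to a full turn
  when the index wraps around.\<close>

lemma closed_kernel_diagonal:
  assumes f: "f \<in> stage_algebra n"
  shows "closed_kernel n k (diagonal_kernel k f)"
  unfolding closed_kernel_def
proof (intro ballI conjI)
  fix x y assume xy: "x \<in> indices n k" "y \<in> indices n k"
  obtain w j i b' i' where e: "x = ((w, j), i)" "y = (b', i')" by (metis prod.exhaust)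
  have lt: "j < 2 ^ k" "i < 4 ^ n" "i' < 4 ^ n" using xy by (auto simp: e indices_def base_points_def)
  have "continuous_on {0..1} (\<lambda>t. entries f (point k t (w, j)) i i')"
    by (rule continuous_on_compose2[OF continuous_on_entries[OF f lt(2,3)]])
      (auto simp: point_def intro!: continuous_intros)
  then show "continuous_on {0..1} (\<lambda>t. diagonal_kernel k f t x y)"
    by (cases "(w, j) = b'") (simp_all add: diagonal_kernel_def e)
  have "entries f (point k 1 (w, j)) = entries f (point k 0 (rotate_base k (w, j)))"
  proof (cases "j + 1 = 2 ^ k")
    case True
    define z :: int where "z = (if word_sign w = 1 then 1 else - 1)"
    have "1 + real j = 2 ^ k" using True by (metis add.commute of_nat_1 of_nat_add of_nat_numeral of_nat_power)
    then have "point k 1 (w, j) = point k 0 (rotate_base k (w, j)) + of_int z"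
      using True word_sign_cases[of w] by (auto simp: point_def rotate_base_def z_def)
    then show ?thesis by (simp only: entries_periodic)
  next
    case False
    then show ?thesis using lt by (simp add: point_def rotate_base_def add.commute)
  qed
  moreover have "(w, j) = b' \<longleftrightarrow> rotate_base k (w, j) = rotate_base k b'"
  proof
    assume eq: "rotate_base k (w, j) = rotate_base k b'"
    have "((w, j), i) \<in> indices n k" "(b', i) \<in> indices n k" using xy by (auto simp: e indices_def)
    moreover have "rotate_index k ((w, j), i) = rotate_index k (b', i)" using eq by (simp add: rotate_index_def)
    ultimately have "((w, j), i) = (b', i)"
      using bij_betw_rotate_index[of k n] unfolding bij_betw_def by (meson inj_onD)
    then show "(w, j) = b'" by simp
  qed simp
  ultimately show "diagonal_kernel k f 1 x y = diagonal_kernel k f 0 (rotate_index k x) (rotate_index k y)"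
    by (auto simp: diagonal_kernel_def e rotate_index_def)
qed

locale blackadar_limit =
  fixes c :: "real \<Rightarrow> complex mat" and \<phi> :: "nat \<Rightarrow> circle_mat \<Rightarrow> 'a::cstar_algebra" and \<alpha> :: "'a \<Rightarrow> 'a"
  assumes c: "swap_path c" and lim: "direct_limit (psi c) \<phi>" and lm: "limit_map alpha \<phi> \<alpha>"
begin

lemma phi_hom: "n \<ge> 1 \<Longrightarrow> circle_star_hom (4 ^ n) (\<phi> n)"
  using lim by (simp add: direct_limit_def)

lemma norm_phi_le:
  assumes n: "n \<ge> 1" and f: "f \<in> stage_algebra n"
  shows "norm (\<phi> n f) \<le> circle_norm f"
proof (rule LIMSEQ_le_const2)
  show "(\<lambda>k. circle_norm (connecting (psi c) n k f)) \<longlonglongrightarrow> norm (\<phi> n f)"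
    using lim n f by (simp add: direct_limit_def)
  show "\<exists>N. \<forall>k\<ge>N. circle_norm (connecting (psi c) n k f) \<le> circle_norm f"
    using circle_norm_connecting_le[OF c n f] by blast
qed

lemma phi_connecting:
  assumes n: "n \<ge> 1" and f: "f \<in> stage_algebra n"
  shows "\<phi> (n + k) (connecting (psi c) n k f) = \<phi> n f"
proof (induction k)
  case (Suc k)
  have "connecting (psi c) n k f \<in> stage_algebra (n + k)" using connecting_frame_sum[OF c n f] by blast
  then show ?case using Suc lim n by (simp add: direct_limit_def)
qed simp

text \<open>The image in the limit of the function that has kernel \<open>\<kappa>\<close> in the
  frame. On closed kernels this respects all operations, so identities in the limit reduce to finite
  sums at each parameter.\<close>

definition realize :: "nat \<Rightarrow> nat \<Rightarrow> kernel \<Rightarrow> 'a" where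
  "realize n k \<kappa> = \<phi> (n + k) (stage_element c n k \<kappa>)"

lemma realize_cong:
  "(\<And>t x y. t \<in> {0..1} \<Longrightarrow> x \<in> indices n k \<Longrightarrow> y \<in> indices n k \<Longrightarrow> \<kappa> t x y = \<mu> t x y) \<Longrightarrow>
    realize n k \<kappa> = realize n k \<mu>"
  unfolding realize_def by (subst stage_element_cong[of n k \<kappa> \<mu>]) auto

context
  fixes n k :: nat
  assumes n: "n \<ge> 1"
begin

lemma nk: "n + k \<ge> 1"
  using n by simp

lemma realize_add:
  "closed_kernel n k \<kappa> \<Longrightarrow> closed_kernel n k \<mu> \<Longrightarrow>
    realize n k (\<lambda>t x y. \<kappa> t x y + \<mu> t x y) = realize n k \<kappa> + realize n k \<mu>"
  using phi_hom[OF nk] stage_element_in_stage_algebra[OF c n, of k]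
  unfolding realize_def stage_element_add[symmetric] circle_star_hom_def by blast

lemma realize_mult:
  "closed_kernel n k \<kappa> \<Longrightarrow> closed_kernel n k \<mu> \<Longrightarrow>
    realize n k (\<lambda>t. kmul (indices n k) (\<kappa> t) (\<mu> t)) = realize n k \<kappa> * realize n k \<mu>"
  using phi_hom[OF nk] stage_element_in_stage_algebra[OF c n, of k]
  unfolding realize_def stage_element_mult[OF c n, symmetric] circle_star_hom_def by blast

lemma realize_scale:
  "closed_kernel n k \<kappa> \<Longrightarrow> realize n k (\<lambda>t x y. a * \<kappa> t x y) = cscale a (realize n k \<kappa>)"
  using phi_hom[OF nk] stage_element_in_stage_algebra[OF c n, of k]
  unfolding realize_def stage_element_scale[symmetric] circle_star_hom_def by blast

lemma realize_star:
  "closed_kernel n k \<kappa> \<Longrightarrow> realize n k (\<lambda>t x y. cnj (\<kappa> t y x)) = star (realize n k \<kappa>)"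
  using phi_hom[OF nk] stage_element_in_stage_algebra[OF c n, of k]
  unfolding realize_def stage_element_star[symmetric] circle_star_hom_def by blast

lemma realize_one: "realize n k (\<lambda>t x y. if x = y then 1 else 0) = 1"
  using phi_hom[OF nk] by (simp add: realize_def stage_element_one[OF c n] circle_star_hom_def)

lemma realize_diff:
  assumes "closed_kernel n k \<kappa>" "closed_kernel n k \<mu>"
  shows "realize n k (\<lambda>t x y. \<kappa> t x y - \<mu> t x y) = realize n k \<kappa> - realize n k \<mu>"
  using realize_add[OF closed_kernel_diff[OF assms] assms(2)] by simp

lemma realize_diagonal:
  "f \<in> stage_algebra n \<Longrightarrow> realize n k (diagonal_kernel k f) = \<phi> n f"
  by (simp add: realize_def stage_element_diagonal[OF c n] phi_connecting[OF n])

lemma norm_realize_le: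
  assumes "closed_kernel n k \<kappa>" "\<And>t. t \<in> {0..1} \<Longrightarrow> kbound (indices n k) (\<kappa> t) C"
  shows "norm (realize n k \<kappa>) \<le> C"
  using norm_phi_le[OF nk stage_element_in_stage_algebra[OF c n assms(1)]]
    circle_norm_stage_element_le[OF c n, of k \<kappa> C] assms(2)
  by (force simp: realize_def)

lemma alpha_realize:
  assumes "closed_kernel n k \<kappa>"
  shows "\<alpha> (realize n k \<kappa>) = realize n k (\<lambda>t x y. index_sign n x * index_sign n y * \<kappa> t x y)"
  using lm nk stage_element_in_stage_algebra[OF c n assms]
  by (simp add: limit_map_def realize_def alpha_stage_element[OF c n assms])

lemma closed_kernel_sign:
  assumes "closed_kernel n k \<kappa>"
  shows "closed_kernel n k (\<lambda>t x y. index_sign n x * index_sign n y * \<kappa> t x y)"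
proof -
  have "index_sign n (rotate_index k x) = index_sign n x" for x
    by (simp add: index_sign_def rotate_index_def rotate_base_def)
  then show ?thesis using assms by (auto simp: closed_kernel_def intro!: continuous_intros)
qed

end

lemma phi_in_later_stage:
  assumes "n \<ge> 1" "f \<in> stage_algebra n" "n \<le> m"
  shows "\<exists>g\<in>stage_algebra m. \<phi> m g = \<phi> n f"
  using connecting_frame_sum[OF c assms(1,2), of "m - n"] phi_connecting[OF assms(1,2), of "m - n"] assms(3)
  by auto

lemma approximation:
  assumes "\<delta> > 0"
  shows "\<exists>n\<ge>1. \<exists>f\<in>stage_algebra n. norm (\<phi> n f - a) < \<delta>"
proof -
  have "a \<in> closure (\<Union>n\<in>{1..}. \<phi> n ` stage_algebra n)" using lim by (simp add: direct_limit_def)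
  then have "\<exists>y\<in>\<Union>n\<in>{1..}. \<phi> n ` stage_algebra n. dist y a < \<delta>"
    using assms by (simp only: closure_approachable)
  then obtain y where y: "y \<in> (\<Union>n\<in>{1..}. \<phi> n ` stage_algebra n)" "dist y a < \<delta>" ..
  then obtain n f where "n \<ge> 1" "f \<in> stage_algebra n" "y = \<phi> n f" by auto
  then show ?thesis using y(2) by (auto simp: dist_norm)
qed

lemma common_approximation:
  assumes "finite F" "\<delta> > 0"
  shows "\<exists>n\<ge>1. \<forall>a\<in>F. \<exists>f\<in>stage_algebra n. norm (\<phi> n f - a) < \<delta>"
  using assms(1)
proof (induction F)
  case (insert a F)
  then obtain n where n: "n \<ge> 1" "\<forall>a\<in>F. \<exists>f\<in>stage_algebra n. norm (\<phi> n f - a) < \<delta>" by auto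
  obtain m f where m: "m \<ge> 1" "f \<in> stage_algebra m" "norm (\<phi> m f - a) < \<delta>"
    using approximation[OF assms(2)] by metis
  have "\<exists>g\<in>stage_algebra (max n m). norm (\<phi> (max n m) g - b) < \<delta>" if "b \<in> insert a F" for b
  proof (cases "b = a")
    case True
    obtain g where "g \<in> stage_algebra (max n m)" "\<phi> (max n m) g = \<phi> m f"
      using phi_in_later_stage[OF m(1,2), of "max n m"] by auto
    then show ?thesis using True m(3) by (intro bexI[of _ g]) simp_all
  next
    case False
    then have "b \<in> F" using that by simp
    with n(2) have "\<exists>h\<in>stage_algebra n. norm (\<phi> n h - b) < \<delta>" ..
    then obtain h where "h \<in> stage_algebra n" "norm (\<phi> n h - b) < \<delta>" ..
    moreover obtain g where "g \<in> stage_algebra (max n m)" "\<phi> (max n m) g = \<phi> n h"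
      using phi_in_later_stage[OF n(1) \<open>h \<in> stage_algebra n\<close>, of "max n m"] by auto
    ultimately show ?thesis by (intro bexI[of _ g]) simp_all
  qed
  then show ?case using n(1) by (intro exI[of _ "max n m"]) auto
qed auto

subsection \<open>The automorphism\<close>

text \<open>An element of a stage is realised, with \<open>k = 0\<close>, by its own diagonal
  kernel; so kernels without connecting maps already give a dense set.\<close>

lemma dense_induct:
  assumes cl: "closed S" and S: "\<And>n \<kappa>. n \<ge> 1 \<Longrightarrow> closed_kernel n 0 \<kappa> \<Longrightarrow> realize n 0 \<kappa> \<in> S"
  shows "x \<in> S"
proof -
  have "(\<Union>n\<in>{1..}. \<phi> n ` stage_algebra n) \<subseteq> S"
    using S[OF _ closed_kernel_diagonal] realize_diagonal[of _ _ 0] by (auto simp del: One_nat_def)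
  then have "closure (\<Union>n\<in>{1..}. \<phi> n ` stage_algebra n) \<subseteq> S" using cl by (rule closure_minimal)
  then show ?thesis using lim by (auto simp: direct_limit_def)
qed

text \<open>Two elements can be moved to a common stage. Closedness in each variable separately is
  enough, as the variables are released one after the other.\<close>

lemma dense_induct_2:
  assumes "\<And>x. closed {y. P x y}" "\<And>y. closed {x. P x y}"
    and P: "\<And>n \<kappa> \<mu>. n \<ge> 1 \<Longrightarrow> closed_kernel n 0 \<kappa> \<Longrightarrow> closed_kernel n 0 \<mu> \<Longrightarrow> P (realize n 0 \<kappa>) (realize n 0 \<mu>)"
  shows "P x y"
proof -
  have lift: "\<exists>\<kappa>. closed_kernel m 0 \<kappa> \<and> realize m 0 \<kappa> = realize n 0 \<mu>"
    if "n \<ge> 1" "closed_kernel n 0 \<mu>" "n \<le> m" for n m \<mu>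
  proof -
    have "\<exists>g\<in>stage_algebra m. \<phi> m g = realize n 0 \<mu>"
      using phi_in_later_stage[OF that(1) _ that(3), of "stage_element c n 0 \<mu>"]
        stage_element_in_stage_algebra[OF c that(1,2)] by (simp add: realize_def)
    then show ?thesis using closed_kernel_diagonal[of _ m 0] realize_diagonal[of m _ 0] that(1,3) by force
  qed
  have "P (realize n 0 \<kappa>) (realize m 0 \<mu>)"
    if n: "n \<ge> 1" and \<kappa>: "closed_kernel n 0 \<kappa>" and m: "m \<ge> 1" and \<mu>: "closed_kernel m 0 \<mu>" for n \<kappa> m \<mu>
  proof -
    obtain \<kappa>' where \<kappa>': "closed_kernel (max n m) 0 \<kappa>'" "realize (max n m) 0 \<kappa>' = realize n 0 \<kappa>"
      using lift[OF n \<kappa>, of "max n m"] by auto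
    obtain \<mu>' where \<mu>': "closed_kernel (max n m) 0 \<mu>'" "realize (max n m) 0 \<mu>' = realize m 0 \<mu>"
      using lift[OF m \<mu>, of "max n m"] by auto
    show ?thesis using P[OF _ \<kappa>'(1) \<mu>'(1)] \<kappa>'(2) \<mu>'(2) n by simp
  qed
  then have "P (realize n 0 \<kappa>) y" if "n \<ge> 1" "closed_kernel n 0 \<kappa>" for n \<kappa>
    using dense_induct[OF assms(1)[of "realize n 0 \<kappa>"]] that by simp
  then show ?thesis using dense_induct[OF assms(2)[of y]] by simp
qed

lemma continuous_on_alpha: "continuous_on S \<alpha>"
  using lm continuous_on_subset[of UNIV \<alpha> S] by (simp add: limit_map_def)

lemma continuous_on_alpha_comp: "continuous_on S f \<Longrightarrow> continuous_on S (\<lambda>x. \<alpha> (f x))"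
  by (rule continuous_on_compose2[OF continuous_on_alpha[of UNIV]]) auto

lemma alpha_add: "\<alpha> (x + y) = \<alpha> x + \<alpha> y"
proof (rule dense_induct_2[where P = "\<lambda>x y. \<alpha> (x + y) = \<alpha> x + \<alpha> y"])
  fix n \<kappa> \<mu> assume n: "n \<ge> 1" and k: "closed_kernel n 0 \<kappa>" "closed_kernel n 0 \<mu>"
  show "\<alpha> (realize n 0 \<kappa> + realize n 0 \<mu>) = \<alpha> (realize n 0 \<kappa>) + \<alpha> (realize n 0 \<mu>)"
    unfolding realize_add[OF n k, symmetric] alpha_realize[OF n closed_kernel_add[OF k]]
      alpha_realize[OF n k(1)] alpha_realize[OF n k(2)]
      realize_add[OF n closed_kernel_sign[OF n k(1)] closed_kernel_sign[OF n k(2)], symmetric]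
    by (simp add: algebra_simps)
qed (auto intro!: closed_Collect_eq continuous_on_alpha_comp continuous_intros)

lemma alpha_mult: "\<alpha> (x * y) = \<alpha> x * \<alpha> y"
proof (rule dense_induct_2[where P = "\<lambda>x y. \<alpha> (x * y) = \<alpha> x * \<alpha> y"])
  fix n \<kappa> \<mu> assume n: "n \<ge> 1" and k: "closed_kernel n 0 \<kappa>" "closed_kernel n 0 \<mu>"
  show "\<alpha> (realize n 0 \<kappa> * realize n 0 \<mu>) = \<alpha> (realize n 0 \<kappa>) * \<alpha> (realize n 0 \<mu>)"
    unfolding realize_mult[OF n k, symmetric] alpha_realize[OF n closed_kernel_kmul[OF c n k]]
      alpha_realize[OF n k(1)] alpha_realize[OF n k(2)]
      realize_mult[OF n closed_kernel_sign[OF n k(1)] closed_kernel_sign[OF n k(2)], symmetric]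
    by (rule realize_cong) (simp add: kmul_def sum_distrib_left mult_ac)
qed (auto intro!: closed_Collect_eq continuous_on_alpha_comp continuous_intros)

lemma alpha_scale: "\<alpha> (cscale a x) = cscale a (\<alpha> x)"
proof -
  note cs = bounded_linear.continuous_on[OF bounded_linear_cscale]
  have "x \<in> {x. \<alpha> (cscale a x) = cscale a (\<alpha> x)}"
  proof (rule dense_induct)
    fix n \<kappa> assume n: "n \<ge> 1" and k: "closed_kernel n 0 \<kappa>"
    show "realize n 0 \<kappa> \<in> {x. \<alpha> (cscale a x) = cscale a (\<alpha> x)}"
      unfolding mem_Collect_eq realize_scale[OF n k, symmetric] alpha_realize[OF n closed_kernel_scale[OF k]]
        alpha_realize[OF n k] realize_scale[OF n closed_kernel_sign[OF n k], symmetric]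
      by (simp add: mult_ac)
  qed (auto intro!: closed_Collect_eq continuous_on_alpha_comp cs continuous_intros)
  then show ?thesis by simp
qed

lemma alpha_star: "\<alpha> (star x) = star (\<alpha> x)"
proof -
  note cs = bounded_linear.continuous_on[OF bounded_linear_star]
  have "x \<in> {x. \<alpha> (star x) = star (\<alpha> x)}"
  proof (rule dense_induct)
    fix n \<kappa> assume n: "n \<ge> 1" and k: "closed_kernel n 0 \<kappa>"
    have s: "cnj (index_sign n x) = index_sign n x" for x by (simp add: index_sign_def half_sign_def)
    show "realize n 0 \<kappa> \<in> {x. \<alpha> (star x) = star (\<alpha> x)}"
      unfolding mem_Collect_eq realize_star[OF n k, symmetric] alpha_realize[OF n closed_kernel_star[OF k]]
        alpha_realize[OF n k] realize_star[OF n closed_kernel_sign[OF n k], symmetric]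
      by (simp add: s mult_ac)
  qed (auto intro!: closed_Collect_eq continuous_on_alpha_comp cs continuous_intros)
  then show ?thesis by simp
qed

lemma alpha_alpha: "\<alpha> (\<alpha> x) = x"
proof -
  have "x \<in> {x. \<alpha> (\<alpha> x) = x}"
  proof (rule dense_induct)
    fix n \<kappa> assume n: "n \<ge> 1" and k: "closed_kernel n 0 \<kappa>"
    show "realize n 0 \<kappa> \<in> {x. \<alpha> (\<alpha> x) = x}"
      unfolding mem_Collect_eq alpha_realize[OF n k] alpha_realize[OF n closed_kernel_sign[OF n k]]
      by (simp add: mult_ac)
  qed (auto intro!: closed_Collect_eq continuous_on_alpha_comp continuous_on_alpha continuous_intros)
  then show ?thesis by simp
qed

lemma alpha_not_id: "\<alpha> \<noteq> id"
proof
  assume id: "\<alpha> = id"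
  \<comment> \<open>The constant permutation matrix in the first stage that exchanges the two halves
    of the coordinates: the grading negates it, while its square is 1, so it is nonzero in the
    limit.\<close>
  define \<kappa> :: kernel where "\<kappa> = (\<lambda>t x y. if snd y = (snd x + 2) mod 4 then 1 else 0)"
  have X: "indices 1 0 = {([], 0)} \<times> {..<4}" by (auto simp: indices_def base_points_def)
  have k: "closed_kernel 1 0 \<kappa>"
    by (auto simp: closed_kernel_def \<kappa>_def rotate_index_def)
  have four: "a < 4 \<longleftrightarrow> a = 0 \<or> a = 1 \<or> a = 2 \<or> a = (3::nat)" for a by auto
  have "kmul (indices 1 0) (\<kappa> t) (\<kappa> t) x y = (if x = y then 1 else 0)"
    if "x \<in> indices 1 0" "y \<in> indices 1 0" for t x y
  proof -
    have "kmul (indices 1 0) (\<kappa> t) (\<kappa> t) x y = (\<Sum>a<4. \<kappa> t x (([], 0), a) * \<kappa> t (([], 0), a) y)"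
      unfolding kmul_def X sum_Times by simp
    also have "\<dots> = (\<Sum>a<4. if a = (snd x + 2) mod 4 then if snd y = ((snd x + 2) mod 4 + 2) mod 4 then 1 else 0 else 0)"
      by (intro sum.cong refl) (simp add: \<kappa>_def)
    also have "\<dots> = (if snd y = ((snd x + 2) mod 4 + 2) mod 4 then 1 else 0)" by simp
    also have "((snd x + 2) mod 4 + 2) mod 4 = snd x"
      using that(1) unfolding X by (auto simp: four)
    finally show ?thesis using that unfolding X by auto
  qed
  then have sq: "realize 1 0 \<kappa> * realize 1 0 \<kappa> = 1"
    unfolding realize_mult[OF order.refl k k, symmetric] realize_one[OF order.refl, of 0, symmetric]
    by (intro realize_cong) auto
  have "realize 1 0 \<kappa> = realize 1 0 (\<lambda>t x y. index_sign 1 x * index_sign 1 y * \<kappa> t x y)"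
    using alpha_realize[OF order.refl k] id by simp
  also have "\<dots> = realize 1 0 (\<lambda>t x y. - 1 * \<kappa> t x y)"
  proof (rule realize_cong)
    fix t :: real and x y assume "x \<in> indices 1 0" "y \<in> indices 1 0"
    then obtain a b where "x = (([], 0), a)" "y = (([], 0), b)" "a < 4" unfolding X by auto
    then show "index_sign 1 x * index_sign 1 y * \<kappa> t x y = - 1 * \<kappa> t x y"
      by (auto simp: four \<kappa>_def index_sign_def half_sign_def)
  qed
  also have "\<dots> = - realize 1 0 \<kappa>"
    using realize_scale[OF order.refl k, of "- 1"] cscale_of_real[of "- 1" "realize 1 0 \<kappa>"] by simp
  finally have "realize 1 0 \<kappa> = - realize 1 0 \<kappa>" .
  then have "2 *\<^sub>R realize 1 0 \<kappa> = 0" by (metis add.right_inverse scaleR_2)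
  then show False using sq by simp
qed

lemma order_two: "order_two_automorphism \<alpha>"
proof -
  have "bij \<alpha>" by (rule o_bij[of \<alpha>]) (auto simp: fun_eq_iff alpha_alpha)
  then show ?thesis
    by (simp add: order_two_automorphism_def star_automorphism_def alpha_add alpha_scale alpha_mult alpha_star
        alpha_not_id fun_eq_iff[of "\<alpha> \<circ> \<alpha>"] alpha_alpha)
qed

end

section \<open>The tracial Rokhlin property\<close>

lemma norm_commutator_perturb:
  fixes e a b :: "'a::cstar_algebra"
  assumes "norm e \<le> 1"
  shows "norm (e * a - a * e) \<le> norm (e * b - b * e) + 2 * norm (b - a)"
proof -
  have "e * a - a * e = (e * b - b * e) - e * (b - a) + (b - a) * e" by (simp add: algebra_simps)
  also have "norm \<dots> \<le> norm (e * b - b * e) + norm (e * (b - a)) + norm ((b - a) * e)"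
    by (intro order.trans[OF norm_triangle_ineq] add_right_mono norm_triangle_ineq4)
  also have "norm (e * (b - a)) \<le> 1 * norm (b - a)"
    using assms by (intro order.trans[OF norm_mult_ineq] mult_right_mono) auto
  also have "norm ((b - a) * e) \<le> norm (b - a) * 1"
    using assms by (intro order.trans[OF norm_mult_ineq] mult_left_mono) auto
  finally show ?thesis by simp
qed

lemma norm_compress_perturb:
  fixes v x y :: "'a::cstar_algebra"
  assumes v: "norm v \<le> 1"
  shows "norm (star (x * v) * (x * v) - star (y * v) * (y * v)) \<le> norm (x - y) * (norm x + norm y)"
proof -
  have "star (x * v) * (x * v) - star (y * v) * (y * v) = star v * (star x * (x - y) + star (x - y) * y) * v"
    by (simp add: star_mult star_diff algebra_simps)
  also have "norm \<dots> \<le> norm (star v) * norm (star x * (x - y) + star (x - y) * y) * norm v"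
    by (intro order.trans[OF norm_mult_ineq] mult_right_mono norm_mult_ineq) auto
  also have "\<dots> \<le> 1 * norm (star x * (x - y) + star (x - y) * y) * 1"
    using v by (intro mult_mono) auto
  also have "norm (star x * (x - y) + star (x - y) * y) \<le> norm (star x) * norm (x - y) + norm (star (x - y)) * norm y"
    by (intro order.trans[OF norm_triangle_ineq] add_mono norm_mult_ineq)
  finally show ?thesis by (simp add: algebra_simps)
qed

context blackadar_limit
begin

lemma rokhlin_projections:
  assumes n: "n \<ge> 1" and cells: "rokhlin_cells k K L"
  defines "e \<equiv> \<lambda>\<epsilon>. realize n k (rokhlin_cells.rokhlin_kernel K L \<epsilon>)"
  shows "\<epsilon> = 1 \<or> \<epsilon> = - 1 \<Longrightarrow> projection (e \<epsilon>)" "e 1 * e (- 1) = 0" "\<alpha> (e \<epsilon>) = e (- \<epsilon>)"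
    "1 - e 1 - e (- 1) = realize n k (rokhlin_cells.defect L)"
proof -
  interpret rokhlin_cells n k K L by (rule cells)
  note cl = closed_kernel_rokhlin_kernel
  show "projection (e \<epsilon>)" if "\<epsilon> = 1 \<or> \<epsilon> = - 1"
  proof -
    have \<epsilon>: "\<epsilon> * \<epsilon> = 1" "cnj \<epsilon> = \<epsilon>" using that by auto
    have "star (e \<epsilon>) = e \<epsilon>"
      unfolding e_def realize_star[OF n cl, symmetric]
      by (rule realize_cong) (simp add: rokhlin_kernel_herm[OF \<epsilon>(2), symmetric])
    moreover have "e \<epsilon> * e \<epsilon> = e \<epsilon>"
      unfolding e_def realize_mult[OF n cl cl, symmetric]
      by (rule realize_cong) (simp add: rokhlin_kernel_idem \<epsilon>)
    ultimately show ?thesis by (simp add: projection_def)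
  qed
  have zero: "realize n k (\<lambda>t x y. 0) = 0"
    using realize_diff[OF n cl cl, of 1 1] by simp
  show "e 1 * e (- 1) = 0"
    unfolding e_def realize_mult[OF n cl cl, symmetric] zero[symmetric]
    by (rule realize_cong) (simp add: rokhlin_kernel_orthogonal)
  show "\<alpha> (e \<epsilon>) = e (- \<epsilon>)"
    unfolding e_def alpha_realize[OF n cl]
    by (rule realize_cong) (simp add: sign_rokhlin_kernel)
  show "1 - e 1 - e (- 1) = realize n k defect"
    unfolding e_def realize_one[OF n, of k, symmetric] realize_diff[OF n closed_kernel_one[OF c n] cl, symmetric]
      realize_diff[OF n closed_kernel_diff[OF closed_kernel_one[OF c n] cl] cl, symmetric]
    by (rule realize_cong) (rule rokhlin_kernel_sum)
qed

lemma rokhlin_commutator: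
  assumes n: "n \<ge> 1" and cells: "rokhlin_cells k K L" and f: "f \<in> stage_algebra n"
    and \<epsilon>: "\<epsilon> = 1 \<or> \<epsilon> = - 1" and \<eta>: "\<eta> \<ge> 0"
    and near: "\<And>y y' i i'. \<bar>y - y'\<bar> \<le> 1 / real K \<Longrightarrow> i < 4 ^ n \<Longrightarrow> i' < 4 ^ n \<Longrightarrow>
      cmod (entries f y i i' - entries f y' i i') \<le> \<eta>"
  defines "e \<equiv> realize n k (rokhlin_cells.rokhlin_kernel K L \<epsilon>)"
  shows "norm (e * \<phi> n f - \<phi> n f * e) \<le> 2 * 4 ^ n * \<eta>"
proof -
  interpret rokhlin_cells n k K L by (rule cells)
  have \<epsilon>: "\<epsilon> * \<epsilon> = 1" "cnj \<epsilon> = \<epsilon>" using assms(4) by auto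
  note cl = closed_kernel_rokhlin_kernel[of \<epsilon>] and cd = closed_kernel_diagonal[OF f, of k]
  have "e * \<phi> n f - \<phi> n f * e = realize n k (\<lambda>t x y. kmul (indices n k) (rokhlin_kernel \<epsilon> t) (diagonal_kernel k f t) x y -
      kmul (indices n k) (diagonal_kernel k f t) (rokhlin_kernel \<epsilon> t) x y)"
    unfolding e_def realize_diagonal[OF n f, of k, symmetric] realize_mult[OF n cl cd, symmetric] realize_mult[OF n cd cl, symmetric]
    by (rule realize_diff[OF n closed_kernel_kmul[OF c n cl cd] closed_kernel_kmul[OF c n cd cl], symmetric])
  also have "norm \<dots> \<le> 2 * 4 ^ n * \<eta>"
  proof (rule norm_realize_le[OF n closed_kernel_diff[OF closed_kernel_kmul[OF c n cl cd] closed_kernel_kmul[OF c n cd cl]]])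
    fix t :: real assume t: "t \<in> {0..1}"
    show "kbound (indices n k) (\<lambda>x y. kmul (indices n k) (rokhlin_kernel \<epsilon> t) (diagonal_kernel k f t) x y -
        kmul (indices n k) (diagonal_kernel k f t) (rokhlin_kernel \<epsilon> t) x y) (2 * 4 ^ n * \<eta>)"
    \<comment> \<open>On each arc \<open>f\<close> is compared with its value at the left end of the
      arc.\<close>
    proof (rule kbound_rokhlin_commutator[OF t \<epsilon> \<eta>, where C = "\<lambda>A. entries f (real A / real K)"])
      fix b and i i' :: nat assume b: "b \<in> base_points k" and i: "i < 4 ^ n" "i' < 4 ^ n"
      obtain z :: int where "\<bar>point k t b + of_int z - real (arc b) / real K\<bar> \<le> 1 / real K"
        using point_near_arc[OF b t] by metis
      from near[OF this i] show "cmod (entries f (point k t b) i i' - entries f (real (arc b) / real K) i i') \<le> \<eta>"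
        by (simp only: entries_periodic)
    qed
  qed
  finally show ?thesis .
qed

text \<open>All slots are put near \<open>t0\<close>, and \<open>v\<close> moves the defect there
  with the fixed vector \<open>\<xi>\<close>. Applying \<open>g\<close> then only changes the fibre
  vectors, whose squared norms are close to \<open>h t0\<close>. The radius in the hypothesis is the
  error \<open>R + 1\<close> of placing the window plus its width \<open>R\<close>.\<close>

lemma defect_comparison:
  assumes n: "n \<ge> 1" and cells: "rokhlin_cells k K L" and g: "g \<in> stage_algebra n"
    and \<xi>: "knorm {..<4 ^ n} \<xi> \<le> 1" and t0: "t0 \<in> {0..1}" and \<delta>: "\<delta> \<ge> 0"
  defines "h \<equiv> \<lambda>y. (knorm {..<4 ^ n} (kapp {..<4 ^ n} (entries g y) \<xi>))\<^sup>2"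
  defines "R \<equiv> 2 * (K * 4 ^ n)"
  assumes R: "R + 1 \<le> 2 ^ k"
    and near: "\<And>y. \<bar>y - t0\<bar> \<le> (2 * real R + 1) / 2 ^ k \<Longrightarrow> \<bar>h y - h t0\<bar> \<le> \<delta>"
  shows "\<exists>v. norm v \<le> 1 \<and>
    norm (star (\<phi> n g * v) * (\<phi> n g * v) - h t0 *\<^sub>R realize n k (rokhlin_cells.defect L)) \<le> \<delta>"
proof -
  \<comment> \<open>On a negative sheet the parameter y describes the point - y, so the window for
    \<open>t0\<close> sits at \<open>1 - t0\<close>.\<close>
  define u where "u w = (if word_sign w = 1 then t0 else 1 - t0)" for w
  have u: "0 \<le> u w" "u w \<le> 1" for w using t0 by (auto simp: u_def)
  have "\<exists>s\<ge>1. s + R \<le> 2 ^ k \<and> \<bar>real s / real (2 ^ k) - u w\<bar> \<le> (real R + 1) / real (2 ^ k)" for w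
    by (rule start_position_exists[OF u R])
  then obtain start where start_pos: "\<And>w. start w \<ge> 1 \<and> start w + R \<le> 2 ^ k \<and>
      \<bar>real (start w) / real (2 ^ k) - u w\<bar> \<le> (real R + 1) / real (2 ^ k)"
    by metis
  have cmp: "rokhlin_comparison n k K L start"
    unfolding rokhlin_comparison_def rokhlin_comparison_axioms_def using cells start_pos by (simp add: R_def)
  interpret rokhlin_comparison n k K L start by (rule cmp)
  have R1: "R \<ge> 1" using K_pos by (simp add: R_def)
  have near_point: "\<bar>h (point k t (w, j)) - h t0\<bar> \<le> \<delta>"
    if t: "t \<in> {0..1}" and j: "start w \<le> j + 1" "j < start w + R" for t w j
  proof -
    define y where "y = (t + real j) / 2 ^ k"
    have "real (start w) - 1 \<le> real j" "real j + 1 \<le> real (start w) + real R" using j by linarith+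
    then have "\<bar>t + real j - real (start w)\<bar> \<le> real R" using t R1 by (auto simp: abs_le_iff)
    then have "\<bar>(t + real j - real (start w)) / 2 ^ k\<bar> \<le> real R / 2 ^ k"
      by (simp add: abs_divide divide_right_mono)
    then have "\<bar>y - real (start w) / 2 ^ k\<bar> \<le> real R / 2 ^ k"
      by (simp add: y_def add_divide_distrib diff_divide_distrib)
    moreover have "\<bar>real (start w) / 2 ^ k - u w\<bar> \<le> (real R + 1) / 2 ^ k" using start_pos[of w] by simp
    ultimately have "\<bar>y - u w\<bar> \<le> real R / 2 ^ k + (real R + 1) / 2 ^ k" by linarith
    also have "\<dots> = (2 * real R + 1) / 2 ^ k" by (simp add: add_divide_distrib)
    finally have y: "\<bar>y - u w\<bar> \<le> (2 * real R + 1) / 2 ^ k" .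
    define z :: int where "z = (if word_sign w = 1 then 0 else 1)"
    have "\<bar>point k t (w, j) + of_int z - t0\<bar> = \<bar>y - u w\<bar>"
    proof (cases "word_sign w = 1")
      case True
      then show ?thesis by (simp add: point_def y_def u_def z_def)
    next
      case False
      then have "word_sign w = - 1" using word_sign_cases[of w] by simp
      then have "point k t (w, j) + of_int z - t0 = - (y - u w)"
        by (simp add: point_def y_def u_def z_def add_divide_distrib diff_divide_distrib)
      then show ?thesis by (simp only: abs_minus_cancel)
    qed
    then have "\<bar>h (point k t (w, j) + of_int z) - h t0\<bar> \<le> \<delta>" using y by (intro near) simp
    then show ?thesis by (simp only: h_def entries_periodic)
  qed
  let ?V = "transfer (\<lambda>t b. \<xi>)" and ?X = "indices n k"
  let ?W = "\<lambda>t. kmul ?X (diagonal_kernel k g t) (?V t)"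
  note cV = closed_kernel_transfer[of \<xi>]
  have cW: "closed_kernel n k ?W" by (rule closed_kernel_kmul[OF c n closed_kernel_diagonal[OF g] cV])
  define v where "v = realize n k ?V"
  have gv: "\<phi> n g * v = realize n k ?W"
    unfolding v_def realize_diagonal[OF n g, of k, symmetric]
    by (rule realize_mult[OF n closed_kernel_diagonal[OF g] cV, symmetric])
  \<comment> \<open>By the norm identity it suffices to bound \<open>star v * v\<close>, the defect
    scaled by averages of the squared norm of \<open>\<xi>\<close>.\<close>
  have "(norm v)\<^sup>2 = norm (star v * v)" by (simp add: cstar_identity)
  also have "star v * v = realize n k (\<lambda>t. kmul ?X (\<lambda>x y. cnj (?V t y x)) (?V t))"
    unfolding v_def realize_star[OF n cV, symmetric] by (rule realize_mult[OF n closed_kernel_star[OF cV] cV, symmetric])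
  also have "norm \<dots> \<le> 1"
  proof (rule norm_realize_le[OF n closed_kernel_kmul[OF c n closed_kernel_star[OF cV] cV]])
    fix t :: real assume t: "t \<in> {0..1}"
    have "(knorm {..<4 ^ n} \<xi>)\<^sup>2 \<le> 1" using \<xi> by (simp add: power_le_one)
    then have "\<bar>slot_average (\<lambda>b. (knorm {..<4 ^ n} \<xi>)\<^sup>2) t (cell x) - 0\<bar> \<le> 1" if "x \<in> ?X" for x
      by (intro slot_average_near[OF t that]) simp
    then have "kbound ?X (\<lambda>x y. defect t x y * complex_of_real (slot_average (\<lambda>b. (knorm {..<4 ^ n} \<xi>)\<^sup>2) t (cell y))) 1"
      by (intro kbound_defect_scaled[OF t]) simp_all
    then show "kbound ?X (kmul ?X (\<lambda>x y. cnj (?V t y x)) (?V t)) 1"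
      by (subst kbound_cong) (auto simp: kmul_transfer[OF t])
  qed
  finally have v1: "norm v \<le> 1" by (simp add: power_le_one_iff abs_le_square_iff)
  \<comment> \<open>This will be the defect multiplied, cell by cell, by the deviation of the slot
    average from \<open>h t0\<close>.\<close>
  let ?gap = "\<lambda>t x y. kmul ?X (\<lambda>x y. cnj (?W t y x)) (?W t) x y - complex_of_real (h t0) * defect t x y"
  have "star (\<phi> n g * v) * (\<phi> n g * v) - h t0 *\<^sub>R realize n k defect = realize n k ?gap"
    unfolding gv realize_star[OF n cW, symmetric] realize_mult[OF n closed_kernel_star[OF cW] cW, symmetric]
      cscale_of_real[symmetric] realize_scale[OF n closed_kernel_defect, symmetric]
    by (rule realize_diff[OF n closed_kernel_kmul[OF c n closed_kernel_star[OF cW] cW] closed_kernel_scale[OF closed_kernel_defect], symmetric])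
  also have "norm \<dots> \<le> \<delta>"
  proof (rule norm_realize_le[OF n closed_kernel_diff[OF closed_kernel_kmul[OF c n closed_kernel_star[OF cW] cW] closed_kernel_scale[OF closed_kernel_defect]]])
    fix t :: real assume t: "t \<in> {0..1}"
    let ?\<Xi> = "\<lambda>t b. kapp {..<4 ^ n} (entries g (point k t b)) \<xi>"
    let ?a = "\<lambda>y. slot_average (\<lambda>b. (knorm {..<4 ^ n} (?\<Xi> t b))\<^sup>2) t (cell y)"
    have "\<bar>?a x - h t0\<bar> \<le> \<delta>" if "x \<in> ?X" for x
      by (rule slot_average_near[OF t that]) (use near_point[OF t] in \<open>simp add: h_def R_def\<close>)
    then have "kbound ?X (\<lambda>x y. defect t x y * complex_of_real (?a y - h t0)) \<delta>"
      by (intro kbound_defect_scaled[OF t \<delta>]) simp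
    moreover have "?gap t x y = defect t x y * complex_of_real (?a y - h t0)" if xy: "x \<in> ?X" "y \<in> ?X" for x y
    proof -
      have "kmul ?X (\<lambda>x y. cnj (?W t y x)) (?W t) x y =
          kmul ?X (\<lambda>x y. cnj (transfer ?\<Xi> t y x)) (transfer ?\<Xi> t) x y"
        unfolding kmul_def[of ?X "\<lambda>x y. cnj (_ y x)"] by (intro sum.cong refl) (simp add: kmul_diagonal_transfer)
      then show ?thesis by (simp add: kmul_transfer[OF t xy] algebra_simps)
    qed
    ultimately show "kbound ?X (?gap t) \<delta>" by (subst kbound_cong) auto
  qed
  finally show ?thesis using v1 by blast
qed

lemma tracial_Rokhlin: "tracial_Rokhlin_Z2 \<alpha>"
  unfolding tracial_Rokhlin_Z2_def
proof (intro allI impI, elim conjE)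
  fix F :: "'a set" and \<epsilon> :: real and x :: 'a
  assume F: "finite F" and \<epsilon>: "\<epsilon> > 0" and x: "positive x" "x \<noteq> 0"
  define X where "X = norm x"
  have X: "X > 0" using x by (simp add: X_def)
  \<comment> \<open>The part \<open>\<epsilon> / 8\<close> costs twice as much in a commutator and
    leaves room for the \<open>\<epsilon> / 4\<close> of the kernel estimate. The part
    \<open>X / 16\<close> keeps \<open>\<rho>\<close> above 49/64 times the square of
    \<open>X\<close>, and the cost of replacing \<open>\<phi> n g\<close> by \<open>x\<close> within
    33/256 of that square.\<close>
  define \<delta> where "\<delta> = min (\<epsilon> / 8) (X / 16)"
  have \<delta>: "\<delta> > 0" "\<delta> \<le> \<epsilon> / 8" "\<delta> \<le> X / 16" using \<epsilon> X by (auto simp: \<delta>_def)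
  obtain n where n: "n \<ge> 1" and approx: "\<forall>a\<in>insert x F. \<exists>f\<in>stage_algebra n. norm (\<phi> n f - a) < \<delta>"
    using common_approximation[of "insert x F" \<delta>] F \<delta> by auto
  then have "\<forall>a\<in>insert x F. \<exists>f. f \<in> stage_algebra n \<and> norm (\<phi> n f - a) < \<delta>" by (simp only: Bex_def)
  from bchoice[OF this] obtain f where "\<forall>a\<in>insert x F. f a \<in> stage_algebra n \<and> norm (\<phi> n (f a) - a) < \<delta>" ..
  then have f: "\<And>a. a \<in> insert x F \<Longrightarrow> f a \<in> stage_algebra n" "\<And>a. a \<in> insert x F \<Longrightarrow> norm (\<phi> n (f a) - a) < \<delta>"
    by auto
  define g where "g = f x"
  have g: "g \<in> stage_algebra n" "norm (\<phi> n g - x) < \<delta>" using f by (auto simp: g_def)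
  have "X \<le> norm (\<phi> n g) + norm (\<phi> n g - x)"
    unfolding X_def by (metis add.commute norm_minus_commute norm_triangle_sub)
  then have "X - 2 * \<delta> < circle_norm g" using norm_phi_le[OF n g(1)] g(2) \<delta>(1) by linarith
  then obtain t0 \<xi> where t0: "t0 \<in> {0..1}" and \<xi>: "knorm {..<4 ^ n} \<xi> \<le> 1"
    and big: "X - 2 * \<delta> < knorm {..<4 ^ n} (kapp {..<4 ^ n} (\<lambda>i j. g t0 $$ (i, j)) \<xi>)"
    using less_circle_norm[OF g(1)] by metis
  define h where "h y = (knorm {..<4 ^ n} (kapp {..<4 ^ n} (entries g y) \<xi>))\<^sup>2" for y
  define \<rho> where "\<rho> = h t0"
  have "entries g t0 = (\<lambda>i j. g t0 $$ (i, j))" using entries_eq[OF g(1) t0] by (intro ext) simp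
  then have "(X - 2 * \<delta>)\<^sup>2 < \<rho>"
    using big \<delta>(3) X unfolding \<rho>_def h_def by (intro power_strict_mono) auto
  moreover have "(7 / 8 * X)\<^sup>2 \<le> (X - 2 * \<delta>)\<^sup>2" using \<delta>(3) X by (intro power_mono) auto
  ultimately have \<rho>: "49 / 64 * X\<^sup>2 < \<rho>" by (simp add: power2_eq_square)
  have "X\<^sup>2 > 0" using X by simp
  then have \<rho>0: "\<rho> > 0" using \<rho> by linarith
  \<comment> \<open>Chosen so that the commutator bound \<open>2 * 4 ^ n * \<eta>\<close> equals
    \<open>\<epsilon> / 4\<close>.\<close>
  define \<eta> where "\<eta> = \<epsilon> / (8 * 4 ^ n)"
  have \<eta>: "\<eta> > 0" using \<epsilon> by (simp add: \<eta>_def)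
  have "\<exists>d>0. \<forall>p\<in>F \<times> ({..<4 ^ n} \<times> {..<4 ^ n}). \<forall>y y'. \<bar>y - y'\<bar> < d \<longrightarrow>
      cmod (entries (f (fst p)) y (fst (snd p)) (snd (snd p)) - entries (f (fst p)) y' (fst (snd p)) (snd (snd p))) \<le> \<eta>"
  proof (rule finite_common_threshold)
    fix p assume "p \<in> F \<times> ({..<(4::nat) ^ n} \<times> {..<(4::nat) ^ n})"
    then obtain a i i' where p: "p = (a, i, i')" "a \<in> F" "i < 4 ^ n" "i' < 4 ^ n" by auto
    have "continuous_on UNIV (\<lambda>y. entries (f a) y i i')" using p f by (intro continuous_on_entries) auto
    then obtain d where d: "d > 0" "\<And>y y'. \<bar>y - y'\<bar> < d \<Longrightarrow> dist (entries (f a) y i i') (entries (f a) y' i i') < \<eta>"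
      using periodic_uniformly_continuous[of "\<lambda>y. entries (f a) y i i'" \<eta>] entries_periodic \<eta> by metis
    then show "\<exists>d>0. \<forall>y y'. \<bar>y - y'\<bar> < d \<longrightarrow> cmod (entries (f (fst p)) y (fst (snd p)) (snd (snd p)) -
        entries (f (fst p)) y' (fst (snd p)) (snd (snd p))) \<le> \<eta>"
      by (intro exI[of _ d]) (auto simp: p dist_norm intro: less_imp_le)
  qed (use F in \<open>auto intro: less_le_trans\<close>)
  then obtain d1 where d1: "d1 > 0" "\<And>a i i' y y'. a \<in> F \<Longrightarrow> i < 4 ^ n \<Longrightarrow> i' < 4 ^ n \<Longrightarrow> \<bar>y - y'\<bar> < d1 \<Longrightarrow>
      cmod (entries (f a) y i i' - entries (f a) y' i i') \<le> \<eta>"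
    by force
  have h_cont: "continuous_on UNIV h"
    unfolding h_def knorm_sq kapp_def using g(1)
    by (intro continuous_intros continuous_on_entries) auto
  obtain d2 where d2: "d2 > 0" "\<And>y y'. \<bar>y - y'\<bar> < d2 \<Longrightarrow> dist (h y) (h y') < \<rho> / 4"
    using periodic_uniformly_continuous[of h "\<rho> / 4"] h_cont \<rho>0 by (auto simp: h_def entries_periodic)
  \<comment> \<open>This makes the arcs shorter than the common modulus \<open>d1\<close> of the
    approximants of \<open>F\<close>.\<close>
  obtain p where p: "1 / d1 < 2 ^ p" using real_arch_pow[of 2 "1 / d1"] by auto
  define K :: nat where "K = 2 ^ p"
  define R where "R = 2 * (K * 4 ^ n)"
  \<comment> \<open>The window size \<open>R\<close> depends on \<open>K\<close>, so
    \<open>L\<close> comes second: the first term makes the window narrower than \<open>d2\<close>,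
    the others give it room in the fibre and force \<open>L \<ge> 2\<close>.\<close>
  obtain q where q: "(2 * real R + 2) / d2 + real R + 2 < 2 ^ q"
    using real_arch_pow[of 2 "(2 * real R + 2) / d2 + real R + 2"] by auto
  define L :: nat where "L = 2 ^ q"
  define k where "k = p + q"
  have q': "(2 * real R + 2) / d2 < 2 ^ q" "real R + 2 < 2 ^ q"
    using q d2(1) by (smt (verit) divide_nonneg_pos of_nat_0_le_iff)+
  have "(2::real) ^ q \<le> 2 ^ k" by (simp add: k_def)
  then have k: "(2 * real R + 2) / d2 < 2 ^ k" "real R + 2 < 2 ^ k" using q' by linarith+
  have "real (R + 1) \<le> real (2 ^ k)" using k(2) by simp
  then have Rk: "R + 1 \<le> 2 ^ k" by (simp only: of_nat_le_iff)
  have "real 2 \<le> real L" using q'(2) by (simp add: L_def)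
  then have "2 \<le> L" by (simp only: of_nat_le_iff)
  then have cells: "rokhlin_cells k K L" by unfold_locales (simp_all add: K_def L_def k_def power_add)
  have K1: "1 / real K < d1" using p d1(1) by (simp add: K_def field_simps)
  define e where "e \<epsilon> = realize n k (rokhlin_cells.rokhlin_kernel K L \<epsilon>)" for \<epsilon>
  define r where "r = realize n k (rokhlin_cells.defect L)"
  note proj = rokhlin_projections[OF n cells, folded e_def r_def]
  have commut: "norm (e s * a - a * e s) < \<epsilon>" if a: "a \<in> F" and s: "s = 1 \<or> s = - 1" for a s
  proof -
    have "norm (e s * \<phi> n (f a) - \<phi> n (f a) * e s) \<le> 2 * 4 ^ n * \<eta>"
      unfolding e_def using K1 d1(2)[OF a] \<eta> f(1) a by (intro rokhlin_commutator[OF n cells _ s]) auto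
    also have "\<dots> = \<epsilon> / 4" by (simp add: \<eta>_def)
    finally have "norm (e s * \<phi> n (f a) - \<phi> n (f a) * e s) \<le> \<epsilon> / 4" .
    moreover have "norm (\<phi> n (f a) - a) < \<epsilon> / 8" using f(2)[of a] a \<delta>(2) by simp
    ultimately show ?thesis
      using norm_commutator_perturb[OF norm_projection_le_1[OF proj(1)[OF s]], of a "\<phi> n (f a)"] \<epsilon> by linarith
  qed
  have "\<bar>h y - h t0\<bar> \<le> \<rho> / 4" if "\<bar>y - t0\<bar> \<le> (2 * real R + 1) / 2 ^ k" for y
  proof -
    have "(2 * real R + 1) / 2 ^ k < d2" using k(1) d2(1) by (simp add: field_simps)
    then show ?thesis using d2(2)[of y t0] that by (simp add: dist_real_def)
  qed
  then obtain v where v: "norm v \<le> 1" "norm (star (\<phi> n g * v) * (\<phi> n g * v) - \<rho> *\<^sub>R r) \<le> \<rho> / 4"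
    using defect_comparison[OF n cells g(1) \<xi> t0, of "\<rho> / 4"] \<rho>0 Rk
    unfolding h_def \<rho>_def r_def R_def by auto
  have xs: "star x = x" by (rule positive_imp_selfadjoint[OF x(1)])
  have gx: "norm (x - \<phi> n g) \<le> X / 16" "norm (\<phi> n g) \<le> 17 / 16 * X"
    using g(2) \<delta>(3) norm_triangle_ineq[of "\<phi> n g - x" x] by (simp_all add: norm_minus_commute X_def)
  have "norm (star (x * v) * (x * v) - star (\<phi> n g * v) * (\<phi> n g * v)) \<le> X / 16 * (X + 17 / 16 * X)"
    using norm_compress_perturb[OF v(1), of x "\<phi> n g"] mult_mono[OF gx(1) add_mono[OF order.refl gx(2)], of X] X
    by (simp add: X_def)
  also have "\<dots> = 33 / 256 * X\<^sup>2" by (simp add: power2_eq_square field_simps)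
  finally have "norm (star (x * v) * (x * v) - \<rho> *\<^sub>R r) \<le> 33 / 256 * X\<^sup>2 + \<rho> / 4"
    using v(2) norm_triangle_ineq[of "star (x * v) * (x * v) - star (\<phi> n g * v) * (\<phi> n g * v)"
      "star (\<phi> n g * v) * (\<phi> n g * v) - \<rho> *\<^sub>R r"] by simp
  \<comment> \<open>By the lower bound for \<open>\<rho>\<close> the first summand is below 33/196
    of \<open>\<rho>\<close>, so the sum is below half of \<open>\<rho>\<close>.\<close>
  also have "\<dots> < \<rho>" using \<rho> \<rho>0 by linarith
  finally have "norm (star v * x * x * v - \<rho> *\<^sub>R r) < \<rho>" by (simp add: star_mult xs mult.assoc)
  moreover have "projection r"
  proof -
    have p1: "projection (e 1)" "projection (e (- 1))" using proj(1) by auto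
    have "e (- 1) * e 1 = 0" using arg_cong[OF proj(2), of star] p1 by (simp add: star_mult projection_def)
    then show ?thesis using p1 proj(2) unfolding proj(4)[symmetric]
      by (simp add: projection_def star_diff star_add algebra_simps)
  qed
  ultimately have "\<exists>q. projection q \<and> q \<in> hereditary_generated x \<and> murray_von_neumann r q"
    by (intro murray_von_neumann_hereditary[OF x(1)])
  then show "\<exists>e0 e1. projection e0 \<and> projection e1 \<and> e0 * e1 = 0 \<and> norm (\<alpha> e0 - e1) < \<epsilon> \<and> norm (\<alpha> e1 - e0) < \<epsilon> \<and>
      (\<forall>a\<in>F. norm (e0 * a - a * e0) < \<epsilon> \<and> norm (e1 * a - a * e1) < \<epsilon>) \<and>
      (\<exists>q. projection q \<and> q \<in> hereditary_generated x \<and> murray_von_neumann (1 - e0 - e1) q)"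
    using proj(1)[of 1] proj(1)[of "- 1"] proj(2) proj(3)[of 1] proj(3)[of "- 1"] proj(4) commut \<epsilon>
    by (intro exI[of _ "e 1"] exI[of _ "e (- 1)"]) simp
qed

end

theorem proposition3p4:
  fixes c :: "real \<Rightarrow> complex mat"
    and \<phi> :: "nat \<Rightarrow> circle_mat \<Rightarrow> 'a::cstar_algebra"
    and \<alpha> :: "'a \<Rightarrow> 'a"
  assumes "swap_path c"
    and "direct_limit (psi c) \<phi>"
    and "limit_map alpha \<phi> \<alpha>"
  shows "order_two_automorphism \<alpha> \<and> tracial_Rokhlin_Z2 \<alpha>"
proof -
  interpret blackadar_limit c \<phi> \<alpha> using assms by unfold_locales
  show ?thesis using order_two tracial_Rokhlin by blast
qed

end
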